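(* In dimension $n=3$, the Newtonian capacity $\mathrm{Cap}$ (which is $1$-homogeneous) does not satisfy the Kneser-Süss inequality; that is, it is not true that $$\mathrm{Cap}^{2}(K\stackrel{.}{+}L)\ \ge\ \mathrm{Cap}^{2}(K)+\mathrm{Cap}^{2}(L)\qquad\forall\,K,L\in\mathcal{K}_0^3 .$$
   Context: $\mathcal{K}_0^3$ is the class of compact convex sets in $\mathbb{R}^3$ with nonempty interior. The Newtonian (electrostatic) capacity is $\mathrm{Cap}(K)=\int_{\mathbb{R}^3\setminus K}|\nabla u_K|^2\,dx$, where $u_K$ is the electrostatic potential of $K$: $\Delta u_K=0$ in $\mathbb{R}^3\setminus K$, $u_K=1$ on $\partial K$, $u_K(x)\to 0$ as $|x|\to\infty$. An $\alpha$-homogeneous functional $F$ on convex bodies of $\mathbb{R}^n$ is said to satisfy the Kneser-Süss inequality if $F^{(n-1)/\alpha}(K\stackrel{.}{+}L)\ge F^{(n-1)/\alpha}(K)+F^{(n-1)/\alpha}(L)$ for all $K,L\in\mathcal{K}_0^n$; here $n=3$, $\alpha=1$. Blaschke addition: for $K\in\mathcal{K}_0^n$ with Gauss map $\nu_K:\partial K\to\mathbb{S}^{n-1}$ (defined $\mathcal{H}^{n-1}$-a.e.), the surface area measure is $\mu(K)[\omega]=\mathcal{H}^{n-1}(\nu_K^{-1}(\omega))$ for Borel $\omega\subseteq\mathbb{S}^{n-1}$; $K\stackrel{.}{+}L\in\mathcal{K}_0^n$ is the convex body, unique up to translation, such that $\mu(K\stackrel{.}{+}L)=\mu(K)+\mu(L)$.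 *)

theory Defs
  imports "HOL-Analysis.Analysis"
begin

section \<open>Convex bodies, surface area measure and Blaschke addition\<close>

definition convex_body :: "'a::euclidean_space set \<Rightarrow> bool" where
  "convex_body K \<longleftrightarrow> compact K \<and> convex K \<and> interior K \<noteq> {}"

text \<open>
  The Hausdorff measure is normalised so that it agrees with Lebesgue measure in \<open>d\<close>-dimensional
  Euclidean space. Boundedness is required of the covering sets because \<^const>\<open>diameter\<close> is
  unspecified on unbounded sets; the case distinction makes empty sets free also for \<open>d = 0\<close>.
\<close>

definition hausdorff_content :: "nat \<Rightarrow> real \<Rightarrow> 'a::metric_space set \<Rightarrow> ennreal" where
  "hausdorff_content d \<delta> S =
     (INF C \<in> {C :: nat \<Rightarrow> 'a set. S \<subseteq> (\<Union>i. C i) \<and> (\<forall>i. bounded (C i) \<and> diameter (C i) \<le> \<delta>)}.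
        \<Sum>i. if C i = {} then 0
             else ennreal (unit_ball_vol (real d) * (diameter (C i) / 2) ^ d))"

definition hausdorff_measure :: "nat \<Rightarrow> 'a::metric_space set \<Rightarrow> ennreal" where
  "hausdorff_measure d S = (SUP \<delta>\<in>{0<..}. hausdorff_content d \<delta> S)"

definition is_outer_normal :: "'a::euclidean_space set \<Rightarrow> 'a \<Rightarrow> 'a \<Rightarrow> bool" where
  "is_outer_normal K x v \<longleftrightarrow> norm v = 1 \<and> (\<forall>y\<in>K. (y - x) \<bullet> v \<le> 0)"

text \<open>The boundary points where the Gauss map is defined: almost all of them, for a convex body.\<close>

definition gauss_domain :: "'a::euclidean_space set \<Rightarrow> 'a set" where
  "gauss_domain K = {x \<in> frontier K. \<exists>!v. is_outer_normal K x v}"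

definition gauss_map :: "'a::euclidean_space set \<Rightarrow> 'a \<Rightarrow> 'a" where
  "gauss_map K x = (THE v. is_outer_normal K x v)"

definition surface_area_measure :: "'a::euclidean_space set \<Rightarrow> 'a set \<Rightarrow> ennreal" where
  "surface_area_measure K \<omega> =
     hausdorff_measure (DIM('a) - 1) {x \<in> gauss_domain K. gauss_map K x \<in> \<omega>}"

text \<open>
  Blaschke addition determines a body only up to translation, so it is a relation here:
  \<open>M\<close> is one of the (mutually translated) Blaschke sums of \<open>K\<close> and \<open>L\<close>.
\<close>

definition is_blaschke_sum ::
    "'a::euclidean_space set \<Rightarrow> 'a set \<Rightarrow> 'a set \<Rightarrow> bool" where
  "is_blaschke_sum K L M \<longleftrightarrow> convex_body M \<and>
     (\<forall>\<omega>\<in>sets borel. \<omega> \<subseteq> sphere 0 1 \<longrightarrow>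
        surface_area_measure M \<omega> = surface_area_measure K \<omega> + surface_area_measure L \<omega>)"


section \<open>Newtonian capacity\<close>

text \<open>
  Classical harmonicity on an open set \<open>S\<close>: \<open>u\<close> is twice continuously differentiable, with
  gradient \<open>g\<close> and Hessian \<open>h\<close>, and the trace of the Hessian vanishes.
\<close>

definition harmonic_on :: "('a::euclidean_space \<Rightarrow> real) \<Rightarrow> 'a set \<Rightarrow> bool" where
  "harmonic_on u S \<longleftrightarrow>
     (\<exists>(g :: 'a \<Rightarrow> 'a) (h :: 'a \<Rightarrow> 'a \<Rightarrow>\<^sub>L 'a).
        (\<forall>x\<in>S. GDERIV u x :> g x) \<and>
        (\<forall>x\<in>S. (g has_derivative blinfun_apply (h x)) (at x)) \<and>
        continuous_on S h \<and>
        (\<forall>x\<in>S. (\<Sum>b\<in>Basis. blinfun_apply (h x) b \<bullet> b) = 0))"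

definition gradient :: "('a::euclidean_space \<Rightarrow> real) \<Rightarrow> 'a \<Rightarrow> 'a" where
  "gradient u x = (THE D. GDERIV u x :> D)"

text \<open>
  The boundary value is attained continuously from outside \<open>K\<close>. The values of \<open>u\<close> in the
  interior of \<open>K\<close> are irrelevant.
\<close>

definition is_electrostatic_potential ::
    "(real ^ 3) set \<Rightarrow> (real ^ 3 \<Rightarrow> real) \<Rightarrow> bool" where
  "is_electrostatic_potential K u \<longleftrightarrow>
     harmonic_on u (- K) \<and>
     continuous_on (- interior K) u \<and>
     (\<forall>x\<in>frontier K. u x = 1) \<and>
     (u \<longlongrightarrow> 0) at_infinity"

text \<open>
  For a convex body the potential exists and is unique outside the interior, so the choice below
  does not affect the capacity, which only involves the potential on the open set \<open>- K\<close>.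
\<close>

definition electrostatic_potential :: "(real ^ 3) set \<Rightarrow> real ^ 3 \<Rightarrow> real" where
  "electrostatic_potential K = (SOME u. is_electrostatic_potential K u)"

definition newtonian_capacity :: "(real ^ 3) set \<Rightarrow> ennreal" where
  "newtonian_capacity K =
     (\<integral>\<^sup>+ x \<in> - K. ennreal ((norm (gradient (electrostatic_potential K) x))\<^sup>2) \<partial>lborel)"

end

theory Submission
  imports Defs "HOL-Real_Asymp.Real_Asymp"
begin

text \<open>
  Boxes are closed under Blaschke addition of boxes with parallel edges, which adds the areas of
  corresponding faces. Two orthogonal needles with edges \<open>(n\<^sup>2, 1, 1)\<close> and \<open>(1, n\<^sup>2, 1)\<close> have a
  Blaschke sum of diameter \<open>O(n)\<close>, hence of capacity \<open>O(n)\<close>, while the capacity of a needle is at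
  least of order \<open>n\<^sup>2 / ln n\<close>: this is seen by testing the Dirichlet energy along straight lines that
  leave the needle orthogonally and fan out at distances comparable to its length.

  Homogeneity needs the existence of the potential. It is obtained as the smallest function that is
  excessive for the Gaussian semigroup and at least \<open>1\<close> on the body, approximated by the hitting
  probabilities of the walk with time step \<open>2\<^sup>-\<^sup>j\<close>. These are, up to time averages over one
  step, Newtonian potentials of densities carried by the body, which gives harmonicity off the body and a
  bound for the Dirichlet energy.
\<close>

section \<open>Uniqueness of the potential\<close>

text \<open>\<open>newtonian_capacity\<close> refers to a chosen potential, so both capacity bounds
  depend on existence as well; the construction therefore also returns the approximating charges,
  from which the upper bound is read off. The kernels 1/|x| and |x|^-2 are written as time integrals
  of Gaussians: their convolution identities then come from the semigroup law, and with
  \<open>ennreal\<close> values Tonelli's theorem lets integrals be interchanged freely. The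
  analytic constants stay unevaluated, since only the orders n and n^2 / ln n are compared. Likewise
  the Hausdorff measure of a unit square remains a common factor on both sides of the Blaschke
  identity, and the comparison of face areas becomes a count of cells in a tiling.

  For needles with half-edges (n^2, 1, 1) and (1, n^2, 1) the sum has half-edges (a, a, c) with a^2
  = 2 n^2 and a c = n^2 + 1. The choice n^2 = 2 k^2 gives a = 2 k, and scaling by 2 k turns all
  half-edges of the three boxes into integers, as the tiling requires.\<close>

lemma second_derivative_nonpos_at_max:
  fixes f :: "real \<Rightarrow> real"
  assumes e: "e > 0"
    and f: "\<And>s. \<bar>s\<bar> < e \<Longrightarrow> (f has_real_derivative f' s) (at s)"
    and f': "(f' has_real_derivative d) (at 0)"
    and mx: "\<And>s. \<bar>s\<bar> < e \<Longrightarrow> f s \<le> f 0"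
  shows "d \<le> 0"
proof (rule ccontr)
  assume "\<not> d \<le> 0"
  then have "0 < d" by simp
  have f0: "f' 0 = 0"
    using DERIV_local_max[OF f[of 0], of e] e mx by (auto simp: abs_minus_commute)
  obtain r where r: "r > 0" "\<And>h. 0 < h \<Longrightarrow> h < r \<Longrightarrow> f' 0 < f' (0 + h)"
    using DERIV_pos_inc_right[OF f' \<open>0 < d\<close>] by blast
  define s where "s = min r e / 2"
  have s: "0 < s" "s < r" "s < e" using r e by (auto simp: s_def)
  obtain z where z: "0 < z" "z < s" "f s - f 0 = (s - 0) * f' z"
    using MVT2[of 0 s f f'] f s by (metis abs_of_nonneg order_le_less_trans s(1))
  have "f' z > 0" using r(2)[of z] z s f0 by simp
  then have "f s > f 0" using z s by (smt (verit) mult_pos_pos)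
  then show False using mx[of s] s by simp
qed

text \<open>Adding \<delta> |x|^2 makes a harmonic function strictly subharmonic, which excludes an
  interior maximum: there each second derivative along an axis is nonpositive, while their sum is 2
  \<delta> times the dimension. The domain is unbounded, so the decay at infinity plays the part of
  an outer boundary.\<close>

lemma harmonic_on_max_principle:
  fixes w :: "'a::euclidean_space \<Rightarrow> real"
  assumes harm: "harmonic_on w (- K)" and K: "closed K"
    and cont: "continuous_on (- interior K) w"
    and bd: "\<And>x. x \<in> frontier K \<Longrightarrow> w x \<le> 0"
    and lim: "(w \<longlongrightarrow> 0) at_infinity" and x1: "x1 \<in> - K"
  shows "w x1 \<le> 0"
proof (rule ccontr)
  assume "\<not> w x1 \<le> 0"
  then have pos: "w x1 > 0" by simp
  obtain g h where g: "\<And>x. x \<in> - K \<Longrightarrow> GDERIV w x :> g x"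
    and h: "\<And>x. x \<in> - K \<Longrightarrow> (g has_derivative blinfun_apply (h x)) (at x)"
    and tr: "\<And>x. x \<in> - K \<Longrightarrow> (\<Sum>b\<in>Basis. blinfun_apply (h x) b \<bullet> b) = 0"
    using harm unfolding harmonic_on_def by blast
  have "\<forall>\<^sub>F x in at_infinity. w x < w x1 / 2"
    using order_tendstoD(2)[OF lim, of "w x1 / 2"] pos by simp
  then obtain R0 where R0: "\<And>x. norm x \<ge> R0 \<Longrightarrow> w x < w x1 / 2"
    unfolding eventually_at_infinity by blast
  define R where "R = max R0 (norm x1)"
  have R: "norm x1 \<le> R" "0 \<le> R" "\<And>x. norm x \<ge> R \<Longrightarrow> w x < w x1 / 2"
    using R0 by (auto simp: R_def intro: max.coboundedI2)
  \<comment> \<open>On the ball of radius R the perturbation stays below half of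
    \<open>w x1\<close>. Since w \<le> 0 on the frontier and w < \<open>w x1 / 2\<close> at norms
    from R on, the maximiser of \<open>F\<close> is forced into the open region. The summand 1 keeps
    the denominator positive when R = 0.\<close>
  define \<delta> where "\<delta> = w x1 / (4 * (R\<^sup>2 + 1))"
  have R1: "R\<^sup>2 + 1 > 0" by (smt (verit) zero_le_power2)
  have \<delta>: "\<delta> > 0" using pos R1 by (simp add: \<delta>_def)
  have \<delta>R: "\<delta> * R\<^sup>2 < w x1 / 2"
  proof -
    have "\<delta> * R\<^sup>2 \<le> \<delta> * (R\<^sup>2 + 1)" using \<delta> by simp
    also have "\<dots> = w x1 / 4" using R1 by (simp add: \<delta>_def field_simps)
    finally show ?thesis using pos by simp
  qed
  define F where "F x = w x + \<delta> * (x \<bullet> x)" for x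
  define S where "S = cball 0 R \<inter> - interior K"
  have "compact S" unfolding S_def by (intro compact_Int_closed) (auto simp: closed_Compl)
  moreover have "x1 \<in> S" using x1 R interior_subset by (auto simp: S_def)
  moreover have "continuous_on S F" unfolding F_def S_def
    by (intro continuous_intros continuous_on_subset[OF cont]) auto
  ultimately obtain z where z: "z \<in> S" "\<And>y. y \<in> S \<Longrightarrow> F y \<le> F z"
    by (metis continuous_attains_sup empty_iff)
  have Fz: "F z \<ge> w x1" using z(2)[OF \<open>x1 \<in> S\<close>] \<delta> by (smt (verit) F_def inner_ge_zero mult_nonneg_nonneg)
  have zz: "z \<bullet> z \<le> R\<^sup>2" using z(1) by (simp add: S_def dot_square_norm power_mono)
  have Fz2: "F z \<le> w z + \<delta> * R\<^sup>2" using zz \<delta> by (simp add: F_def)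
  have "z \<notin> frontier K" using bd[of z] Fz Fz2 \<delta>R pos by auto
  then have zK: "z \<in> - K" using z(1) K by (auto simp: S_def frontier_def closure_closed)
  have zR: "norm z < R" using R(3)[of z] Fz Fz2 \<delta>R by force
  have "open (- K \<inter> ball 0 R)" using K by auto
  moreover have "z \<in> - K \<inter> ball 0 R" using zK zR by simp
  ultimately obtain e where e: "e > 0" "ball z e \<subseteq> - K \<inter> ball 0 R"
    using open_contains_ball by blast
  have "blinfun_apply (h z) b \<bullet> b + 2 * \<delta> \<le> 0" if b: "b \<in> Basis" for b
  proof (rule second_derivative_nonpos_at_max[where e = e and f = "\<lambda>s. F (z + s *\<^sub>R b)" and
        f' = "\<lambda>s. g (z + s *\<^sub>R b) \<bullet> b + 2 * \<delta> * ((z + s *\<^sub>R b) \<bullet> b)"])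
    have inb: "z + s *\<^sub>R b \<in> - K \<and> z + s *\<^sub>R b \<in> S" if "\<bar>s\<bar> < e" for s
    proof -
      have "z + s *\<^sub>R b \<in> ball z e" using that b by (simp add: dist_norm)
      then show ?thesis using e interior_subset by (force simp: S_def)
    qed
    fix s :: real assume s: "\<bar>s\<bar> < e"
    have 1: "((\<lambda>s. z + s *\<^sub>R b) has_derivative (\<lambda>s. s *\<^sub>R b)) (at s)"
      by (auto intro!: derivative_eq_intros)
    have 2: "(w has_derivative (\<lambda>k. k \<bullet> g (z + s *\<^sub>R b))) (at (z + s *\<^sub>R b))"
      using g inb[OF s] by (simp add: gderiv_def)
    have 3: "((\<lambda>s. w (z + s *\<^sub>R b)) has_derivative (\<lambda>k. (k *\<^sub>R b) \<bullet> g (z + s *\<^sub>R b))) (at s)"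
      using has_derivative_compose[OF 1 2] by simp
    have 4: "((\<lambda>s. (z + s *\<^sub>R b) \<bullet> (z + s *\<^sub>R b)) has_derivative (\<lambda>k. k * (2 * ((z + s *\<^sub>R b) \<bullet> b)))) (at s)"
      by (rule derivative_eq_intros refl | rule 1)+ (auto simp: algebra_simps inner_commute)
    show "((\<lambda>s. F (z + s *\<^sub>R b)) has_real_derivative g (z + s *\<^sub>R b) \<bullet> b + 2 * \<delta> * ((z + s *\<^sub>R b) \<bullet> b)) (at s)"
      unfolding has_field_derivative_def F_def
      by (rule has_derivative_eq_rhs[OF has_derivative_add[OF 3 has_derivative_mult_right[OF 4]]])
        (auto simp: algebra_simps inner_commute)
    show "F (z + s *\<^sub>R b) \<le> F (z + 0 *\<^sub>R b)" using z(2) inb[OF s] by simp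
  next
    have 1: "((\<lambda>s. z + s *\<^sub>R b) has_derivative (\<lambda>s. s *\<^sub>R b)) (at 0)"
      by (auto intro!: derivative_eq_intros)
    have 2: "(g has_derivative blinfun_apply (h z)) (at (z + 0 *\<^sub>R b))"
      using h[OF zK] by simp
    have 3: "((\<lambda>s. g (z + s *\<^sub>R b)) has_derivative (\<lambda>k. blinfun_apply (h z) (k *\<^sub>R b))) (at 0)"
      by (rule has_derivative_compose[OF 1 2])
    show "((\<lambda>s. g (z + s *\<^sub>R b) \<bullet> b + 2 * \<delta> * ((z + s *\<^sub>R b) \<bullet> b)) has_real_derivative
          blinfun_apply (h z) b \<bullet> b + 2 * \<delta>) (at 0)"
      unfolding has_field_derivative_def
      by (rule derivative_eq_intros refl 3 1)+
        (use b in \<open>auto simp: blinfun.scaleR_right algebra_simps\<close>)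
  qed (rule e)
  then have "(\<Sum>b\<in>Basis. blinfun_apply (h z) b \<bullet> b + 2 * \<delta>) \<le> 0" by (rule sum_nonpos)
  then have "2 * \<delta> * DIM('a) \<le> 0" using tr[OF zK] by (simp add: sum.distrib algebra_simps)
  then show False using \<delta> by (simp add: mult_le_0_iff)
qed

lemma harmonic_on_diff:
  assumes "harmonic_on u S" "harmonic_on v S"
  shows "harmonic_on (\<lambda>x. u x - v x) S"
proof -
  obtain g h where 1: "\<And>x. x \<in> S \<Longrightarrow> GDERIV u x :> g x"
    "\<And>x. x \<in> S \<Longrightarrow> (g has_derivative blinfun_apply (h x)) (at x)" "continuous_on S h"
    "\<And>x. x \<in> S \<Longrightarrow> (\<Sum>b\<in>Basis. blinfun_apply (h x) b \<bullet> b) = 0"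
    using assms(1) unfolding harmonic_on_def by blast
  obtain g' h' where 2: "\<And>x. x \<in> S \<Longrightarrow> GDERIV v x :> g' x"
    "\<And>x. x \<in> S \<Longrightarrow> (g' has_derivative blinfun_apply (h' x)) (at x)" "continuous_on S h'"
    "\<And>x. x \<in> S \<Longrightarrow> (\<Sum>b\<in>Basis. blinfun_apply (h' x) b \<bullet> b) = 0"
    using assms(2) unfolding harmonic_on_def by blast
  show ?thesis unfolding harmonic_on_def
    by (rule exI[of _ "\<lambda>x. g x - g' x"], rule exI[of _ "\<lambda>x. h x - h' x"])
      (use 1 2 in \<open>auto intro!: GDERIV_diff continuous_intros has_derivative_eq_rhs[OF has_derivative_diff]
        simp: blinfun.diff_left inner_diff_left sum_subtractf\<close>)
qed

lemma electrostatic_potential_unique: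
  assumes u: "is_electrostatic_potential K u" and v: "is_electrostatic_potential K v"
    and K: "closed K" and x: "x \<in> - K"
  shows "u x = v x"
proof -
  have "u x - v x \<le> 0" if "is_electrostatic_potential K u" "is_electrostatic_potential K v" for u v
    by (rule harmonic_on_max_principle[where w = "\<lambda>x. u x - v x" and K = K])
      (use that K x in \<open>auto simp: is_electrostatic_potential_def intro!: harmonic_on_diff continuous_intros tendsto_eq_intros\<close>)
  from this[OF u v] this[OF v u] show ?thesis by simp
qed

lemma GDERIV_unique: "GDERIV f x :> D \<Longrightarrow> GDERIV f x :> D' \<Longrightarrow> D = D'"
  unfolding gderiv_def by (metis has_derivative_unique inner_commute vector_eq_ldot)

lemma gradient_eq: "GDERIV f x :> D \<Longrightarrow> gradient f x = D"
  unfolding gradient_def using GDERIV_unique by blast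

text \<open>By uniqueness the chosen potential agrees with u on the open set \<open>- K\<close>,
  hence has the same gradient there. All capacity estimates pass through this lemma to a constructed
  potential with a known gradient.\<close>

lemma newtonian_capacity_eq:
  assumes u: "is_electrostatic_potential K u" and K: "closed K"
    and g: "\<And>x. x \<in> - K \<Longrightarrow> GDERIV u x :> g x"
  shows "newtonian_capacity K = (\<integral>\<^sup>+ x \<in> - K. ennreal ((norm (g x))\<^sup>2) \<partial>lborel)"
proof -
  have *: "is_electrostatic_potential K (electrostatic_potential K)"
    unfolding electrostatic_potential_def by (rule someI[of _ u]) (rule u)
  have "gradient (electrostatic_potential K) x = g x" if x: "x \<in> - K" for x
  proof (rule gradient_eq)
    have "(u has_derivative (\<lambda>h. h \<bullet> g x)) (at x)" using g[OF x] by (simp add: gderiv_def)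
    then show "GDERIV (electrostatic_potential K) x :> g x" unfolding gderiv_def
      by (rule has_derivative_transform_within_open[where s = "- K"])
        (use K x electrostatic_potential_unique[OF u *] in auto)
  qed
  then show ?thesis unfolding newtonian_capacity_def
    by (intro nn_integral_cong) (auto simp: indicator_def)
qed

text \<open>The dilated body has the potential x \<mapsto> u(x / t): the squared gradient
  contributes t^-2 and the volume element t^3, which leaves one factor t.\<close>

lemma newtonian_capacity_scaleR:
  fixes K :: "(real ^ 3) set"
  assumes u: "is_electrostatic_potential K u" and K: "closed K" and t: "t > 0"
  shows "newtonian_capacity ((\<lambda>x. t *\<^sub>R x) ` K) = ennreal t * newtonian_capacity K"
proof -
  obtain g h where g: "\<And>x. x \<in> - K \<Longrightarrow> GDERIV u x :> g x"
    and h: "\<And>x. x \<in> - K \<Longrightarrow> (g has_derivative blinfun_apply (h x)) (at x)"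
    and hc: "continuous_on (- K) h"
    and tr: "\<And>x. x \<in> - K \<Longrightarrow> (\<Sum>b\<in>Basis. blinfun_apply (h x) b \<bullet> b) = 0"
    using u unfolding is_electrostatic_potential_def harmonic_on_def by blast
  let ?T = "\<lambda>x::real^3. t *\<^sub>R x" and ?K = "(\<lambda>x. t *\<^sub>R x) ` K"
  let ?S = "\<lambda>x::real^3. (1/t) *\<^sub>R x"
  have mem: "x \<in> ?T ` A \<longleftrightarrow> ?S x \<in> A" for x A
  proof
    assume "?S x \<in> A"
    then have "?T (?S x) \<in> ?T ` A" by blast
    then show "x \<in> ?T ` A" using t by simp
  qed (use t in auto)
  have cl: "closed ?K" using K t by (simp add: closed_scaling)
  have int: "interior ?K = ?T ` interior K" using t by (intro interior_injective_linear_image) (auto simp: linear_iff inj_def algebra_simps)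
  have fr: "frontier ?K = ?T ` frontier K"
    using t K cl by (subst (1 2) frontier_def, subst int, subst image_set_diff) (auto simp: inj_def)
  define u' where "u' x = u (?S x)" for x
  define g' where "g' x = (1/t) *\<^sub>R g (?S x)" for x
  define h' where "h' x = (1/t\<^sup>2) *\<^sub>R h (?S x)" for x
  have dS: "(?S has_derivative ?S) (at x)" for x
    by (auto intro!: derivative_eq_intros)
  have g': "GDERIV u' x :> g' x" if "x \<in> - ?K" for x
  proof -
    have "(u has_derivative (\<lambda>h. h \<bullet> g (?S x))) (at (?S x))"
      using g[of "?S x"] that by (simp add: gderiv_def mem)
    from has_derivative_compose[OF dS this] show ?thesis
      by (simp add: gderiv_def u'_def[abs_def] g'_def)
  qed
  have h': "(g' has_derivative blinfun_apply (h' x)) (at x)" if "x \<in> - ?K" for x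
  proof -
    have "(g has_derivative blinfun_apply (h (?S x))) (at (?S x))"
      using h[of "?S x"] that by (simp add: mem)
    from has_derivative_scaleR_right[OF has_derivative_compose[OF dS this], of "1/t"] show ?thesis
      unfolding g'_def[abs_def] h'_def
      by (rule has_derivative_eq_rhs)
        (simp add: blinfun.scaleR_left blinfun.scaleR_right power2_eq_square fun_eq_iff)
  qed
  have pot: "is_electrostatic_potential ?K u'"
    unfolding is_electrostatic_potential_def
  proof (intro conjI)
    show "harmonic_on u' (- ?K)" unfolding harmonic_on_def
    proof (intro exI[of _ g'] exI[of _ h'] conjI ballI g' h')
      show "continuous_on (- ?K) h'" unfolding h'_def
        by (intro continuous_intros continuous_on_compose2[OF hc]) (auto simp: mem)
      fix x assume "x \<in> - ?K"
      then show "(\<Sum>b\<in>Basis. blinfun_apply (h' x) b \<bullet> b) = 0"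
        using tr[of "?S x"] by (simp add: h'_def blinfun.scaleR_left mem flip: sum_divide_distrib)
    qed
    show "continuous_on (- interior ?K) u'" unfolding u'_def
      by (rule continuous_on_compose2[where g = u and t = "- interior K"])
        (use u in \<open>auto simp: is_electrostatic_potential_def int mem intro!: continuous_intros\<close>)
    show "\<forall>x\<in>frontier ?K. u' x = 1"
      using u unfolding fr by (auto simp: mem u'_def is_electrostatic_potential_def)
    show "(u' \<longlongrightarrow> 0) at_infinity" unfolding u'_def
    proof (rule filterlim_compose[where g = u])
      show "(u \<longlongrightarrow> 0) at_infinity" using u by (simp add: is_electrostatic_potential_def)
      have "filterlim (\<lambda>x::real^3. norm ((1/t) *\<^sub>R x)) at_top at_infinity"
        unfolding norm_scaleR using t
        by (intro filterlim_tendsto_pos_mult_at_top[OF tendsto_const] filterlim_norm_at_top) auto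
      then show "filterlim ?S at_infinity at_infinity"
        using filterlim_at_infinity_conv_norm_at_top by blast
    qed
  qed
  let ?F = "\<lambda>x. ennreal ((norm (g' x))\<^sup>2) * indicator (- ?K) x"
  have gm: "(\<lambda>x. ennreal ((norm (g x))\<^sup>2) * indicator (- K) x) \<in> borel_measurable borel"
  proof -
    have "continuous_on (- K) g"
      using h K by (meson continuous_at_imp_continuous_on has_derivative_continuous)
    then have "(\<lambda>x. indicator (- K) x *\<^sub>R g x) \<in> borel_measurable borel"
      using K by (intro borel_measurable_continuous_on_indicator) auto
    then have "(\<lambda>x. ennreal ((norm (indicator (- K) x *\<^sub>R g x))\<^sup>2)) \<in> borel_measurable borel"
      by measurable
    moreover have "(\<lambda>x. ennreal ((norm (indicator (- K) x *\<^sub>R g x))\<^sup>2)) =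
        (\<lambda>x. ennreal ((norm (g x))\<^sup>2) * indicator (- K) x)"
      by (auto simp: indicator_def)
    ultimately show ?thesis by (simp only:)
  qed
  have eqF: "?F x = ennreal (1 / t\<^sup>2) * (ennreal ((norm (g (?S x)))\<^sup>2) * indicator (- K) (?S x))" for x
    using t by (auto simp: g'_def mem indicator_def power_mult_distrib power_divide simp flip: ennreal_mult)
  have Fm: "?F \<in> borel_measurable borel"
    unfolding eqF by (rule borel_measurable_times_ennreal[OF _ measurable_compose[OF _ gm]]) simp_all
  have "newtonian_capacity ?K = (\<integral>\<^sup>+ x. ?F x \<partial>lborel)"
    using newtonian_capacity_eq[OF pot cl g'] by simp
  also have "\<dots> = (\<integral>\<^sup>+ x. ?F x \<partial>density (distr lborel borel (\<lambda>x. 0 + t *\<^sub>R x)) (\<lambda>_. ennreal (\<bar>t\<bar> ^ DIM(real^3))))"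
    using lborel_affine[of t "0 :: real^3"] t by simp
  also have "\<dots> = (\<integral>\<^sup>+ x. ennreal (t ^ 3) * ?F (t *\<^sub>R x) \<partial>lborel)"
    using Fm t by (simp add: nn_integral_density nn_integral_distr)
  also have "\<dots> = (\<integral>\<^sup>+ x. ennreal t * (ennreal ((norm (g x))\<^sup>2) * indicator (- K) x) \<partial>lborel)"
  proof (rule nn_integral_cong)
    fix x
    have "ennreal (t ^ 3) * ennreal (1 / t\<^sup>2) = ennreal t"
      using t by (simp add: power3_eq_cube power2_eq_square flip: ennreal_mult)
    then show "ennreal (t ^ 3) * ?F (t *\<^sub>R x) = ennreal t * (ennreal ((norm (g x))\<^sup>2) * indicator (- K) x)"
      unfolding eqF using t by (simp add: mult.assoc[symmetric])
  qed
  also have "\<dots> = ennreal t * newtonian_capacity K"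
    using gm newtonian_capacity_eq[OF u K g] by (simp add: nn_integral_cmult)
  finally show ?thesis .
qed

section \<open>The heat kernel\<close>

lemma nn_integral_lborel_affine:
  fixes t :: "'a::euclidean_space"
  assumes [measurable]: "f \<in> borel_measurable borel" and c: "c \<noteq> 0"
  shows "(\<integral>\<^sup>+x. f x \<partial>lborel) = ennreal (\<bar>c\<bar> ^ DIM('a)) * (\<integral>\<^sup>+x. f (t + c *\<^sub>R x) \<partial>lborel)"
  by (subst lborel_affine[OF c, of t])
    (simp add: nn_integral_density nn_integral_distr nn_integral_cmult)

text \<open>The inequality x^2 / 4 \<ge> |x| - 1 expresses that (|x| / 2 - 1)^2 is nonnegative; it
  reduces the Gaussian to two one-sided exponentials.\<close>

lemma nn_integral_exp_minus_square_finite: "(\<integral>\<^sup>+x. ennreal (exp (- (x\<^sup>2 / 4))) \<partial>lborel) < \<infinity>"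
proof -
  have e: "(\<integral>\<^sup>+x. ennreal (exp (1 - x)) * indicator {0..} x \<partial>lborel) = ennreal (0 - (- exp 1))"
  proof -
    have "(\<integral>\<^sup>+x. ennreal (exp (1 - x)) * indicator {0..} x \<partial>lborel) = ennreal (0 - (- exp (1 - 0)))"
    proof (rule nn_integral_FTC_atLeast)
      show "((\<lambda>x::real. - exp (1 - x)) \<longlongrightarrow> 0) at_top"
      proof -
        have "((\<lambda>x::real. - (exp 1 * exp (- x))) \<longlongrightarrow> - (exp 1 * 0)) at_top"
          by (intro tendsto_intros filterlim_compose[OF exp_at_bot] filterlim_uminus_at_bot_at_top)
        then show ?thesis by (simp add: exp_diff exp_minus divide_inverse)
      qed
    qed (auto intro!: derivative_eq_intros)
    then show ?thesis by simp
  qed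
  have "(\<integral>\<^sup>+x. ennreal (exp (1 + x)) * indicator {..0} x \<partial>lborel) =
      (\<integral>\<^sup>+x. ennreal (exp (1 - x)) * indicator {0..} x \<partial>lborel)"
    by (subst nn_integral_real_affine[where c = "-1" and t = 0])
      (auto simp: indicator_def intro!: nn_integral_cong)
  with e have e': "(\<integral>\<^sup>+x. ennreal (exp (1 + x)) * indicator {..0} x \<partial>lborel) = ennreal (0 - (- exp 1))"
    by simp
  have "(\<integral>\<^sup>+x. ennreal (exp (- (x\<^sup>2 / 4))) \<partial>lborel) \<le>
    (\<integral>\<^sup>+x. ennreal (exp (1 - x)) * indicator {0..} x + ennreal (exp (1 + x)) * indicator {..0} x \<partial>lborel)"
  proof (rule nn_integral_mono)
    fix x :: real
    have "- (x\<^sup>2 / 4) \<le> 1 - \<bar>x\<bar>"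
      using zero_le_power2[of "\<bar>x\<bar> / 2 - 1"] by (simp add: power2_eq_square algebra_simps)
    then show "ennreal (exp (- (x\<^sup>2 / 4))) \<le> ennreal (exp (1 - x)) * indicator {0..} x + ennreal (exp (1 + x)) * indicator {..0} x"
      by (auto simp: indicator_def abs_if add_increasing2 intro!: ennreal_leI split: if_splits)
  qed
  also have "\<dots> = ennreal (0 - (- exp 1)) + ennreal (0 - (- exp 1))"
    by (subst nn_integral_add) (auto simp: e e')
  also have "\<dots> < \<infinity>" by simp
  finally show ?thesis .
qed

text \<open>The number (4 pi)^(3/2), kept as an integral; its finiteness and positivity carry the
  normalisation of the heat kernel.\<close>

definition gauss_mass :: real where
  "gauss_mass = enn2real (\<integral>\<^sup>+z. ennreal (exp (- ((norm (z::real^3))\<^sup>2 / 4))) \<partial>lborel)"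

lemma nn_integral_gauss_mass: "(\<integral>\<^sup>+z. ennreal (exp (- ((norm (z::real^3))\<^sup>2 / 4))) \<partial>lborel) = ennreal gauss_mass"
  and gauss_mass_pos: "gauss_mass > 0"
proof -
  let ?I = "\<integral>\<^sup>+z. ennreal (exp (- ((norm (z::real^3))\<^sup>2 / 4))) \<partial>lborel"
  have eq: "exp (- ((norm z)\<^sup>2 / 4)) = (\<Prod>b\<in>Basis. exp (- ((z \<bullet> b)\<^sup>2 / 4)))" for z :: "real^3"
  proof -
    have "(norm z)\<^sup>2 = (\<Sum>b\<in>Basis. (z \<bullet> b)\<^sup>2)"
      unfolding power2_norm_eq_inner by (subst euclidean_inner) (simp add: power2_eq_square)
    then show ?thesis
      by (simp add: exp_sum[symmetric] sum_negf sum_divide_distrib[symmetric])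
  qed
  have "?I = (\<Prod>b\<in>(Basis :: (real^3) set). \<integral>\<^sup>+x. ennreal (exp (- (x\<^sup>2 / 4))) \<partial>lborel)"
    unfolding eq by (subst prod_ennreal[symmetric], simp, subst nn_integral_lborel_prod) auto
  also have "\<dots> < \<infinity>"
    using nn_integral_exp_minus_square_finite by (simp add: power_less_top_ennreal less_top)
  finally have fin: "?I < \<infinity>" .
  then show 1: "?I = ennreal gauss_mass" unfolding gauss_mass_def by simp
  have "?I \<noteq> 0"
  proof
    assume "?I = 0"
    then have "AE z in (lborel :: (real^3) measure). ennreal (exp (- ((norm z)\<^sup>2 / 4))) = 0"
      by (subst (asm) nn_integral_0_iff_AE) auto
    then have "AE z in (lborel :: (real^3) measure). False" by simp
    then show False by (simp add: AE_iff_null null_sets_def)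
  qed
  then show "gauss_mass > 0" unfolding gauss_mass_def
    using fin by (simp add: enn2real_positive_iff zero_less_iff_neq_zero)
qed

text \<open>For t > 0 this is the transition density of Brownian motion in space with the full
  Laplacian (not half of it) as generator.\<close>

definition heat :: "real \<Rightarrow> real ^ 3 \<Rightarrow> real" where
  "heat t x = t powr (- (3/2)) * exp (- ((norm x)\<^sup>2 / (4 * t))) / gauss_mass"

lemma heat_nonneg [simp]: "0 \<le> heat t x"
  using gauss_mass_pos by (simp add: heat_def)

lemma measurable_heat [measurable (raw)]:
  assumes [measurable]: "f \<in> borel_measurable M" "g \<in> borel_measurable M"
  shows "(\<lambda>x. heat (f x) (g x)) \<in> borel_measurable M"
  unfolding heat_def by measurable

lemma sqrt_cubed_powr: "t > 0 \<Longrightarrow> sqrt t ^ 3 = t powr (3/2)"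
  by (simp add: powr_half_sqrt[symmetric] powr_powr flip: powr_realpow)

lemma nn_integral_heat:
  assumes t: "t > 0"
  shows "(\<integral>\<^sup>+y. ennreal (heat t (x - y)) \<partial>lborel) = 1"
proof -
  have "(\<integral>\<^sup>+y. ennreal (heat t (x - y)) \<partial>lborel) =
      ennreal (\<bar>sqrt t\<bar> ^ DIM(real^3)) * (\<integral>\<^sup>+z. ennreal (heat t (x - (x + sqrt t *\<^sub>R z))) \<partial>lborel)"
    using t by (intro nn_integral_lborel_affine) auto
  also have "\<dots> = (\<integral>\<^sup>+z. ennreal (exp (- ((norm (z::real^3))\<^sup>2 / 4))) * ennreal (1 / gauss_mass) \<partial>lborel)"
  proof (subst nn_integral_cmult[symmetric], simp, rule nn_integral_cong)
    fix z :: "real^3"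
    have "sqrt t ^ 3 * heat t (x - (x + sqrt t *\<^sub>R z)) = (t powr (3/2) * t powr (-(3/2))) * (exp (- ((norm z)\<^sup>2 / 4)) / gauss_mass)"
      using t by (simp add: heat_def sqrt_cubed_powr power_mult_distrib)
    also have "t powr (3/2) * t powr (-(3/2)) = 1" using t by (simp flip: powr_add)
    finally show "ennreal (\<bar>sqrt t\<bar> ^ DIM(real^3)) * ennreal (heat t (x - (x + sqrt t *\<^sub>R z))) =
        ennreal (exp (- ((norm z)\<^sup>2 / 4))) * ennreal (1 / gauss_mass)"
      using t gauss_mass_pos by (simp flip: ennreal_mult)
  qed
  also have "\<dots> = 1"
    using gauss_mass_pos by (subst nn_integral_multc) (simp_all add: nn_integral_gauss_mass flip: ennreal_mult)
  finally show ?thesis .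
qed

text \<open>Completing the square in the product of two Gaussians.\<close>

lemma heat_mult_heat:
  assumes s: "s > 0" and t: "t > 0"
  shows "heat s (x - z) * heat t (z - y) =
    heat (s + t) (x - y) * heat (s * t / (s + t)) (((t / (s + t)) *\<^sub>R x + (s / (s + t)) *\<^sub>R y) - z)"
proof -
  define r \<sigma> \<tau> where "r = s + t" and "\<sigma> = s / r" and "\<tau> = t / r"
  have r: "r > 0" and \<sigma>: "\<sigma> > 0" and \<tau>: "\<tau> > 0" and sr: "s = \<sigma> * r" and tr: "t = \<tau> * r"
    using s t by (simp_all add: r_def \<sigma>_def \<tau>_def)
  have st1: "\<sigma> + \<tau> = 1"
    using r unfolding \<sigma>_def \<tau>_def by (simp add: add_divide_distrib[symmetric] r_def[symmetric])
  define m where "m = \<tau> *\<^sub>R x + \<sigma> *\<^sub>R y"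
  define w q where "w = m - z" and "q = x - y"
  define A B C where "A = w \<bullet> w" and "B = w \<bullet> q" and "C = q \<bullet> q"
  have \<tau>1: "\<tau> = 1 - \<sigma>" using st1 by simp
  have "x - z = w + \<sigma> *\<^sub>R q" by (simp add: w_def m_def q_def \<tau>1 algebra_simps)
  then have 1: "(norm (x - z))\<^sup>2 = A + 2 * \<sigma> * B + \<sigma>\<^sup>2 * C"
    unfolding power2_norm_eq_inner
    by (simp add: inner_add_left inner_add_right A_def B_def C_def inner_commute[of q w] power2_eq_square distrib_left)
  have "z - y = \<tau> *\<^sub>R q - w" by (simp add: w_def m_def q_def \<tau>1 algebra_simps)
  then have 2: "(norm (z - y))\<^sup>2 = A - 2 * \<tau> * B + \<tau>\<^sup>2 * C"
    unfolding power2_norm_eq_inner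
    by (simp add: inner_diff_left inner_diff_right A_def B_def C_def inner_commute[of q w] power2_eq_square right_diff_distrib)
  have a: "s * t / (s + t) = \<sigma> * \<tau> * r"
    using r by (simp add: r_def[symmetric] \<sigma>_def \<tau>_def)
  have e: "(norm (x - z))\<^sup>2 / (4 * s) + (norm (z - y))\<^sup>2 / (4 * t) =
      C / (4 * (s + t)) + A / (4 * (s * t / (s + t)))"
  proof -
    have "(A + 2 * \<sigma> * B + \<sigma>\<^sup>2 * C) / (4 * (\<sigma> * r)) + (A - 2 * \<tau> * B + \<tau>\<^sup>2 * C) / (4 * (\<tau> * r)) =
        (\<tau> * (A + 2 * \<sigma> * B + \<sigma>\<^sup>2 * C) + \<sigma> * (A - 2 * \<tau> * B + \<tau>\<^sup>2 * C)) / (4 * (\<sigma> * \<tau> * r))"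
      using r \<sigma> \<tau> by (simp add: add_divide_distrib)
    also have "\<tau> * (A + 2 * \<sigma> * B + \<sigma>\<^sup>2 * C) + \<sigma> * (A - 2 * \<tau> * B + \<tau>\<^sup>2 * C) =
        (\<sigma> + \<tau>) * (\<sigma> * \<tau> * C + A)"
      by (simp add: algebra_simps power2_eq_square)
    also have "(\<sigma> + \<tau>) * (\<sigma> * \<tau> * C + A) / (4 * (\<sigma> * \<tau> * r)) = C / (4 * r) + A / (4 * (\<sigma> * \<tau> * r))"
      using r \<sigma> \<tau> by (simp add: st1 add_divide_distrib)
    finally show ?thesis unfolding 1 2 a unfolding sr tr by (simp add: st1 distrib_right[symmetric])
  qed
  have p: "s powr (-(3/2)) * t powr (-(3/2)) = (s + t) powr (-(3/2)) * (s * t / (s + t)) powr (-(3/2))"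
    using s t r_def r by (subst (1 2) powr_mult[symmetric]) auto
  have "heat s (x - z) * heat t (z - y) = (s powr (-(3/2)) * t powr (-(3/2))) *
      exp (- ((norm (x - z))\<^sup>2 / (4 * s) + (norm (z - y))\<^sup>2 / (4 * t))) / gauss_mass\<^sup>2"
    by (simp add: heat_def exp_add[symmetric] power2_eq_square)
  also have "\<dots> = heat (s + t) q * heat (s * t / (s + t)) w"
    unfolding e p unfolding heat_def A_def C_def power2_norm_eq_inner by (simp add: exp_add[symmetric] power2_eq_square)
  finally show ?thesis by (simp add: w_def q_def m_def \<sigma>_def \<tau>_def r_def)
qed

lemma heat_convolution:
  assumes s: "s > 0" and t: "t > 0"
  shows "(\<integral>\<^sup>+z. ennreal (heat s (x - z)) * ennreal (heat t (z - y)) \<partial>lborel) = ennreal (heat (s + t) (x - y))"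
proof -
  have "s * t / (s + t) > 0" using s t by simp
  then show ?thesis
    unfolding ennreal_mult[OF heat_nonneg heat_nonneg, symmetric] heat_mult_heat[OF s t]
    by (simp add: ennreal_mult nn_integral_cmult nn_integral_heat)
qed

text \<open>With growing time the exponential factor increases and only the prefactor falls. This
  gives a one-sided comparison of different times whose factor tends to 1 as t approaches s; it
  stands in for continuity of the heat flow in time.\<close>

lemma heat_le_heat:
  assumes s: "0 < s" and st: "s \<le> t"
  shows "(s / t) powr (3/2) * heat s x \<le> heat t x"
proof -
  have "(s / t) powr (3/2) * s powr (-(3/2)) = t powr (-(3/2))"
    using s st by (simp add: powr_divide powr_minus field_simps)
  moreover have "(norm x)\<^sup>2 / (4 * t) \<le> (norm x)\<^sup>2 / (4 * s)"
    using s st by (intro divide_left_mono) auto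
  ultimately show ?thesis using gauss_mass_pos
    by (simp add: heat_def mult.assoc[symmetric] divide_right_mono mult_left_mono)
qed

text \<open>The time integral of \<open>heat\<close> at a point of norm 1, whose value is 1 / (4
  pi); thus \<open>newton_const / norm x\<close> is the fundamental solution of minus the
  Laplacian.\<close>

definition newton_const :: real where
  "newton_const = enn2real (\<integral>\<^sup>+r\<in>{0<..}. ennreal (r powr (- (3/2)) * exp (- (1 / (4 * r))) / gauss_mass) \<partial>lborel)"

lemma nn_integral_powr_tail:
  assumes "T > 0"
  shows "(\<integral>\<^sup>+r. ennreal (r powr (- (3/2))) * indicator {T..} r \<partial>lborel) = ennreal (2 * T powr (- (1/2)))"
proof -
  have "(\<integral>\<^sup>+r. ennreal (r powr (- (3/2))) * indicator {T..} r \<partial>lborel) = ennreal (0 - (- 2 * T powr (- (1/2))))"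
  proof (rule nn_integral_FTC_atLeast)
    show "((\<lambda>r::real. - 2 * r powr (- (1/2))) \<longlongrightarrow> 0) at_top"
      by (intro tendsto_mult_right_zero tendsto_neg_powr filterlim_ident) auto
  qed (use assms in \<open>auto intro!: derivative_eq_intros\<close>)
  then show ?thesis by simp
qed

lemma newton_const_pos: "newton_const > 0"
  and nn_integral_newton_const:
    "(\<integral>\<^sup>+r\<in>{0<..}. ennreal (r powr (- (3/2)) * exp (- (1 / (4 * r))) / gauss_mass) \<partial>lborel) = ennreal newton_const"
proof -
  let ?f = "\<lambda>r. r powr (- (3/2)) * exp (- (1 / (4 * r))) / gauss_mass"
  let ?I = "\<integral>\<^sup>+r\<in>{0<..}. ennreal (?f r) \<partial>lborel"
  have b: "ennreal (?f r) * indicator {0<..} r \<le> ennreal (32 / gauss_mass) * indicator {0..1} r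
      + ennreal (1 / gauss_mass) * (ennreal (r powr (- (3/2))) * indicator {1..} r)" for r
  proof (cases "0 < r \<and> r \<le> 1")
    case True
    define x where "x = 1 / (4 * r)"
    have x: "x > 0" using True by (simp add: x_def)
    \<comment> \<open>Near time 0 the exponential has to beat r^(-3/2). The quadratic Taylor bound
      at x = 1 / (4 r) yields exp(-x) \<le> 32 r^2, so the integrand is at most a multiple of
      r^(1/2).\<close>
    have "1 + x + x\<^sup>2 / 2 \<le> exp x" by (rule exp_lower_Taylor_quadratic) (use x in simp)
    then have "x\<^sup>2 / 2 \<le> exp x" using x by linarith
    then have "exp (- x) \<le> 2 / x\<^sup>2" using x by (simp add: exp_minus field_simps)
    then have "exp (- (1 / (4 * r))) \<le> 32 * r\<^sup>2" by (simp add: x_def power_divide power2_eq_square field_simps)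
    then have "r powr (- (3/2)) * exp (- (1 / (4 * r))) \<le> r powr (- (3/2)) * (32 * r\<^sup>2)"
      by (rule mult_left_mono) simp
    also have "\<dots> = 32 * (r powr (- (3/2)) * r powr 2)" using True by simp
    also have "\<dots> = 32 * r powr (1/2)" by (simp flip: powr_add)
    also have "\<dots> \<le> 32" using True by (simp add: powr_le1)
    finally show ?thesis using True gauss_mass_pos
      by (auto simp: indicator_def divide_right_mono intro!: order_trans[OF ennreal_leI add_increasing2])
  next
    case False
    show ?thesis
    proof (cases "r > 1")
      case True
      have "?f r \<le> (1 / gauss_mass) * r powr (- (3/2))"
        using True gauss_mass_pos by (simp add: divide_right_mono mult_left_le)
      then show ?thesis using True gauss_mass_pos
        by (simp add: indicator_def ennreal_leI flip: ennreal_mult)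
    qed (use False in \<open>auto simp: indicator_def\<close>)
  qed
  have "?I \<le> (\<integral>\<^sup>+r. ennreal (32 / gauss_mass) * indicator {0..1} r
      + ennreal (1 / gauss_mass) * (ennreal (r powr (- (3/2))) * indicator {1..} r) \<partial>lborel)"
    by (intro nn_integral_mono b)
  also have "\<dots> = ennreal (32 / gauss_mass) + ennreal (1 / gauss_mass) * ennreal 2"
    by (subst nn_integral_add) (auto simp: nn_integral_cmult nn_integral_powr_tail)
  also have "\<dots> < \<infinity>" by (simp add: ennreal_mult_less_top)
  finally have fin: "?I < \<infinity>" .
  then show "?I = ennreal newton_const" unfolding newton_const_def by simp
  have "?I \<noteq> 0"
  proof
    assume "?I = 0"
    then have "AE r in lborel. ennreal (?f r) * indicator {0<..} r = 0"
      by (subst (asm) nn_integral_0_iff_AE) auto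
    then have "AE r in lborel. r \<notin> {0<..<1::real}"
    proof eventually_elim
      case (elim r)
      show ?case
      proof
        assume r: "r \<in> {0<..<1}"
        then have "?f r > 0" using gauss_mass_pos by simp
        then show False using elim r by (simp add: indicator_def ennreal_eq_0_iff not_le[symmetric])
      qed
    qed
    then have "{0<..<1::real} \<in> null_sets lborel" by (subst AE_iff_null_sets) auto
    then show False by (simp add: null_sets_def)
  qed
  then show "newton_const > 0" unfolding newton_const_def
    using fin by (simp add: enn2real_positive_iff zero_less_iff_neq_zero)
qed

lemma nn_integral_heat_time:
  assumes z: "z \<noteq> 0"
  shows "(\<integral>\<^sup>+t\<in>{0<..}. ennreal (heat t z) \<partial>lborel) = ennreal (newton_const / norm z)"
proof -
  define n where "n = norm z"
  have n: "n > 0" using z by (simp add: n_def)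
  have "(\<integral>\<^sup>+t\<in>{0<..}. ennreal (heat t z) \<partial>lborel) =
     ennreal \<bar>n\<^sup>2\<bar> * (\<integral>\<^sup>+r. ennreal (heat (0 + n\<^sup>2 * r) z) * indicator {0<..} (0 + n\<^sup>2 * r) \<partial>lborel)"
    using n by (intro nn_integral_real_affine) auto
  also have "\<dots> = (\<integral>\<^sup>+r. ennreal (1 / n) * (ennreal (r powr (- (3/2)) * exp (- (1 / (4 * r))) / gauss_mass) * indicator {0<..} r) \<partial>lborel)"
  proof (subst nn_integral_cmult[symmetric], simp, rule nn_integral_cong)
    fix r :: real
    show "ennreal \<bar>n\<^sup>2\<bar> * (ennreal (heat (0 + n\<^sup>2 * r) z) * indicator {0<..} (0 + n\<^sup>2 * r)) =
      ennreal (1 / n) * (ennreal (r powr (- (3/2)) * exp (- (1 / (4 * r))) / gauss_mass) * indicator {0<..} r)"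
    proof (cases "r > 0")
      case True
      have "n\<^sup>2 * (n\<^sup>2) powr (- (3/2)) = n powr 2 * (n powr 2) powr (- (3/2))" using n by simp
      also have "\<dots> = n powr (-1)" unfolding powr_powr by (subst powr_add[symmetric]) simp
      also have "\<dots> = 1 / n" using n by (simp add: powr_minus_divide)
      finally have e: "n\<^sup>2 * (n\<^sup>2) powr (- (3/2)) = 1 / n" .
      have "n\<^sup>2 * heat (n\<^sup>2 * r) z = (n\<^sup>2 * (n\<^sup>2) powr (- (3/2))) * (r powr (- (3/2)) * exp (- (1 / (4 * r))) / gauss_mass)"
        using n True by (simp add: heat_def powr_mult flip: n_def)
      then show ?thesis using n True gauss_mass_pos unfolding e
        by (simp add: indicator_def flip: ennreal_mult)
    qed (use n in \<open>auto simp: indicator_def zero_less_mult_iff\<close>)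
  qed
  also have "\<dots> = ennreal (newton_const / norm z)"
    using n newton_const_pos by (simp add: nn_integral_cmult nn_integral_newton_const n_def flip: ennreal_mult)
  finally show ?thesis .
qed

lemma nn_integral_heat_tail_le:
  assumes T: "T > 0"
  shows "(\<integral>\<^sup>+t\<in>{T..}. ennreal (heat t z) \<partial>lborel) \<le> ennreal (2 / gauss_mass * T powr (- (1/2)))"
proof -
  have "(\<integral>\<^sup>+t\<in>{T..}. ennreal (heat t z) \<partial>lborel) \<le>
      (\<integral>\<^sup>+t. ennreal (1 / gauss_mass) * (ennreal (t powr (- (3/2))) * indicator {T..} t) \<partial>lborel)"
    using T gauss_mass_pos
    by (intro nn_integral_mono)
      (auto simp: heat_def indicator_def divide_right_mono mult_left_le intro!: ennreal_leI simp flip: ennreal_mult)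
  also have "\<dots> = ennreal (2 / gauss_mass * T powr (- (1/2)))"
    using T gauss_mass_pos by (simp add: nn_integral_cmult nn_integral_powr_tail flip: ennreal_mult)
  finally show ?thesis .
qed

section \<open>The heat semigroup and its potential operator\<close>

definition heat_op :: "real \<Rightarrow> (real ^ 3 \<Rightarrow> ennreal) \<Rightarrow> real ^ 3 \<Rightarrow> ennreal" where
  "heat_op t v x = (\<integral>\<^sup>+y. ennreal (heat t (x - y)) * v y \<partial>lborel)"

lemma measurable_heat_op [measurable (raw)]:
  assumes [measurable]: "v \<in> borel_measurable borel" "f \<in> borel_measurable M" "g \<in> borel_measurable M"
  shows "(\<lambda>x. heat_op (f x) v (g x)) \<in> borel_measurable M"
proof -
  have "(\<lambda>p. \<integral>\<^sup>+y. ennreal (heat (fst p) (snd p - y)) * v y \<partial>lborel) \<in> borel_measurable (borel \<Otimes>\<^sub>M borel)"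
    by measurable
  then have "(\<lambda>p. heat_op (fst p) v (snd p)) \<in> borel_measurable (borel \<Otimes>\<^sub>M borel)"
    unfolding heat_op_def .
  from measurable_compose[OF measurable_Pair[OF assms(2,3)] this] show ?thesis by simp
qed

lemma heat_op_mono: "(\<And>y. v y \<le> w y) \<Longrightarrow> heat_op t v x \<le> heat_op t w x"
  unfolding heat_op_def by (intro nn_integral_mono mult_left_mono) auto

lemma heat_op_const: "t > 0 \<Longrightarrow> heat_op t (\<lambda>_. c) x = c"
  unfolding heat_op_def by (simp add: nn_integral_multc nn_integral_heat)

lemma heat_op_le_1: "t > 0 \<Longrightarrow> (\<And>y. v y \<le> 1) \<Longrightarrow> heat_op t v x \<le> 1"
  using heat_op_mono[of v "\<lambda>_. 1"] heat_op_const[of t 1] by metis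

lemma heat_op_add:
  assumes [measurable]: "v \<in> borel_measurable borel" "w \<in> borel_measurable borel"
  shows "heat_op t (\<lambda>y. v y + w y) x = heat_op t v x + heat_op t w x"
  unfolding heat_op_def by (simp add: distrib_left nn_integral_add)

lemma heat_op_cmult:
  assumes [measurable]: "v \<in> borel_measurable borel"
  shows "heat_op t (\<lambda>y. c * v y) x = c * heat_op t v x"
  unfolding heat_op_def by (simp add: mult.left_commute nn_integral_cmult)

lemma heat_op_heat_op:
  assumes [measurable]: "v \<in> borel_measurable borel" and s: "s > 0" and t: "t > 0"
  shows "heat_op s (heat_op t v) x = heat_op (s + t) v x"
proof -
  have "heat_op s (heat_op t v) x =
      (\<integral>\<^sup>+y. \<integral>\<^sup>+z. ennreal (heat s (x - y)) * (ennreal (heat t (y - z)) * v z) \<partial>lborel \<partial>lborel)"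
    unfolding heat_op_def by (simp add: nn_integral_cmult)
  also have "\<dots> = (\<integral>\<^sup>+z. \<integral>\<^sup>+y. ennreal (heat s (x - y)) * (ennreal (heat t (y - z)) * v z) \<partial>lborel \<partial>lborel)"
    by (rule lborel_pair.Fubini') measurable
  also have "\<dots> = (\<integral>\<^sup>+z. (\<integral>\<^sup>+y. ennreal (heat s (x - y)) * ennreal (heat t (y - z)) \<partial>lborel) * v z \<partial>lborel)"
    by (intro nn_integral_cong) (simp add: mult.assoc[symmetric] nn_integral_multc)
  also have "\<dots> = heat_op (s + t) v x"
    unfolding heat_convolution[OF s t] heat_op_def ..
  finally show ?thesis .
qed

lemma heat_op_SUP:
  assumes [measurable]: "\<And>n::nat. v n \<in> borel_measurable borel" and inc: "incseq v"
  shows "heat_op t (\<lambda>y. SUP n. v n y) x = (SUP n. heat_op t (v n) x)"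
proof -
  have "heat_op t (\<lambda>y. SUP n. v n y) x = (\<integral>\<^sup>+y. (SUP n. ennreal (heat t (x - y)) * v n y) \<partial>lborel)"
    unfolding heat_op_def by (simp add: SUP_mult_left_ennreal)
  also have "\<dots> = (SUP n. \<integral>\<^sup>+y. ennreal (heat t (x - y)) * v n y \<partial>lborel)"
    by (rule nn_integral_monotone_convergence_SUP)
      (use inc in \<open>auto simp: incseq_def le_fun_def intro!: mult_left_mono\<close>)
  finally show ?thesis unfolding heat_op_def .
qed

lemma heat_op_le_heat_op:
  assumes [measurable]: "v \<in> borel_measurable borel" and "0 < s" "s \<le> t"
  shows "ennreal ((s / t) powr (3/2)) * heat_op s v x \<le> heat_op t v x"
  unfolding heat_op_def using assms heat_le_heat[OF assms(2,3)]
  by (subst nn_integral_cmult[symmetric])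
    (auto intro!: nn_integral_mono mult_right_mono ennreal_leI simp: mult.assoc[symmetric] simp flip: ennreal_mult)

definition newton_op :: "(real ^ 3 \<Rightarrow> ennreal) \<Rightarrow> real ^ 3 \<Rightarrow> ennreal" where
  "newton_op f x = (\<integral>\<^sup>+t\<in>{0<..}. heat_op t f x \<partial>lborel)"

lemma newton_op_eq:
  assumes [measurable]: "f \<in> borel_measurable borel"
  shows "newton_op f x = (\<integral>\<^sup>+y. ennreal (newton_const / norm (x - y)) * f y \<partial>lborel)"
proof -
  have "newton_op f x = (\<integral>\<^sup>+t. \<integral>\<^sup>+y. (ennreal (heat t (x - y)) * indicator {0<..} t) * f y \<partial>lborel \<partial>lborel)"
    unfolding newton_op_def heat_op_def
    by (intro nn_integral_cong, subst nn_integral_multc[symmetric]) (auto intro!: nn_integral_cong simp: ac_simps)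
  also have "\<dots> = (\<integral>\<^sup>+y. \<integral>\<^sup>+t. (ennreal (heat t (x - y)) * indicator {0<..} t) * f y \<partial>lborel \<partial>lborel)"
    by (rule lborel_pair.Fubini') measurable
  also have "\<dots> = (\<integral>\<^sup>+y. (\<integral>\<^sup>+t\<in>{0<..}. ennreal (heat t (x - y)) \<partial>lborel) * f y \<partial>lborel)"
    by (simp add: nn_integral_multc)
  also have "\<dots> = (\<integral>\<^sup>+y. ennreal (newton_const / norm (x - y)) * f y \<partial>lborel)"
    \<comment> \<open>The two kernels differ at y = x, where the division by zero yields 0 while the
      time integral diverges; a single point is a null set.\<close>
    by (intro nn_integral_cong_AE AE_mp[OF AE_lborel_singleton[of x] AE_I2])
      (auto simp: nn_integral_heat_time)
  finally show ?thesis .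
qed

text \<open>A multiple of the Newtonian kernel, as a heat integral so that it is infinite at the origin.\<close>

definition newton_kernel :: "real ^ 3 \<Rightarrow> ennreal" where
  "newton_kernel x = (\<integral>\<^sup>+t\<in>{0<..}. ennreal (heat t x) \<partial>lborel)"

lemma measurable_newton_kernel [measurable]: "newton_kernel \<in> borel_measurable borel"
  unfolding newton_kernel_def by measurable

text \<open>By the semigroup law, flowing for time s shifts the time variable, so the flow merely
  removes the times up to s. Hence the kernel is excessive, and its flow is controlled by a heat
  tail that vanishes as s grows.\<close>

lemma heat_op_newton_kernel:
  assumes s: "s > 0"
  shows "heat_op s newton_kernel x = (\<integral>\<^sup>+t\<in>{s<..}. ennreal (heat t x) \<partial>lborel)"
proof -
  have "heat_op s newton_kernel x =
      (\<integral>\<^sup>+y. \<integral>\<^sup>+t. (ennreal (heat s (x - y)) * ennreal (heat t y)) * indicator {0<..} t \<partial>lborel \<partial>lborel)"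
    unfolding heat_op_def newton_kernel_def by (simp add: nn_integral_cmult mult.assoc)
  also have "\<dots> = (\<integral>\<^sup>+t. \<integral>\<^sup>+y. (ennreal (heat s (x - y)) * ennreal (heat t y)) * indicator {0<..} t \<partial>lborel \<partial>lborel)"
    by (rule lborel_pair.Fubini') measurable
  also have "\<dots> = (\<integral>\<^sup>+t. ennreal (heat (s + t) x) * indicator {0<..} t \<partial>lborel)"
  proof (intro nn_integral_cong)
    fix t :: real
    show "(\<integral>\<^sup>+y. (ennreal (heat s (x - y)) * ennreal (heat t y)) * indicator {0<..} t \<partial>lborel) =
        ennreal (heat (s + t) x) * indicator {0<..} t"
    proof (cases "t > 0")
      case True
      then show ?thesis using heat_convolution[OF s True, of x 0] by simp
    qed simp
  qed
  also have "\<dots> = (\<integral>\<^sup>+t\<in>{s<..}. ennreal (heat t x) \<partial>lborel)"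
    by (subst (2) nn_integral_real_affine[where c = 1 and t = s]) (auto simp: indicator_def)
  finally show ?thesis .
qed

lemma heat_op_newton_kernel_le: "s > 0 \<Longrightarrow> heat_op s newton_kernel x \<le> newton_kernel x"
  unfolding heat_op_newton_kernel newton_kernel_def
  by (intro nn_integral_mono) (auto simp: indicator_def)

lemma newton_kernel_eq: "x \<noteq> 0 \<Longrightarrow> newton_kernel x = ennreal (newton_const / norm x)"
  unfolding newton_kernel_def by (rule nn_integral_heat_time)

lemma newton_kernel_ge:
  assumes "norm x \<le> R" "R > 0"
  shows "ennreal (newton_const / R) \<le> newton_kernel x"
proof (cases "x = 0")
  case False
  then show ?thesis using assms newton_const_pos
    by (auto simp: newton_kernel_eq intro!: ennreal_leI divide_left_mono)
next
  case True
  \<comment> \<open>At the origin the exponential in \<open>heat\<close> is 1, so the kernel there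
    dominates its value at every other point, in particular at one of norm R.\<close>
  have "newton_kernel x \<ge> ennreal (newton_const / norm (y::real^3))" if "y \<noteq> 0" for y
    unfolding newton_kernel_eq[OF that, symmetric] True newton_kernel_def
    using gauss_mass_pos
    by (intro nn_integral_mono) (auto simp: heat_def indicator_def divide_right_mono mult_left_le intro!: ennreal_leI)
  from this[of "R *\<^sub>R axis 1 1"] show ?thesis using assms by (auto simp: axis_eq_0_iff)
qed

section \<open>Existence of the potential\<close>

text \<open>
  \<open>hit K e x\<close> is the probability that the Gaussian random walk with time step \<open>e\<close> ever visits \<open>K\<close>
  when started at \<open>x\<close>.
\<close>

primrec hit_iter :: "(real ^ 3) set \<Rightarrow> real \<Rightarrow> nat \<Rightarrow> real ^ 3 \<Rightarrow> ennreal" where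
  "hit_iter K e 0 = indicator K"
| "hit_iter K e (Suc n) = (\<lambda>x. if x \<in> K then 1 else heat_op e (hit_iter K e n) x)"

definition hit :: "(real ^ 3) set \<Rightarrow> real \<Rightarrow> real ^ 3 \<Rightarrow> ennreal" where
  "hit K e x = (SUP n. hit_iter K e n x)"

context
  fixes K :: "(real ^ 3) set" and e :: real
  assumes K [measurable]: "K \<in> sets borel" and e: "e > 0"
begin

lemma measurable_hit_iter [measurable]: "hit_iter K e n \<in> borel_measurable borel"
  by (induction n) auto

lemma hit_iter_le_1: "hit_iter K e n x \<le> 1"
  by (induction n arbitrary: x) (auto simp: indicator_def intro!: heat_op_le_1 e)

lemma hit_iter_on: "x \<in> K \<Longrightarrow> hit_iter K e n x = 1"
  by (cases n) auto

lemma hit_iter_Suc: "hit_iter K e n x \<le> hit_iter K e (Suc n) x"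
  by (induction n arbitrary: x) (auto intro: heat_op_mono)

lemma incseq_hit_iter: "incseq (hit_iter K e)"
  by (intro incseq_SucI le_funI hit_iter_Suc)

lemma measurable_hit [measurable]: "hit K e \<in> borel_measurable borel"
  unfolding hit_def[abs_def] by measurable

lemma hit_le_1: "hit K e x \<le> 1"
  unfolding hit_def by (intro SUP_least hit_iter_le_1)

lemma hit_on: "x \<in> K \<Longrightarrow> hit K e x = 1"
  unfolding hit_def by (simp add: hit_iter_on)

lemma hit_off: 
  assumes x: "x \<notin> K"
  shows "heat_op e (hit K e) x = hit K e x"
proof -
  have "heat_op e (hit K e) x = (SUP n. heat_op e (hit_iter K e n) x)"
    unfolding hit_def[abs_def] by (rule heat_op_SUP[OF _ incseq_hit_iter]) measurable
  also have "\<dots> = (SUP n. hit_iter K e (Suc n) x)" using x by simp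
  also have "\<dots> = hit K e x" unfolding hit_def
    by (rule antisym; intro SUP_mono) (blast intro: hit_iter_Suc order_refl)+
  finally show ?thesis .
qed

lemma heat_op_hit_le: "heat_op e (hit K e) x \<le> hit K e x"
  using hit_off[of x] hit_on[of x] heat_op_le_1[of e "hit K e" x] e hit_le_1 by (cases "x \<in> K") auto

text \<open>Minimality among the supersolutions of the walk, by induction on the number of steps.
  Upper bounds for hitting probabilities are obtained by exhibiting a competitor w.\<close>

lemma hit_least:
  assumes "\<And>x. x \<in> K \<Longrightarrow> 1 \<le> w x" "\<And>x. heat_op e w x \<le> w x"
  shows "hit K e x \<le> w x"
proof -
  have "hit_iter K e n x \<le> w x" for n x
  proof (induction n arbitrary: x)
    case (Suc n)
    have "heat_op e (hit_iter K e n) x \<le> heat_op e w x" by (rule heat_op_mono) (rule Suc)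
    also note assms(2)
    finally show ?case using assms(1) by simp
  qed (use assms in \<open>auto simp: indicator_def\<close>)
  then show ?thesis unfolding hit_def by (intro SUP_least)
qed

text \<open>The charge of the walk at scale e: the defect in the equation that the hitting
  probability satisfies off K, per unit of time. \<open>heat_op_hit_le\<close> makes the truncated
  subtraction of \<open>ennreal\<close> a true one here.\<close>

definition hit_density :: "real ^ 3 \<Rightarrow> ennreal" where
  "hit_density x = (hit K e x - heat_op e (hit K e) x) / ennreal e"

lemma measurable_hit_density [measurable]: "hit_density \<in> borel_measurable borel"
  unfolding hit_density_def[abs_def] by measurable

lemma hit_density_off: "x \<notin> K \<Longrightarrow> hit_density x = 0"
  using hit_off[of x] le_less_trans[OF hit_le_1[of x], of top] unfolding hit_density_def
  by (simp add: diff_eq_0_ennreal)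

lemma hit_decomp: "hit K e x = heat_op e (hit K e) x + ennreal e * hit_density x"
proof -
  have "ennreal e * hit_density x = hit K e x - heat_op e (hit K e) x"
    unfolding hit_density_def using e
    by (simp add: ennreal_mult_divide_eq ennreal_times_divide mult.commute[of "ennreal e"])
  then show ?thesis using heat_op_hit_le[of x]
    by (simp add: add_diff_inverse_ennreal)
qed

text \<open>The competitor is R / |y| off the origin, the potential of the ball of radius R outside
  that ball: it is at least 1 on K and excessive. This is the source of the decay at
  infinity.\<close>

lemma hit_le_newton_kernel:
  assumes R: "R > 0" and KR: "K \<subseteq> cball 0 R"
  shows "hit K e y \<le> ennreal (R / newton_const) * newton_kernel y"
proof (rule hit_least)
  have c: "ennreal (R / newton_const) * ennreal (newton_const / R) = 1"
    using R newton_const_pos by (simp flip: ennreal_mult)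
  show "1 \<le> ennreal (R / newton_const) * newton_kernel z" if "z \<in> K" for z
    using mult_left_mono[OF newton_kernel_ge[of z R], of "ennreal (R / newton_const)"] that KR R
    unfolding c by (auto simp: subset_iff)
  show "heat_op e (\<lambda>y. ennreal (R / newton_const) * newton_kernel y) z \<le>
      ennreal (R / newton_const) * newton_kernel z" for z
    by (simp add: heat_op_cmult mult_left_mono heat_op_newton_kernel_le[OF e])
qed

text \<open>Telescoping \<open>P\<^sub>t v = P\<^sub>t\<^sub>+\<^sub>e v + e P\<^sub>t f\<close> for \<open>v = hit\<close> and \<open>f = hit_density\<close>.\<close>

lemma newton_op_hit_density:
  assumes R: "R > 0" and KR: "K \<subseteq> cball 0 R"
  shows "ennreal e * newton_op hit_density x = (\<integral>\<^sup>+t\<in>{0<..e}. heat_op t (hit K e) x \<partial>lborel)"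
proof -
  let ?v = "hit K e"
  \<comment> \<open>\<open>a n\<close> collects the flow of the hitting probability over the n-th
    time slab of length e, and \<open>b n\<close> the flow of the density up to time n e. One
    telescoping step moves the first by a slab, so that \<open>a 0 = a n + ennreal e * b n\<close>;
    it remains to let n tend to infinity.\<close>
  define a where "a n = (\<integral>\<^sup>+t\<in>{real n * e<..real (Suc n) * e}. heat_op t ?v x \<partial>lborel)" for n
  define b where "b n = (\<integral>\<^sup>+t\<in>{0<..real n * e}. heat_op t hit_density x \<partial>lborel)" for n
  have step: "heat_op t ?v x = heat_op (t + e) ?v x + ennreal e * heat_op t hit_density x" if "t > 0" for t
  proof -
    have "heat_op t ?v x = heat_op t (\<lambda>y. heat_op e ?v y + ennreal e * hit_density y) x"
      by (rule arg_cong[where f = "\<lambda>v. heat_op t v x"], rule ext, rule hit_decomp)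
    also have "\<dots> = heat_op t (heat_op e ?v) x + ennreal e * heat_op t hit_density x"
      by (simp add: heat_op_add heat_op_cmult)
    finally show ?thesis using heat_op_heat_op[OF measurable_hit that e] by simp
  qed
  have shift: "a n = a (Suc n) + ennreal e * (\<integral>\<^sup>+t\<in>{real n * e<..real (Suc n) * e}. heat_op t hit_density x \<partial>lborel)" for n
  proof -
    have pos: "t > 0" if "t \<in> {real n * e<..real (Suc n) * e}" for t
      using that e by (smt (verit) greaterThanAtMost_iff mult_nonneg_nonneg of_nat_0_le_iff)
    have "a n = (\<integral>\<^sup>+t. heat_op (t + e) ?v x * indicator {real n * e<..real (Suc n) * e} t
        + ennreal e * (heat_op t hit_density x * indicator {real n * e<..real (Suc n) * e} t) \<partial>lborel)"
      unfolding a_def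
    proof (intro nn_integral_cong)
      fix t
      show "heat_op t ?v x * indicator {real n * e<..real (Suc n) * e} t =
          heat_op (t + e) ?v x * indicator {real n * e<..real (Suc n) * e} t
        + ennreal e * (heat_op t hit_density x * indicator {real n * e<..real (Suc n) * e} t)"
        using step[OF pos, of t] by (cases "t \<in> {real n * e<..real (Suc n) * e}") simp_all
    qed
    also have "\<dots> = (\<integral>\<^sup>+t. heat_op (t + e) ?v x * indicator {real n * e<..real (Suc n) * e} t \<partial>lborel)
        + ennreal e * (\<integral>\<^sup>+t\<in>{real n * e<..real (Suc n) * e}. heat_op t hit_density x \<partial>lborel)"
      by (simp add: nn_integral_add nn_integral_cmult)
    also have "(\<integral>\<^sup>+t. heat_op (t + e) ?v x * indicator {real n * e<..real (Suc n) * e} t \<partial>lborel) = a (Suc n)"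
      unfolding a_def
      by (subst (2) nn_integral_real_affine[where c = 1 and t = e])
        (auto simp: indicator_def algebra_simps intro!: nn_integral_cong)
    finally show ?thesis .
  qed
  have tel: "a 0 = a n + ennreal e * b n" for n
  proof (induction n)
    case (Suc n)
    have "b (Suc n) = (\<integral>\<^sup>+t. heat_op t hit_density x * indicator {0<..real n * e} t
        + heat_op t hit_density x * indicator {real n * e<..real (Suc n) * e} t \<partial>lborel)"
    proof -
      define c where "c = real n * e"
      have "c \<ge> 0" "real (Suc n) * e = c + e" using e by (auto simp: c_def algebra_simps)
      then show ?thesis unfolding b_def c_def[symmetric] using e
        by (intro nn_integral_cong) (auto simp: indicator_def)
    qed
    also have "\<dots> = b n + (\<integral>\<^sup>+t\<in>{real n * e<..real (Suc n) * e}. heat_op t hit_density x \<partial>lborel)"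
      unfolding b_def by (subst nn_integral_add) auto
    finally show ?case using Suc shift[of n] by (simp add: distrib_left ac_simps)
  qed (simp add: b_def)
  have "(\<lambda>n. b n) \<longlonglongrightarrow> newton_op hit_density x"
  proof -
    have "(\<lambda>n. b n) \<longlonglongrightarrow> (\<integral>\<^sup>+t. (SUP n. heat_op t hit_density x * indicator {0<..real n * e} t) \<partial>lborel)"
      unfolding b_def
    proof (subst nn_integral_monotone_convergence_SUP)
      show inc: "incseq (\<lambda>n t. heat_op t hit_density x * indicator {0<..real n * e} t)"
        using e by (auto simp: incseq_def le_fun_def indicator_def intro: order_trans mult_right_mono)
      show "(\<lambda>n. \<integral>\<^sup>+t\<in>{0<..real n * e}. heat_op t hit_density x \<partial>lborel) \<longlonglongrightarrow>
          (SUP n. \<integral>\<^sup>+t\<in>{0<..real n * e}. heat_op t hit_density x \<partial>lborel)"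
        using inc by (intro LIMSEQ_SUP) (auto simp: incseq_def le_fun_def intro!: nn_integral_mono)
    qed simp
    moreover have "(SUP n. heat_op t hit_density x * indicator {0<..real n * e} t) =
        heat_op t hit_density x * indicator {0<..} t" for t
    proof (rule antisym)
      obtain n where "t / e \<le> real n" using real_arch_simple by blast
      then have "t \<le> real n * e" using e by (simp add: field_simps)
      then show "heat_op t hit_density x * indicator {0<..} t \<le>
          (SUP n. heat_op t hit_density x * indicator {0<..real n * e} t)"
        by (intro SUP_upper2[of n]) (auto simp: indicator_def)
    qed (auto intro!: SUP_least simp: indicator_def)
    ultimately show ?thesis unfolding newton_op_def by simp
  qed
  then have lim1: "(\<lambda>n. ennreal e * b n) \<longlonglongrightarrow> ennreal e * newton_op hit_density x"
    by (intro ennreal_tendsto_cmult) auto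
  \<comment> \<open>Late slabs vanish: the hitting probability lies below a multiple of the
    Newtonian kernel, whose flow at time t is a heat tail beginning at t, of order t^(-1/2).\<close>
  have a_le: "a n \<le> ennreal e * (ennreal (R / newton_const) * ennreal (2 / gauss_mass * (real n * e) powr (- (1/2))))"
    if n: "n > 0" for n
  proof -
    let ?c = "ennreal (R / newton_const) * ennreal (2 / gauss_mass * (real n * e) powr (- (1/2)))"
    have "heat_op t ?v x \<le> ?c" if t: "t > real n * e" for t
    proof -
      have t0: "t > 0" "real n * e > 0" using n e t by (auto intro: less_trans[of 0 "real n * e"])
      have "heat_op t ?v x \<le> heat_op t (\<lambda>y. ennreal (R / newton_const) * newton_kernel y) x"
        by (intro heat_op_mono hit_le_newton_kernel R KR)
      also have "\<dots> = ennreal (R / newton_const) * (\<integral>\<^sup>+r\<in>{t<..}. ennreal (heat r x) \<partial>lborel)"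
        using t0 by (simp add: heat_op_cmult heat_op_newton_kernel)
      also have "(\<integral>\<^sup>+r\<in>{t<..}. ennreal (heat r x) \<partial>lborel) \<le> (\<integral>\<^sup>+r\<in>{real n * e..}. ennreal (heat r x) \<partial>lborel)"
        using t by (intro nn_integral_mono) (auto simp: indicator_def)
      also have "\<dots> \<le> ennreal (2 / gauss_mass * (real n * e) powr (- (1/2)))"
        using t0 by (intro nn_integral_heat_tail_le)
      finally show ?thesis by (simp add: mult_left_mono)
    qed
    then have "a n \<le> (\<integral>\<^sup>+t. ?c * indicator {real n * e<..real (Suc n) * e} t \<partial>lborel)"
      unfolding a_def by (intro nn_integral_mono) (auto simp: indicator_def)
    also have "\<dots> = ?c * ennreal e"
    proof (subst nn_integral_cmult_indicator)
      have "real n * e \<le> real (Suc n) * e" "real (Suc n) * e - real n * e = e"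
        using e by (auto simp: algebra_simps)
      then show "?c * emeasure lborel {real n * e<..real (Suc n) * e} = ?c * ennreal e" by simp
    qed simp
    finally show ?thesis by (simp only: ac_simps)
  qed
  have lim2: "a \<longlonglongrightarrow> 0"
  proof (rule tendsto_sandwich[OF always_eventually _ tendsto_const])
    show "\<forall>\<^sub>F n in sequentially. a n \<le>
        ennreal (e * ((R / newton_const) * (2 / gauss_mass * (real n * e) powr (- (1/2)))))"
      using eventually_gt_at_top[of 0]
    proof eventually_elim
      case (elim n)
      have *: "0 \<le> e" "0 \<le> R / newton_const" "0 \<le> 2 / gauss_mass * (real n * e) powr (- (1/2))"
        using e R newton_const_pos gauss_mass_pos by auto
      show ?case using a_le[OF elim] ennreal_mult[OF *(1) mult_nonneg_nonneg[OF *(2,3)]] ennreal_mult[OF *(2,3)]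
        by simp
    qed
    have "filterlim (\<lambda>n. real n * e) at_top sequentially"
      using e by (intro filterlim_at_top_mult_tendsto_pos[OF tendsto_const]) (auto intro: filterlim_real_sequentially)
    then have "(\<lambda>n. e * ((R / newton_const) * (2 / gauss_mass * (real n * e) powr (- (1/2))))) \<longlonglongrightarrow>
        e * ((R / newton_const) * (2 / gauss_mass * 0))"
      by (intro tendsto_intros tendsto_neg_powr) auto
    then show "(\<lambda>n. ennreal (e * ((R / newton_const) * (2 / gauss_mass * (real n * e) powr (- (1/2)))))) \<longlonglongrightarrow> 0"
      using tendsto_ennrealI by fastforce
  qed auto
  have "(\<lambda>n. a n + ennreal e * b n) \<longlonglongrightarrow> 0 + ennreal e * newton_op hit_density x"
    by (intro tendsto_add lim1 lim2)
  then have "(\<lambda>n. a 0) \<longlonglongrightarrow> ennreal e * newton_op hit_density x"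
    by (simp flip: tel)
  then have "a 0 = ennreal e * newton_op hit_density x"
    using LIMSEQ_unique tendsto_const by blast
  then show ?thesis by (simp add: a_def)
qed

end

section \<open>The limit over dyadic time steps\<close>

context
  fixes K :: "(real ^ 3) set"
  assumes K [measurable]: "K \<in> sets borel"
begin

lemma heat_op_mult_hit_le:
  assumes e: "e > 0"
  shows "heat_op (real (Suc m) * e) (hit K e) x \<le> hit K e x"
proof (induction m arbitrary: x)
  case 0
  show ?case using heat_op_hit_le[OF K e] by simp
next
  case (Suc m)
  have "heat_op (real (Suc (Suc m)) * e) (hit K e) x = heat_op (real (Suc m) * e) (heat_op e (hit K e)) x"
    using e by (subst heat_op_heat_op) (auto simp: distrib_right measurable_hit[OF K e] add_pos_nonneg)
  also have "\<dots> \<le> heat_op (real (Suc m) * e) (hit K e) x"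
    by (intro heat_op_mono heat_op_hit_le K e)
  also have "\<dots> \<le> hit K e x" by (rule Suc)
  finally show ?case .
qed

text \<open>Two half steps make a full step, so the hitting probability of the finer walk is a
  supersolution for the coarser walk.\<close>

lemma hit_half_ge:
  assumes e: "e > 0"
  shows "hit K e x \<le> hit K (e / 2) x"
proof (rule hit_least[OF K e])
  show "heat_op e (hit K (e / 2)) x \<le> hit K (e / 2) x" for x
    using heat_op_mult_hit_le[of "e / 2" 1 x] e by simp
qed (use hit_on[OF K] e in auto)

text \<open>Each refinement 2^-(j+1) retains the observation times of the previous walk; this is
  what makes the sequence increasing and a supremum a limit.\<close>

definition dyadic_hit :: "nat \<Rightarrow> real ^ 3 \<Rightarrow> ennreal" where
  "dyadic_hit j = hit K (1 / 2 ^ j)"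

definition capacitary :: "real ^ 3 \<Rightarrow> ennreal" where
  "capacitary x = (SUP j. dyadic_hit j x)"

lemma measurable_dyadic_hit [measurable]: "dyadic_hit j \<in> borel_measurable borel"
  unfolding dyadic_hit_def by (rule measurable_hit[OF K]) simp

lemma measurable_capacitary [measurable]: "capacitary \<in> borel_measurable borel"
  unfolding capacitary_def[abs_def] by measurable

lemma incseq_dyadic_hit: "incseq dyadic_hit"
  by (intro incseq_SucI le_funI) (use hit_half_ge[of "1 / 2 ^ n" for n] in \<open>simp add: dyadic_hit_def mult.commute\<close>)

lemma dyadic_hit_le: "dyadic_hit j x \<le> capacitary x"
  unfolding capacitary_def by (rule SUP_upper) simp

lemma capacitary_le_1: "capacitary x \<le> 1"
  unfolding capacitary_def dyadic_hit_def by (intro SUP_least hit_le_1[OF K]) simp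

lemma capacitary_on: "x \<in> K \<Longrightarrow> capacitary x = 1"
  unfolding capacitary_def dyadic_hit_def by (simp add: hit_on[OF K])

text \<open>A dyadic time is a multiple of all sufficiently fine steps, so the one-step inequality
  of the walk with step 2^-n, iterated, reaches it once n \<ge> i.\<close>

lemma heat_op_dyadic_capacitary_le: "heat_op (real (Suc m) / 2 ^ i) capacitary x \<le> capacitary x"
proof -
  have "heat_op (real (Suc m) / 2 ^ i) capacitary x = (SUP j. heat_op (real (Suc m) / 2 ^ i) (dyadic_hit j) x)"
    unfolding capacitary_def[abs_def] by (rule heat_op_SUP[OF _ incseq_dyadic_hit]) measurable
  also have "\<dots> \<le> capacitary x"
  proof (rule SUP_least)
    fix j
    define n where "n = max i j"
    have "heat_op (real (Suc m) / 2 ^ i) (dyadic_hit j) x \<le> heat_op (real (Suc m) / 2 ^ i) (dyadic_hit n) x"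
      by (intro heat_op_mono le_funD[OF incseqD[OF incseq_dyadic_hit]]) (simp add: n_def)
    also have "\<dots> = heat_op (real (Suc (Suc m * 2 ^ (n - i) - 1)) * (1 / 2 ^ n)) (dyadic_hit n) x"
    proof -
      have "(2::real) ^ n = 2 ^ i * 2 ^ (n - i)" by (simp add: n_def flip: power_add)
      then have "real (Suc m) / 2 ^ i = real (Suc (Suc m * 2 ^ (n - i) - 1)) * (1 / 2 ^ n)"
        by (simp add: field_simps of_nat_diff)
      then show ?thesis by simp
    qed
    also have "\<dots> \<le> dyadic_hit n x"
      unfolding dyadic_hit_def by (rule heat_op_mult_hit_le) simp
    also have "\<dots> \<le> capacitary x" by (rule dyadic_hit_le)
    finally show "heat_op (real (Suc m) / 2 ^ i) (dyadic_hit j) x \<le> capacitary x" .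
  qed
  finally show ?thesis .
qed

text \<open>The time s is approached from above by dyadic times t i.
  \<open>heat_op_le_heat_op\<close> bounds the flow at s by that at t i, up to a factor that tends
  to 1, so the dyadic inequality survives the limit.\<close>

lemma heat_op_capacitary_le:
  assumes s: "s > 0"
  shows "heat_op s capacitary x \<le> capacitary x"
proof -
  \<comment> \<open>The \<open>Suc\<close> rounds up: t i is a positive multiple of 2^-i, at least s
    and at most s + 2^-i.\<close>
  define t where "t i = real (Suc (nat \<lfloor>s * 2 ^ i\<rfloor>)) / 2 ^ i" for i :: nat
  have t: "s \<le> t i" "t i \<le> s + 1 / 2 ^ i" for i
  proof -
    have "0 \<le> s * 2 ^ i" using s by simp
    then have "real (nat \<lfloor>s * 2 ^ i\<rfloor>) = of_int \<lfloor>s * 2 ^ i\<rfloor>" by simp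
    then have "s * 2 ^ i \<le> real (Suc (nat \<lfloor>s * 2 ^ i\<rfloor>))" "real (Suc (nat \<lfloor>s * 2 ^ i\<rfloor>)) \<le> s * 2 ^ i + 1"
      by linarith+
    then show "s \<le> t i" "t i \<le> s + 1 / 2 ^ i" unfolding t_def by (simp_all add: field_simps)
  qed
  have "t \<longlonglongrightarrow> s"
  proof (rule tendsto_sandwich[OF always_eventually always_eventually tendsto_const])
    show "(\<lambda>i. s + 1 / 2 ^ i) \<longlonglongrightarrow> s"
      using tendsto_add[OF tendsto_const[of s] LIMSEQ_realpow_zero[of "1/2"]] by (simp add: power_divide)
  qed (use t in auto)
  then have "(\<lambda>i. (s / t i) powr (3/2)) \<longlonglongrightarrow> (s / s) powr (3/2)"
    using s by (intro tendsto_intros) auto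
  then have "(\<lambda>i. heat_op s capacitary x * ennreal ((s / t i) powr (3/2))) \<longlonglongrightarrow>
      heat_op s capacitary x * ennreal ((s / s) powr (3/2))"
    using heat_op_le_1[of s capacitary x] s capacitary_le_1
    by (intro ennreal_tendsto_cmult tendsto_ennrealI) (auto simp: le_less_trans[of _ 1])
  then have lim: "(\<lambda>i. heat_op s capacitary x * ennreal ((s / t i) powr (3/2))) \<longlonglongrightarrow> heat_op s capacitary x"
    using s by simp
  have "heat_op s capacitary x * ennreal ((s / t i) powr (3/2)) \<le> capacitary x" for i
  proof -
    have "heat_op s capacitary x * ennreal ((s / t i) powr (3/2)) \<le> heat_op (t i) capacitary x"
      using heat_op_le_heat_op[OF measurable_capacitary s t(1)] by (simp add: mult.commute)
    also have "\<dots> \<le> capacitary x" unfolding t_def by (rule heat_op_dyadic_capacitary_le)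
    finally show ?thesis .
  qed
  then show ?thesis by (intro LIMSEQ_le_const2[OF lim]) auto
qed

section \<open>The charges on the body and their potentials\<close>

definition capacitary_measure :: "nat \<Rightarrow> (real ^ 3) measure" where
  "capacitary_measure j = density lborel (\<lambda>y. ennreal newton_const * hit_density K (1 / 2 ^ j) y)"

lemma sets_capacitary_measure [simp]: "sets (capacitary_measure j) = sets borel"
  unfolding capacitary_measure_def by simp

lemma measurable_hit_density' [measurable]: "hit_density K (1 / 2 ^ j) \<in> borel_measurable borel"
  by (rule measurable_hit_density[OF K]) simp

lemma capacitary_measure_off: "emeasure (capacitary_measure j) (- K) = 0"
proof -
  have "emeasure (capacitary_measure j) (- K) =
      (\<integral>\<^sup>+y. ennreal newton_const * hit_density K (1 / 2 ^ j) y * indicator (- K) y \<partial>lborel)"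
    unfolding capacitary_measure_def by (subst emeasure_density) auto
  also have "\<dots> = (\<integral>\<^sup>+y. 0 \<partial>(lborel :: (real^3) measure))"
    using hit_density_off[OF K, of "1 / 2 ^ j"] by (intro nn_integral_cong) (auto simp: indicator_def)
  finally show ?thesis by simp
qed

text \<open>The factor \<open>newton_const\<close> in the measure absorbs the constant of the
  Newtonian kernel, so that from here on potentials have the kernel 1 / |x - y|.\<close>

lemma potential_capacitary_measure:
  "(\<integral>\<^sup>+y. ennreal (1 / norm (x - y)) \<partial>capacitary_measure j) = newton_op (hit_density K (1 / 2 ^ j)) x"
proof -
  have "(\<integral>\<^sup>+y. ennreal (1 / norm (x - y)) \<partial>capacitary_measure j) =
      (\<integral>\<^sup>+y. ennreal newton_const * hit_density K (1 / 2 ^ j) y * ennreal (1 / norm (x - y)) \<partial>lborel)"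
    unfolding capacitary_measure_def by (subst nn_integral_density) auto
  also have "\<dots> = (\<integral>\<^sup>+y. ennreal (newton_const / norm (x - y)) * hit_density K (1 / 2 ^ j) y \<partial>lborel)"
  proof (rule nn_integral_cong)
    fix y
    have "ennreal newton_const * ennreal (1 / norm (x - y)) = ennreal (newton_const / norm (x - y))"
      using newton_const_pos by (simp flip: ennreal_mult)
    then show "ennreal newton_const * hit_density K (1 / 2 ^ j) y * ennreal (1 / norm (x - y)) =
        ennreal (newton_const / norm (x - y)) * hit_density K (1 / 2 ^ j) y"
      by (metis mult.assoc mult.commute)
  qed
  finally show ?thesis by (simp add: newton_op_eq)
qed

context
  fixes R :: real
  assumes R: "R > 0" and KR: "K \<subseteq> cball 0 R"
begin

lemma capacitary_le:
  assumes x: "x \<noteq> 0"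
  shows "capacitary x \<le> ennreal (R / norm x)"
proof -
  have "capacitary x \<le> ennreal (R / newton_const) * newton_kernel x"
    unfolding capacitary_def dyadic_hit_def by (intro SUP_least hit_le_newton_kernel[OF K _ R KR]) simp
  also have "\<dots> = ennreal (R / norm x)"
    using x R newton_const_pos by (simp add: newton_kernel_eq flip: ennreal_mult)
  finally show ?thesis .
qed

text \<open>By \<open>newton_op_hit_density\<close> the potential is the average over the times in
  (0, 2^-j] of flows of a hitting probability, and each of these lies below the excessive function
  \<open>capacitary\<close>.\<close>

lemma newton_op_hit_density_le: "newton_op (hit_density K (1 / 2 ^ j)) x \<le> capacitary x"
proof -
  let ?e = "1 / 2 ^ j :: real"
  have "ennreal ?e * newton_op (hit_density K ?e) x = (\<integral>\<^sup>+t\<in>{0<..?e}. heat_op t (hit K ?e) x \<partial>lborel)"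
    by (rule newton_op_hit_density[OF K _ R KR]) simp
  also have "\<dots> \<le> (\<integral>\<^sup>+t. capacitary x * indicator {0<..?e} t \<partial>lborel)"
  proof (rule nn_integral_mono)
    fix t :: real
    have "heat_op t (hit K ?e) x \<le> capacitary x" if "t > 0"
      using order_trans[OF heat_op_mono heat_op_capacitary_le[OF that]] dyadic_hit_le[of j]
      unfolding dyadic_hit_def by metis
    then show "heat_op t (hit K ?e) x * indicator {0<..?e} t \<le> capacitary x * indicator {0<..?e} t"
      by (auto simp: indicator_def)
  qed
  also have "\<dots> = ennreal ?e * capacitary x"
    by (subst nn_integral_cmult_indicator) (auto simp: mult.commute)
  finally show ?thesis by (simp add: ennreal_mult_le_mult_iff)
qed

text \<open>Off K the hitting probability with step 2^-i is reproduced by the flow over that step.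
  Lengthening the time by t \<le> 2^-j costs at most the displayed factor, and the flow over time t
  of the coarse hitting probability is below that of the fine one. Averaging over t produces the
  potential.\<close>

lemma newton_op_hit_density_ge:
  assumes x: "x \<notin> K" and ij: "i \<le> j"
  shows "ennreal (((1 / 2 ^ i) / (1 / 2 ^ i + 1 / 2 ^ j)) powr (3/2)) * dyadic_hit i x
    \<le> newton_op (hit_density K (1 / 2 ^ j)) x"
proof -
  let ?e = "1 / 2 ^ j :: real" and ?s = "1 / 2 ^ i :: real"
  let ?c = "ennreal ((?s / (?s + ?e)) powr (3/2))"
  have "ennreal ?e * (?c * dyadic_hit i x) = (\<integral>\<^sup>+t. (?c * dyadic_hit i x) * indicator {0<..?e} t \<partial>lborel)"
    by (subst nn_integral_cmult_indicator) (auto simp: mult.commute)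
  also have "\<dots> \<le> (\<integral>\<^sup>+t\<in>{0<..?e}. heat_op t (hit K ?e) x \<partial>lborel)"
  proof (rule nn_integral_mono)
    fix t :: real
    have "?c * dyadic_hit i x \<le> heat_op t (hit K ?e) x" if t: "0 < t" "t \<le> ?e"
    proof -
      have "?c * dyadic_hit i x = ?c * heat_op ?s (hit K ?s) x"
        using hit_off[OF K _ x, of ?s] by (simp add: dyadic_hit_def)
      also have "\<dots> \<le> ennreal ((?s / (?s + t)) powr (3/2)) * heat_op ?s (hit K ?s) x"
        using t by (intro mult_right_mono ennreal_leI powr_mono2 divide_left_mono) (auto intro!: mult_pos_pos add_pos_pos)
      also have "\<dots> \<le> heat_op (?s + t) (hit K ?s) x"
        using t by (intro heat_op_le_heat_op measurable_hit[OF K]) auto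
      also have "\<dots> = heat_op t (heat_op ?s (hit K ?s)) x"
        using t by (subst heat_op_heat_op) (auto simp: add.commute measurable_hit[OF K])
      also have "\<dots> \<le> heat_op t (hit K ?s) x"
        by (intro heat_op_mono heat_op_hit_le[OF K]) simp
      also have "\<dots> \<le> heat_op t (hit K ?e) x"
        using le_funD[OF incseqD[OF incseq_dyadic_hit ij]] by (intro heat_op_mono) (simp add: dyadic_hit_def)
      finally show ?thesis .
    qed
    then show "(?c * dyadic_hit i x) * indicator {0<..?e} t \<le> heat_op t (hit K ?e) x * indicator {0<..?e} t"
      by (auto simp: indicator_def)
  qed
  also have "\<dots> = ennreal ?e * newton_op (hit_density K ?e) x"
    by (rule newton_op_hit_density[OF K _ R KR, symmetric]) simp
  finally show ?thesis by (simp add: ennreal_mult_le_mult_iff)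
qed

lemma potential_capacitary_measure_tendsto:
  assumes x: "x \<notin> K"
  shows "(\<lambda>j. \<integral>\<^sup>+y. ennreal (1 / norm (x - y)) \<partial>capacitary_measure j) \<longlonglongrightarrow> capacitary x"
  unfolding potential_capacitary_measure
proof (rule order_tendstoI)
  fix a assume "capacitary x < a"
  then show "\<forall>\<^sub>F j in sequentially. newton_op (hit_density K (1 / 2 ^ j)) x < a"
    using newton_op_hit_density_le le_less_trans by (intro always_eventually) blast
next
  fix a assume "a < capacitary x"
  \<comment> \<open>The coarse level i is fixed before j tends to infinity; the factor of
    \<open>newton_op_hit_density_ge\<close> then tends to 1, and the potential exceeds a from some j
    on.\<close>
  then obtain i where i: "a < dyadic_hit i x" unfolding capacitary_def less_SUP_iff by blast
  have "(\<lambda>j. ((1 / 2 ^ i) / (1 / 2 ^ i + (1 / 2) ^ j)) powr (3/2)) \<longlonglongrightarrow> ((1 / 2 ^ i) / (1 / 2 ^ i + 0 :: real)) powr (3/2)"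
    by (intro tendsto_intros LIMSEQ_realpow_zero) auto
  then have "(\<lambda>j. ennreal (((1 / 2 ^ i) / (1 / 2 ^ i + (1 / 2) ^ j)) powr (3/2))) \<longlonglongrightarrow> ennreal 1"
    by (intro tendsto_ennrealI) simp
  moreover have "dyadic_hit i x < top"
    using dyadic_hit_le[of i x] capacitary_le_1[of x] by (auto intro: le_less_trans order_trans)
  ultimately have "(\<lambda>j. dyadic_hit i x * ennreal (((1 / 2 ^ i) / (1 / 2 ^ i + (1 / 2) ^ j)) powr (3/2))) \<longlonglongrightarrow> dyadic_hit i x * ennreal 1"
    by (intro ennreal_tendsto_cmult)
  then have "\<forall>\<^sub>F j in sequentially. a < dyadic_hit i x * ennreal (((1 / 2 ^ i) / (1 / 2 ^ i + (1 / 2) ^ j)) powr (3/2))"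
    using i by (intro order_tendstoD) auto
  then show "\<forall>\<^sub>F j in sequentially. a < newton_op (hit_density K (1 / 2 ^ j)) x"
    using eventually_ge_at_top[of i]
  proof eventually_elim
    case (elim j)
    then show ?case using newton_op_hit_density_ge[OF x elim(2)]
      by (simp add: power_divide mult.commute less_le_trans)
  qed
qed

lemma potential_capacitary_measure_le_1: "(\<integral>\<^sup>+y. ennreal (1 / norm (x - y)) \<partial>capacitary_measure j) \<le> 1"
  unfolding potential_capacitary_measure
  by (rule order_trans[OF newton_op_hit_density_le capacitary_le_1])

text \<open>On the support 1 \<le> R / |y|, except at the origin, which has measure zero. Hence the
  total charge is at most R times the potential at the origin, and that potential is at most
  1.\<close>

lemma capacitary_measure_le: "emeasure (capacitary_measure j) UNIV \<le> ennreal R"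
proof -
  let ?f = "\<lambda>y. ennreal newton_const * hit_density K (1 / 2 ^ j) y"
  have "emeasure (capacitary_measure j) UNIV = (\<integral>\<^sup>+y. ?f y \<partial>lborel)"
    unfolding capacitary_measure_def by (subst emeasure_density) auto
  also have "\<dots> \<le> (\<integral>\<^sup>+y. ennreal R * (?f y * ennreal (1 / norm (0 - y))) \<partial>lborel)"
  proof (intro nn_integral_mono_AE AE_mp[OF AE_lborel_singleton[of 0] AE_I2] impI)
    fix y :: "real^3" assume y: "y \<noteq> 0"
    show "?f y \<le> ennreal R * (?f y * ennreal (1 / norm (0 - y)))"
    proof (cases "y \<in> K")
      case True
      then have "norm y \<le> R" using KR by auto
      then have "1 \<le> ennreal R * ennreal (1 / norm (0 - y))"
        using y R by (simp add: field_simps flip: ennreal_mult)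
      from mult_left_mono[OF this, of "?f y"] show ?thesis by (simp add: ac_simps)
    next
      case False
      then show ?thesis using hit_density_off[OF K, of "1 / 2 ^ j" y] by simp
    qed
  qed
  also have "\<dots> = ennreal R * (\<integral>\<^sup>+y. ennreal (1 / norm (0 - y)) \<partial>capacitary_measure j)"
    unfolding capacitary_measure_def by (simp add: nn_integral_density nn_integral_cmult)
  also have "\<dots> \<le> ennreal R * 1"
    by (intro mult_left_mono potential_capacitary_measure_le_1) auto
  finally show ?thesis by simp
qed

end
end

section \<open>Continuous attainment of the boundary value\<close>

lemma heat_op_tail:
  assumes t: "t > 0" and \<rho>: "\<rho> > 0"
  shows "heat_op t (indicator (- ball x \<rho>)) x \<le> ennreal (2 powr (3/2) * exp (- (\<rho>\<^sup>2 / (8 * t))))"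
proof -
  have "heat_op t (indicator (- ball x \<rho>)) x \<le>
      (\<integral>\<^sup>+y. ennreal (2 powr (3/2) * exp (- (\<rho>\<^sup>2 / (8 * t)))) * ennreal (heat (2 * t) (x - y)) \<partial>lborel)"
    unfolding heat_op_def
  proof (rule nn_integral_mono)
    fix y
    \<comment> \<open>Half of the Gaussian exponent is spent on the decay in \<rho>; the other half
      is the exponent of the kernel at time 2 t, whose integral is 1.\<close>
    have "heat t (x - y) \<le> 2 powr (3/2) * exp (- (\<rho>\<^sup>2 / (8 * t))) * heat (2 * t) (x - y)" if "\<rho> \<le> dist x y"
    proof -
      define n where "n = norm (x - y)"
      have n: "\<rho>\<^sup>2 \<le> n\<^sup>2" using that \<rho> by (auto simp: n_def dist_norm intro: power_mono)
      have "- (n\<^sup>2 / (4 * t)) \<le> - (\<rho>\<^sup>2 / (8 * t)) + - (n\<^sup>2 / (4 * (2 * t)))"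
        using t n by (simp add: field_simps)
      then have "exp (- (n\<^sup>2 / (4 * t))) \<le> exp (- (\<rho>\<^sup>2 / (8 * t))) * exp (- (n\<^sup>2 / (4 * (2 * t))))"
        by (simp flip: exp_add)
      moreover have "2 powr (3/2) * (2 * t) powr (- (3/2)) = t powr (- (3/2))"
        using t by (simp add: powr_mult powr_minus)
      ultimately have "t powr (- (3/2)) * exp (- (n\<^sup>2 / (4 * t))) \<le>
          (2 powr (3/2) * (2 * t) powr (- (3/2))) * (exp (- (\<rho>\<^sup>2 / (8 * t))) * exp (- (n\<^sup>2 / (4 * (2 * t)))))"
        by (metis mult_left_mono powr_ge_zero)
      then show ?thesis using gauss_mass_pos
        unfolding heat_def n_def[symmetric] by (simp add: divide_right_mono mult_ac)
    qed
    then show "ennreal (heat t (x - y)) * indicator (- ball x \<rho>) y \<le>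
        ennreal (2 powr (3/2) * exp (- (\<rho>\<^sup>2 / (8 * t)))) * ennreal (heat (2 * t) (x - y))"
      by (auto simp: indicator_def ennreal_leI simp flip: ennreal_mult)
  qed
  also have "\<dots> = ennreal (2 powr (3/2) * exp (- (\<rho>\<^sup>2 / (8 * t))))"
    using t by (simp add: nn_integral_cmult nn_integral_heat)
  finally show ?thesis .
qed

text \<open>Points of a convex body are regular. The homothety with centre \<open>x0\<close> and
  ratio l maps an inscribed ball to a ball of radius l r0 inside K, at distance of order l from
  \<open>x0\<close>. From a point at distance l, the flow over the time l^2 puts a mass \<eta> into
  this ball that does not depend on l. Excessivity of \<open>capacitary\<close> turns this into a
  bound that can be iterated.\<close>

lemma capacitary_boundary:
  fixes K :: "(real ^ 3) set"
  assumes K: "compact K" "convex K" "interior K \<noteq> {}" and x0: "x0 \<in> K" and \<epsilon>: "\<epsilon> > 0"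
  shows "\<exists>d>0. \<forall>x\<in>ball x0 d. ennreal (1 - \<epsilon>) \<le> capacitary K x"
proof -
  have Kb [measurable]: "K \<in> sets borel" using K(1) by (simp add: borel_compact)
  obtain z0 r0 where r0: "r0 > 0" "cball z0 r0 \<subseteq> K"
    using K(3) by (metis ex_in_conv mem_interior_cball)
  \<comment> \<open>For x at distance l from \<open>x0\<close>, all points of the small ball are
    within l D of x: the three summands bound the way to \<open>x0\<close>, to the new centre, and
    the radius. At time l^2 the kernel on the ball is at least exp(-D^2 / 4) / (l^3
    \<open>gauss_mass\<close>), and multiplying by the volume cancels l^3, which gives
    \<open>\<eta>0\<close>.\<close>
  define D where "D = 1 + norm (z0 - x0) + r0"
  have D: "D > 0" using r0 by (simp add: D_def add_pos_nonneg)
  define \<eta>0 where "\<eta>0 = unit_ball_vol 3 * r0 ^ 3 * exp (- (D\<^sup>2 / 4)) / gauss_mass"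
  define \<eta> where "\<eta> = min 1 \<eta>0"
  have "\<eta>0 > 0" using r0 gauss_mass_pos by (simp add: \<eta>0_def unit_ball_vol_pos)
  then have \<eta>: "\<eta> > 0" "\<eta> \<le> 1" by (auto simp: \<eta>_def)
  have cone: "\<exists>B. B \<in> sets borel \<and> B \<subseteq> K \<and> B \<subseteq> cball x0 (l * D) \<and> ennreal \<eta> \<le> heat_op (l\<^sup>2) (indicator B) x"
    if l: "l = dist x x0" "0 < l" "l \<le> 1" for x l
  proof (intro exI conjI)
    define c where "c = x0 + l *\<^sub>R (z0 - x0)"
    let ?B = "cball c (l * r0)"
    show "?B \<in> sets borel" by simp
    show "?B \<subseteq> K"
    proof
      fix y assume y: "y \<in> ?B"
      define z where "z = z0 + (1 / l) *\<^sub>R (y - c)"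
      have "norm (y - c) \<le> l * r0" using y by (simp add: dist_norm norm_minus_commute)
      then have "norm ((1 / l) *\<^sub>R (y - c)) \<le> r0" using l(2) unfolding norm_scaleR by (simp add: field_simps)
      then have "z \<in> cball z0 r0" by (simp add: z_def dist_norm)
      then have "z \<in> K" using r0 by blast
      moreover have "y = (1 - l) *\<^sub>R x0 + l *\<^sub>R z" using l(2) by (simp add: z_def c_def algebra_simps)
      ultimately show "y \<in> K" using K(2) x0 l by (simp add: convex_alt)
    qed
    have B: "norm (y - x0) \<le> l * norm (z0 - x0) + l * r0" if "y \<in> ?B" for y
    proof -
      have "y - x0 = (y - c) + l *\<^sub>R (z0 - x0)" by (simp add: c_def)
      then have "norm (y - x0) \<le> norm (y - c) + norm (l *\<^sub>R (z0 - x0))" using norm_triangle_ineq by metis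
      then show ?thesis using that l by (simp add: dist_norm norm_minus_commute)
    qed
    show "?B \<subseteq> cball x0 (l * D)"
    proof
      fix y assume "y \<in> ?B"
      from B[OF this] show "y \<in> cball x0 (l * D)"
        using l(2) by (simp add: D_def dist_norm norm_minus_commute[of x0] distrib_left)
    qed
    have "ennreal \<eta> \<le> ennreal (exp (- (D\<^sup>2 / 4)) / (l ^ 3 * gauss_mass)) * emeasure lborel ?B"
    proof -
      have "emeasure lborel ?B = ennreal (unit_ball_vol 3 * (l * r0) ^ 3)"
        using l r0 by (simp add: emeasure_cball)
      moreover have "exp (- (D\<^sup>2 / 4)) / (l ^ 3 * gauss_mass) * (unit_ball_vol 3 * (l * r0) ^ 3) = \<eta>0"
        using l by (simp add: \<eta>0_def power_mult_distrib)
      ultimately show ?thesis using gauss_mass_pos l r0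
        by (simp add: \<eta>_def ennreal_leI flip: ennreal_mult)
    qed
    also have "\<dots> = (\<integral>\<^sup>+y. ennreal (exp (- (D\<^sup>2 / 4)) / (l ^ 3 * gauss_mass)) * indicator ?B y \<partial>lborel)"
      by (subst nn_integral_cmult_indicator) auto
    also have "\<dots> \<le> heat_op (l\<^sup>2) (indicator ?B) x"
      unfolding heat_op_def
    proof (rule nn_integral_mono)
      fix y
      have "exp (- (D\<^sup>2 / 4)) / (l ^ 3 * gauss_mass) \<le> heat (l\<^sup>2) (x - y)" if y: "y \<in> ?B"
      proof -
        have "norm (x - y) \<le> norm (x - x0) + norm (y - x0)"
          using norm_triangle_ineq4[of "x - x0" "y - x0"] by simp
        also have "\<dots> \<le> l * D" using B[OF y] l by (simp add: D_def dist_norm algebra_simps)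
        finally have "(norm (x - y))\<^sup>2 \<le> (l * D)\<^sup>2" by (rule power_mono) simp
        then have "(norm (x - y))\<^sup>2 / (4 * l\<^sup>2) \<le> D\<^sup>2 / 4" using l(2) by (simp add: power_mult_distrib field_simps)
        then have E: "exp (- (D\<^sup>2 / 4)) \<le> exp (- ((norm (x - y))\<^sup>2 / (4 * l\<^sup>2)))" by simp
        have P: "(l\<^sup>2) powr (- (3/2)) = 1 / l ^ 3"
        proof -
          have "(l\<^sup>2) powr (- (3/2)) = (l powr 2) powr (- (3/2))" using l by simp
          also have "\<dots> = l powr - 3" unfolding powr_powr by simp
          finally show ?thesis using l by (simp add: powr_minus_divide)
        qed
        have "exp (- (D\<^sup>2 / 4)) / (l ^ 3 * gauss_mass) = 1 / l ^ 3 * exp (- (D\<^sup>2 / 4)) / gauss_mass" by simp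
        also have "\<dots> \<le> 1 / l ^ 3 * exp (- ((norm (x - y))\<^sup>2 / (4 * l\<^sup>2))) / gauss_mass"
          using E l(2) gauss_mass_pos by (intro divide_right_mono mult_left_mono) auto
        finally show ?thesis unfolding heat_def P .
      qed
      then show "ennreal (exp (- (D\<^sup>2 / 4)) / (l ^ 3 * gauss_mass)) * indicator ?B y \<le>
          ennreal (heat (l\<^sup>2) (x - y)) * indicator ?B y"
        by (auto simp: indicator_def ennreal_leI)
    qed
    finally show "ennreal \<eta> \<le> heat_op (l\<^sup>2) (indicator ?B) x" .
  qed
  txt \<open>Each passage to a smaller ball improves the bound on \<open>1 - capacitary\<close> by a fixed factor, since
    the cone property makes the heat flow charge \<open>K\<close> with mass at least \<open>\<eta>\<close>.\<close>
  have improve: "\<exists>d'>0. \<forall>x\<in>ball x0 d'. ennreal (1 - m * (1 - \<eta> / 2)) \<le> capacitary K x"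
    if m: "0 < m" "m \<le> 1" and d: "d > 0" "\<forall>x\<in>ball x0 d. ennreal (1 - m) \<le> capacitary K x" for m d
  proof -
    have "((\<lambda>l. 2 powr (3/2) * exp (- ((d / 2)\<^sup>2 / (8 * l\<^sup>2)))) \<longlongrightarrow> 2 powr (3/2) * 0) (at_right 0)"
    proof (intro tendsto_intros filterlim_compose[OF exp_at_bot])
      have "filterlim (\<lambda>l::real. 8 * l\<^sup>2) (at_right 0) (at_right 0)"
        unfolding filterlim_at by (auto intro!: tendsto_eq_intros simp: eventually_at_filter)
      then have "filterlim (\<lambda>l. (d / 2)\<^sup>2 / (8 * l\<^sup>2)) at_top (at_right 0)"
        using d by (intro LIM_at_top_divide[OF tendsto_const]) (auto simp: filterlim_at intro!: tendsto_eq_intros simp: eventually_at_filter)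
      then show "filterlim (\<lambda>l. - ((d / 2)\<^sup>2 / (8 * l\<^sup>2))) at_bot (at_right 0)"
        by (simp add: filterlim_uminus_at_bot)
    qed
    then have "\<forall>\<^sub>F l in at_right 0. 2 powr (3/2) * exp (- ((d / 2)\<^sup>2 / (8 * l\<^sup>2))) < m * \<eta> / 2"
      using m \<eta> by (intro order_tendstoD) auto
    then obtain d1 where d1: "d1 > 0" "\<And>l. 0 < l \<Longrightarrow> l < d1 \<Longrightarrow> 2 powr (3/2) * exp (- ((d / 2)\<^sup>2 / (8 * l\<^sup>2))) < m * \<eta> / 2"
      unfolding eventually_at_right_field by auto
    \<comment> \<open>The four bounds serve in turn: the Gaussian tail stays below m \<eta> / 2, the
      cone construction applies, \<open>ball x (d / 2)\<close> lies in \<open>ball x0 d\<close>, and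
      so does the small ball \<open>B\<close>.\<close>
    define d' where "d' = Min {d1, 1, d / 2, d / (2 * D)}"
    have d': "d' > 0" "d' \<le> d1" "d' \<le> 1" "d' \<le> d / 2" "d' \<le> d / (2 * D)"
      using d1 d D by (auto simp: d'_def)
    have "ennreal (1 - m * (1 - \<eta> / 2)) \<le> capacitary K x" if x: "x \<in> ball x0 d'" for x
    proof (cases "x = x0")
      case True
      then show ?thesis using capacitary_on[OF Kb x0] m \<eta> by simp
    next
      case False
      define l where "l = dist x x0"
      have l: "0 < l" "l < d'" using x False by (auto simp: l_def dist_commute)
      obtain B where B [measurable]: "B \<in> sets borel" and BK: "B \<subseteq> K" and Bx: "B \<subseteq> cball x0 (l * D)"
        and B\<eta>: "ennreal \<eta> \<le> heat_op (l\<^sup>2) (indicator B) x"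
        using cone[OF l_def l(1)] l d' by auto
      have l2: "l\<^sup>2 > 0" using l by simp
      have Bd: "B \<subseteq> ball x0 d"
      proof -
        have "l * D < d / (2 * D) * D" using l d' D by (intro mult_strict_right_mono) auto
        also have "\<dots> < d" using D d by simp
        finally have "l * D < d" .
        then show ?thesis using Bx by auto
      qed
      have sub: "ball x (d / 2) \<subseteq> ball x0 d"
      proof
        fix y assume "y \<in> ball x (d / 2)"
        then show "y \<in> ball x0 d" using l d' dist_triangle[of x0 y x] by (auto simp: l_def dist_commute)
      qed
      have out: "heat_op (l\<^sup>2) (indicator (- ball x0 d)) x \<le> ennreal (m * \<eta> / 2)"
      proof -
        have "heat_op (l\<^sup>2) (indicator (- ball x0 d)) x \<le> heat_op (l\<^sup>2) (indicator (- ball x (d / 2))) x"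
          using sub by (intro heat_op_mono) (auto simp: indicator_def)
        also have "\<dots> \<le> ennreal (2 powr (3/2) * exp (- ((d / 2)\<^sup>2 / (8 * l\<^sup>2))))"
          using l2 d by (intro heat_op_tail) auto
        also have "\<dots> \<le> ennreal (m * \<eta> / 2)" using d1(2)[of l] l d' by (intro ennreal_leI) auto
        finally show ?thesis .
      qed
      \<comment> \<open>The bound known so far on the ball, raised to 1 on \<open>B\<close>. Its
        flow gains m \<eta> from \<open>B\<close> and loses at most m \<eta> / 2 by escape from the
        ball; the surplus of m \<eta> / 2 is the improvement from m to m (1 - \<eta> / 2).\<close>
      define \<phi> :: "real^3 \<Rightarrow> ennreal" where
        "\<phi> = (\<lambda>y. ennreal (1 - m) * indicator (ball x0 d) y + ennreal m * indicator B y)"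
      have "\<phi> y \<le> capacitary K y" for y
      proof (cases "y \<in> B")
        case True
        then show ?thesis using Bd BK capacitary_on[OF Kb, of y] m
          by (auto simp: \<phi>_def subset_iff simp flip: ennreal_plus)
      next
        case False
        then show ?thesis using d(2) by (auto simp: \<phi>_def indicator_def)
      qed
      then have "heat_op (l\<^sup>2) \<phi> x \<le> heat_op (l\<^sup>2) (capacitary K) x" by (rule heat_op_mono)
      also have "\<dots> \<le> capacitary K x" by (rule heat_op_capacitary_le[OF Kb l2])
      finally have 1: "heat_op (l\<^sup>2) \<phi> x \<le> capacitary K x" .
      have 2: "heat_op (l\<^sup>2) \<phi> x = ennreal (1 - m) * heat_op (l\<^sup>2) (indicator (ball x0 d)) x + ennreal m * heat_op (l\<^sup>2) (indicator B) x"
      proof -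
        have m1: "(\<lambda>y. ennreal (1 - m) * indicator (ball x0 d) y) \<in> borel_measurable borel"
          and m2: "(\<lambda>y. ennreal m * indicator B y) \<in> borel_measurable borel"
          using B by (auto intro!: borel_measurable_times_ennreal borel_measurable_indicator)
        have "heat_op (l\<^sup>2) \<phi> x = heat_op (l\<^sup>2) (\<lambda>y. ennreal (1 - m) * indicator (ball x0 d) y) x
            + heat_op (l\<^sup>2) (\<lambda>y. ennreal m * indicator B y) x"
          unfolding \<phi>_def by (rule heat_op_add[OF m1 m2])
        then show ?thesis using B by (simp add: heat_op_cmult borel_measurable_indicator)
      qed
      define p where "p = enn2real (heat_op (l\<^sup>2) (indicator (ball x0 d)) x)"
      have "heat_op (l\<^sup>2) (indicator (ball x0 d)) x + heat_op (l\<^sup>2) (indicator (- ball x0 d)) x =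
          heat_op (l\<^sup>2) (\<lambda>y. indicator (ball x0 d) y + indicator (- ball x0 d) y) x"
        by (rule heat_op_add[symmetric]) (auto intro!: borel_measurable_indicator)
      also have "(\<lambda>y. indicator (ball x0 d) y + indicator (- ball x0 d) y) = (\<lambda>y::real^3. 1 :: ennreal)"
        by (auto simp: indicator_def)
      also have "heat_op (l\<^sup>2) (\<lambda>y. 1) x = 1" by (rule heat_op_const[OF l2])
      finally have tot: "heat_op (l\<^sup>2) (indicator (ball x0 d)) x + heat_op (l\<^sup>2) (indicator (- ball x0 d)) x = 1" .
      have fin: "heat_op (l\<^sup>2) (indicator (ball x0 d)) x = ennreal p"
      proof -
        have "heat_op (l\<^sup>2) (indicator (ball x0 d)) x \<le> 1"
          using l2 by (intro heat_op_le_1) (auto simp: indicator_def)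
        then have "heat_op (l\<^sup>2) (indicator (ball x0 d)) x \<noteq> top" by (auto simp: top_unique)
        then show ?thesis unfolding p_def by (simp add: less_top)
      qed
      have p: "1 - m * \<eta> / 2 \<le> p"
      proof -
        have "1 \<le> ennreal p + ennreal (m * \<eta> / 2)"
          using tot out unfolding fin by (metis add_left_mono)
        also have "\<dots> = ennreal (p + m * \<eta> / 2)"
          using m \<eta> by (subst ennreal_plus) (auto simp: p_def)
        finally show ?thesis using ennreal_le_iff2[of 1] by (auto simp: algebra_simps ennreal_le_iff2)
      qed
      have "1 - m * (1 - \<eta> / 2) \<le> (1 - m) * p + m * \<eta>"
      proof -
        have "(1 - m) * (1 - m * \<eta> / 2) \<le> (1 - m) * p" using p m by (intro mult_left_mono) auto
        moreover have "(1 - m) * (m * \<eta> / 2) \<le> 1 * (m * \<eta> / 2)" using m \<eta> by (intro mult_right_mono) auto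
        moreover have "(1 - m) * (1 - m * \<eta> / 2) = (1 - m) - (1 - m) * (m * \<eta> / 2)"
          "m * (1 - \<eta> / 2) = m - m * \<eta> / 2"
          by (simp_all add: right_diff_distrib)
        ultimately show ?thesis by linarith
      qed
      then have "ennreal (1 - m * (1 - \<eta> / 2)) \<le> ennreal (1 - m) * ennreal p + ennreal m * ennreal \<eta>"
        using m \<eta> by (simp add: p_def ennreal_leI flip: ennreal_mult ennreal_plus)
      also have "\<dots> \<le> heat_op (l\<^sup>2) \<phi> x" unfolding 2 fin
        by (intro add_left_mono mult_left_mono B\<eta>) auto
      finally show ?thesis using 1 by simp
    qed
    then show ?thesis using d' by blast
  qed
  have iter: "\<exists>d>0. \<forall>x\<in>ball x0 d. ennreal (1 - (1 - \<eta> / 2) ^ n) \<le> capacitary K x" for n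
  proof (induction n)
    case 0
    show ?case by (intro exI[of _ 1]) auto
  next
    case (Suc n)
    then obtain d where "d > 0" "\<forall>x\<in>ball x0 d. ennreal (1 - (1 - \<eta> / 2) ^ n) \<le> capacitary K x" by blast
    from improve[OF _ _ this] show ?case using \<eta> by (simp add: power_le_one mult.commute)
  qed
  have "(\<lambda>n. (1 - \<eta> / 2) ^ n) \<longlonglongrightarrow> 0" using \<eta> by (intro LIMSEQ_realpow_zero) auto
  from order_tendstoD(2)[OF this \<epsilon>] obtain n where "(1 - \<eta> / 2) ^ n < \<epsilon>"
    unfolding eventually_sequentially by blast
  then have "ennreal (1 - \<epsilon>) \<le> ennreal (1 - (1 - \<eta> / 2) ^ n)" by (intro ennreal_leI) auto
  then show ?thesis using iter[of n] order_trans by blast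
qed

section \<open>Limits of Newtonian potentials\<close>

text \<open>Meant for derivatives of potentials: their difference quotients with a fixed step
  converge, and they approximate the derivatives uniformly in the index.\<close>

lemma convergent_uniform_approx:
  fixes a :: "nat \<Rightarrow> real"
  assumes "\<And>e. e > 0 \<Longrightarrow> \<exists>c. convergent c \<and> (\<forall>j. \<bar>a j - c j\<bar> \<le> e)"
  shows "convergent a"
proof (rule Cauchy_convergent, rule metric_CauchyI)
  fix e :: real assume e: "e > 0"
  obtain c where c: "convergent c" "\<And>j. \<bar>a j - c j\<bar> \<le> e / 4" using assms[of "e / 4"] e by auto
  obtain N where N: "\<And>m n. m \<ge> N \<Longrightarrow> n \<ge> N \<Longrightarrow> dist (c m) (c n) < e / 4"
    using metric_CauchyD[OF convergent_Cauchy[OF c(1)], of "e / 4"] e by auto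
  have "dist (a m) (a n) < e" if "m \<ge> N" "n \<ge> N" for m n
  proof -
    have "\<bar>a m - a n\<bar> \<le> \<bar>a m - c m\<bar> + \<bar>c m - c n\<bar> + \<bar>a n - c n\<bar>" by linarith
    also have "\<dots> < e" using N[OF that] c(2)[of m] c(2)[of n] e by (simp add: dist_real_def)
    finally show ?thesis by (simp add: dist_real_def)
  qed
  then show "\<exists>N. \<forall>m\<ge>N. \<forall>n\<ge>N. dist (a m) (a n) < e" by blast
qed

text \<open>Keeps all differences x' - y in one compact set off the singularity, where the kernels
  are bounded and uniformly continuous.\<close>

lemma compact_diff_separated:
  fixes K :: "'a::euclidean_space set"
  assumes K: "compact K" and x: "x \<notin> K"
  obtains d Z where "d > 0" "compact Z" "0 \<notin> Z"
    "\<And>x' y. x' \<in> cball x d \<Longrightarrow> y \<in> K \<Longrightarrow> x' - y \<in> Z" "cball x d \<subseteq> - K"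
proof -
  have "open (- K)" using K by (simp add: compact_imp_closed open_Compl)
  then obtain d where d: "d > 0" "cball x d \<subseteq> - K" using x open_contains_cball by blast
  let ?Z = "{x' - y | x' y. x' \<in> cball x d \<and> y \<in> K}"
  have "compact ?Z" using compact_differences[OF compact_cball K] by simp
  then show ?thesis using d by (intro that[of d ?Z]) auto
qed

text \<open>Common bounds on support and mass stand in for a weak limit of the charges: they make
  the estimates of the potentials uniform in j, so pointwise convergence of the potentials carries
  over to their derivatives.\<close>

locale bounded_charges =
  fixes K :: "'a::euclidean_space set" and M :: "nat \<Rightarrow> 'a measure" and C :: real
  assumes K: "compact K"
    and sets_M [simp, measurable_cong]: "\<And>j. sets (M j) = sets borel"
    and M_off: "\<And>j. emeasure (M j) (- K) = 0"
    and M_le: "\<And>j. emeasure (M j) UNIV \<le> ennreal C"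
    and C: "C \<ge> 0"
begin

lemma space_M [simp]: "space (M j) = UNIV"
  using sets_eq_imp_space_eq[OF sets_M[of j]] by simp

lemma finite_M: "finite_measure (M j)"
  by standard (use M_le[of j] in \<open>auto simp: top_unique\<close>)

lemma measure_M: "measure (M j) UNIV \<le> C"
  unfolding measure_def using M_le[of j] C by (intro enn2real_leI) auto

lemma AE_M: "AE y in M j. y \<in> K"
  using M_off[of j] K by (intro AE_I[of _ _ "- K"]) (auto simp: compact_imp_closed)

lemma integrable_M:
  assumes [measurable]: "f \<in> borel_measurable borel" and "\<And>y. y \<in> K \<Longrightarrow> \<bar>f y\<bar> \<le> (B :: real)"
  shows "integrable (M j) f"
  using assms(2) AE_M[of j]
  by (intro finite_measure.integrable_const_bound[OF finite_M, where B = B]) (auto elim: AE_mp simp: measurable_cong_sets[OF sets_M refl])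

lemma integral_M_le:
  assumes [measurable]: "f \<in> borel_measurable borel" and B: "\<And>y. y \<in> K \<Longrightarrow> \<bar>f y\<bar> \<le> (B :: real)" "B \<ge> 0"
  shows "\<bar>LINT y|M j. f y\<bar> \<le> C * B"
proof -
  interpret finite_measure "M j" by (rule finite_M)
  have "\<bar>LINT y|M j. f y\<bar> \<le> (LINT y|M j. \<bar>f y\<bar>)" by (rule integral_abs_bound)
  also have "\<dots> \<le> (LINT y|M j. B)"
    using B AE_M[of j] by (intro integral_mono_AE integrable_M[of _ B] integrable_const) (auto elim: AE_mp)
  also have "\<dots> = measure (M j) UNIV * B" by simp
  also have "\<dots> \<le> C * B" using measure_M B by (intro mult_right_mono)
  finally show ?thesis .
qed

definition pot :: "('a \<Rightarrow> real) \<Rightarrow> nat \<Rightarrow> 'a \<Rightarrow> real" where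
  "pot \<phi> j x = (LINT y|M j. \<phi> (x - y))"

lemma bounded_kernel:
  assumes \<phi>: "continuous_on (- {0}) (\<phi> :: 'a \<Rightarrow> real)" and x: "x \<notin> K"
  obtains B where "\<And>y. y \<in> K \<Longrightarrow> \<bar>\<phi> (x - y)\<bar> \<le> B"
proof -
  obtain d Z where Z: "d > 0" "compact Z" "0 \<notin> Z" "\<And>x' y. x' \<in> cball x d \<Longrightarrow> y \<in> K \<Longrightarrow> x' - y \<in> Z"
    by (rule compact_diff_separated[OF K x]) blast
  have "compact (\<phi> ` Z)"
    using Z by (intro compact_continuous_image continuous_on_subset[OF \<phi>]) auto
  then obtain B where "\<And>r. r \<in> \<phi> ` Z \<Longrightarrow> norm r \<le> B" using compact_imp_bounded bounded_iff by metis
  then show ?thesis using Z(1) Z(4)[of x] by (intro that[of B]) auto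
qed

lemma integrable_kernel:
  assumes \<phi>: "continuous_on (- {0}) (\<phi> :: 'a \<Rightarrow> real)" and [measurable]: "\<phi> \<in> borel_measurable borel"
    and x: "x \<notin> K"
  shows "integrable (M j) (\<lambda>y. \<phi> (x - y))"
proof -
  obtain B where "\<And>y. y \<in> K \<Longrightarrow> \<bar>\<phi> (x - y)\<bar> \<le> B" by (rule bounded_kernel[OF \<phi> x]) blast
  then show ?thesis by (intro integrable_M[of _ B]) auto
qed

text \<open>The kernel is uniformly continuous on the compact set of differences and the masses are
  at most C, so near x the potentials share a modulus of continuity, which the limit
  inherits.\<close>

lemma continuous_on_lim_pot:
  assumes \<phi>: "continuous_on (- {0}) \<phi>" and [measurable]: "\<phi> \<in> borel_measurable borel"
    and conv: "\<And>x. x \<notin> K \<Longrightarrow> (\<lambda>j. pot \<phi> j x) \<longlonglongrightarrow> F x"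
  shows "continuous_on (- K) F"
proof -
  have "isCont F x" if x: "x \<notin> K" for x
    unfolding continuous_at_eps_delta
  proof (intro allI impI)
    fix e :: real assume e: "e > 0"
    obtain d Z where Z: "d > 0" "compact Z" "0 \<notin> Z" "\<And>x' y. x' \<in> cball x d \<Longrightarrow> y \<in> K \<Longrightarrow> x' - y \<in> Z" "cball x d \<subseteq> - K"
      by (rule compact_diff_separated[OF K x]) blast
    define e' where "e' = e / (2 * (C + 1))"
    have e': "e' > 0" "C * e' < e" using e C by (auto simp: e'_def field_simps intro: add_nonneg_pos)
    have "uniformly_continuous_on Z \<phi>"
      using Z by (intro compact_uniformly_continuous continuous_on_subset[OF \<phi>]) auto
    then obtain \<delta> where \<delta>: "\<delta> > 0" "\<And>z z'. z \<in> Z \<Longrightarrow> z' \<in> Z \<Longrightarrow> dist z' z < \<delta> \<Longrightarrow> dist (\<phi> z') (\<phi> z) < e'"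
      unfolding uniformly_continuous_on_def using e' by metis
    have "dist (F x') (F x) < e" if x': "dist x' x < min d \<delta>" for x'
    proof -
      have x'd: "x' \<in> cball x d" using x' by (simp add: dist_commute)
      have x'K: "x' \<notin> K" using x'd Z(5) by auto
      have "\<bar>pot \<phi> j x' - pot \<phi> j x\<bar> \<le> C * e'" for j
      proof -
        have "pot \<phi> j x' - pot \<phi> j x = (LINT y|M j. \<phi> (x' - y) - \<phi> (x - y))"
          unfolding pot_def by (intro Bochner_Integration.integral_diff[symmetric] integrable_kernel \<phi> x x'K assms(2))
        also have "\<bar>\<dots>\<bar> \<le> C * e'"
        proof (rule integral_M_le)
          fix y assume y: "y \<in> K"
          have "dist (\<phi> (x' - y)) (\<phi> (x - y)) < e'"
            using y x' x'd Z by (intro \<delta>(2)) (auto simp: dist_norm)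
          then show "\<bar>\<phi> (x' - y) - \<phi> (x - y)\<bar> \<le> e'" by (simp add: dist_real_def)
        qed (use e' in auto)
        finally show ?thesis .
      qed
      then have "\<bar>F x' - F x\<bar> \<le> C * e'"
        by (intro LIMSEQ_le_const2[OF tendsto_rabs[OF tendsto_diff[OF conv[OF x'K] conv[OF x]]]]) auto
      then show ?thesis using e' by (simp add: dist_real_def)
    qed
    then show "\<exists>d>0. \<forall>x'. dist x' x < d \<longrightarrow> dist (F x') (F x) < e" using Z(1) \<delta>(1) by (metis min_less_iff_conj)
  qed
  then show ?thesis by (intro continuous_at_imp_continuous_on) auto
qed

lemma pot_inner:
  assumes G: "continuous_on (- {0}) G" and [measurable]: "G \<in> borel_measurable borel" and x: "x \<notin> K"
  shows "pot (\<lambda>z. G z \<bullet> v) j x = (\<Sum>b\<in>Basis. (v \<bullet> b) * pot (\<lambda>z. G z \<bullet> b) j x)"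
proof -
  have "pot (\<lambda>z. G z \<bullet> v) j x = (LINT y|M j. (\<Sum>b\<in>Basis. (v \<bullet> b) * (G (x - y) \<bullet> b)))"
    unfolding pot_def by (subst euclidean_inner) (simp add: mult.commute)
  also have "\<dots> = (\<Sum>b\<in>Basis. (v \<bullet> b) * pot (\<lambda>z. G z \<bullet> b) j x)"
    unfolding pot_def
    by (subst Bochner_Integration.integral_sum)
      (auto intro!: integrable_mult_right integrable_kernel[where \<phi> = "\<lambda>z. G z \<bullet> b" for b] continuous_intros G x)
  finally show ?thesis .
qed

lemma pot_linearization:
  assumes \<phi>: "\<And>z. z \<noteq> 0 \<Longrightarrow> GDERIV \<phi> z :> G z" and [measurable]: "\<phi> \<in> borel_measurable borel"
    and G: "continuous_on (- {0}) G" and [measurable]: "G \<in> borel_measurable borel"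
    and x: "x \<notin> K" and e: "e > 0"
  obtains d where "d > 0" "cball x d \<subseteq> - K"
    "\<And>h j. norm h \<le> d \<Longrightarrow> \<bar>pot \<phi> j (x + h) - pot \<phi> j x - pot (\<lambda>z. G z \<bullet> h) j x\<bar> \<le> e * norm h"
proof -
  obtain d Z where Z: "d > 0" "compact Z" "0 \<notin> Z" "\<And>x' y. x' \<in> cball x d \<Longrightarrow> y \<in> K \<Longrightarrow> x' - y \<in> Z" "cball x d \<subseteq> - K"
    by (rule compact_diff_separated[OF K x]) blast
  \<comment> \<open>The summand 1 admits C = 0; integrating a pointwise error e' |h| against a mass
    of at most C stays below e |h|.\<close>
  define e' where "e' = e / (C + 1)"
  have e': "e' > 0" "C * e' \<le> e" using e C by (auto simp: e'_def divide_simps mult_left_mono)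
  have "uniformly_continuous_on Z G"
    using Z by (intro compact_uniformly_continuous continuous_on_subset[OF G]) auto
  then obtain \<delta> where \<delta>: "\<delta> > 0" "\<And>z z'. z \<in> Z \<Longrightarrow> z' \<in> Z \<Longrightarrow> dist z' z < \<delta> \<Longrightarrow> dist (G z') (G z) < e'"
    unfolding uniformly_continuous_on_def using e' by metis
  have cont\<phi>: "continuous_on (- {0}) \<phi>"
    using \<phi> unfolding gderiv_def by (intro continuous_at_imp_continuous_on) (auto intro: has_derivative_continuous)
  define r where "r = min d (\<delta> / 2)"
  have r: "r > 0" "r \<le> d" "r < \<delta>" using Z(1) \<delta>(1) by (auto simp: r_def)
  have "\<bar>pot \<phi> j (x + h) - pot \<phi> j x - pot (\<lambda>z. G z \<bullet> h) j x\<bar> \<le> e * norm h" if h: "norm h \<le> r" for h j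
  proof -
    have xh: "x + h \<notin> K"
    proof -
      have "x + h \<in> cball x d" using h r by (simp add: dist_norm)
      then show ?thesis using Z(5) by auto
    qed
    have "pot \<phi> j (x + h) - pot \<phi> j x - pot (\<lambda>z. G z \<bullet> h) j x =
        (LINT y|M j. \<phi> (x + h - y) - \<phi> (x - y) - G (x - y) \<bullet> h)"
    proof -
      have "integrable (M j) (\<lambda>y. \<phi> (x + h - y))" "integrable (M j) (\<lambda>y. \<phi> (x - y))"
        by (intro integrable_kernel[OF cont\<phi>] assms(2) x xh)+
      moreover have "integrable (M j) (\<lambda>y. G (x - y) \<bullet> h)"
        by (rule integrable_kernel[where \<phi> = "\<lambda>z. G z \<bullet> h"]) (auto intro!: continuous_intros G x)
      ultimately show ?thesis unfolding pot_def by simp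
    qed
    also have "\<bar>\<dots>\<bar> \<le> C * (e' * norm h)"
    proof (rule integral_M_le)
      fix y assume y: "y \<in> K"
      define S where "S = (\<lambda>x'. x' - y) ` cball x r"
      have SZ: "S \<subseteq> Z" using y r Z(4) by (auto simp: S_def)
      have "norm (\<phi> (x + h - y) - \<phi> (x - y) - (\<lambda>v. v \<bullet> G (x - y)) ((x + h - y) - (x - y))) \<le>
          norm ((x + h - y) - (x - y)) * e'"
      proof (rule differentiable_bound_linearization[where S = S and f' = "\<lambda>z v. v \<bullet> G z"])
        show "(x - y) + t *\<^sub>R ((x + h - y) - (x - y)) \<in> S" if t: "t \<in> {0..1}" for t
        proof -
          have "\<bar>t\<bar> * norm h \<le> 1 * r" using t h by (intro mult_mono) auto
          then have "x + t *\<^sub>R h \<in> cball x r" by (simp add: dist_norm)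
          then show ?thesis unfolding S_def by (intro image_eqI[of _ _ "x + t *\<^sub>R h"]) auto
        qed
        show "(\<phi> has_derivative (\<lambda>v. v \<bullet> G z)) (at z within S)" if "z \<in> S" for z
          using \<phi>[of z] SZ Z(3) that by (auto simp: gderiv_def intro: has_derivative_at_withinI)
        show "onorm ((\<lambda>v. v \<bullet> G z) - (\<lambda>v. v \<bullet> G (x - y))) \<le> e'" if z: "z \<in> S" for z
        proof (rule onorm_le)
          fix v :: 'a
          have xyZ: "x - y \<in> Z" using y Z(1,4) by auto
          have "dist z (x - y) < \<delta>" using z r by (auto simp: S_def dist_norm norm_minus_commute)
          then have "norm (G z - G (x - y)) < e'" using \<delta>(2)[OF xyZ _] SZ z by (auto simp: dist_norm)
          then have "norm v * norm (G z - G (x - y)) \<le> norm v * e'" by (intro mult_left_mono) auto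
          moreover have "\<bar>v \<bullet> (G z - G (x - y))\<bar> \<le> norm v * norm (G z - G (x - y))" by (rule Cauchy_Schwarz_ineq2)
          ultimately show "norm (((\<lambda>v. v \<bullet> G z) - (\<lambda>v. v \<bullet> G (x - y))) v) \<le> e' * norm v"
            by (simp add: inner_diff_right mult.commute)
        qed
        show "x - y \<in> S" using r by (auto simp: S_def)
      qed
      then show "\<bar>\<phi> (x + h - y) - \<phi> (x - y) - G (x - y) \<bullet> h\<bar> \<le> e' * norm h"
        by (simp add: inner_commute mult.commute)
    qed (use e' in auto)
    also have "\<dots> \<le> e * norm h" using e' by (simp add: mult.assoc[symmetric] mult_right_mono)
    finally show ?thesis .
  qed
  moreover have "cball x r \<subseteq> - K" using r(2) Z(5) by (meson subset_trans subset_cball)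
  ultimately show ?thesis using r(1) by (intro that[of r]) auto
qed

text \<open>For each fixed step the difference quotients converge by assumption, and
  \<open>pot_linearization\<close> makes them approximate the integrated directional derivatives
  uniformly in j. So these converge too, and the uniform remainder identifies the limit as the
  gradient of F. The second conclusion has the form of the hypothesis \<open>conv\<close>, so that
  the lemma applies again to the components of G and yields second derivatives.\<close>

lemma lim_pot_gderiv:
  assumes \<phi>: "\<And>z. z \<noteq> 0 \<Longrightarrow> GDERIV \<phi> z :> G z" and \<phi>m: "\<phi> \<in> borel_measurable borel"
    and G: "continuous_on (- {0}) G" and Gm: "G \<in> borel_measurable borel"
    and conv: "\<And>x. x \<notin> K \<Longrightarrow> (\<lambda>j. pot \<phi> j x) \<longlonglongrightarrow> F x"
  obtains g where "\<And>x. x \<notin> K \<Longrightarrow> GDERIV F x :> g x"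
    "\<And>x v. x \<notin> K \<Longrightarrow> (\<lambda>j. pot (\<lambda>z. G z \<bullet> v) j x) \<longlonglongrightarrow> g x \<bullet> v"
proof -
  have cv: "convergent (\<lambda>j. pot (\<lambda>z. G z \<bullet> b) j x)" if x: "x \<notin> K" and b: "b \<in> Basis" for x b
  proof (rule convergent_uniform_approx)
    fix e :: real assume "e > 0"
    then obtain d where d: "d > 0" "cball x d \<subseteq> - K"
      "\<And>h j. norm h \<le> d \<Longrightarrow> \<bar>pot \<phi> j (x + h) - pot \<phi> j x - pot (\<lambda>z. G z \<bullet> h) j x\<bar> \<le> e * norm h"
      using pot_linearization[OF \<phi> \<phi>m G Gm x] by blast
    define c where "c j = (pot \<phi> j (x + d *\<^sub>R b) - pot \<phi> j x) / d" for j
    have "x + d *\<^sub>R b \<in> cball x d" using b d by (simp add: dist_norm)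
    then have "x + d *\<^sub>R b \<notin> K" using d by auto
    then have "convergent c" unfolding c_def convergent_def
      using tendsto_divide[OF tendsto_diff[OF conv[of "x + d *\<^sub>R b"] conv[OF x]] tendsto_const[of d]] d(1) by auto
    moreover have "\<bar>pot (\<lambda>z. G z \<bullet> b) j x - c j\<bar> \<le> e" for j
    proof -
      have "pot (\<lambda>z. G z \<bullet> (d *\<^sub>R b)) j x = d * pot (\<lambda>z. G z \<bullet> b) j x"
        unfolding pot_def by simp
      then have "d * \<bar>pot (\<lambda>z. G z \<bullet> b) j x - c j\<bar> \<le> d * e"
      proof -
        have "d * \<bar>pot (\<lambda>z. G z \<bullet> b) j x - c j\<bar> = \<bar>d * (pot (\<lambda>z. G z \<bullet> b) j x - c j)\<bar>"
          using d(1) by (simp add: abs_mult)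
        also have "d * (pot (\<lambda>z. G z \<bullet> b) j x - c j) = - (pot \<phi> j (x + d *\<^sub>R b) - pot \<phi> j x - d * pot (\<lambda>z. G z \<bullet> b) j x)"
        proof -
          have "d * c j = pot \<phi> j (x + d *\<^sub>R b) - pot \<phi> j x" using d(1) by (simp add: c_def)
          then show ?thesis by (simp add: right_diff_distrib)
        qed
        finally show ?thesis using d(3)[of "d *\<^sub>R b" j] d(1) b \<open>pot (\<lambda>z. G z \<bullet> (d *\<^sub>R b)) j x = _\<close>
          by (simp add: mult.commute)
      qed
      then show ?thesis using d(1) by simp
    qed
    ultimately show "\<exists>c. convergent c \<and> (\<forall>j. \<bar>pot (\<lambda>z. G z \<bullet> b) j x - c j\<bar> \<le> e)" by blast
  qed
  define g where "g x = (\<Sum>b\<in>Basis. lim (\<lambda>j. pot (\<lambda>z. G z \<bullet> b) j x) *\<^sub>R b)" for x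
  have lim: "(\<lambda>j. pot (\<lambda>z. G z \<bullet> v) j x) \<longlonglongrightarrow> g x \<bullet> v" if x: "x \<notin> K" for x v
  proof -
    have "(\<lambda>j. \<Sum>b\<in>Basis. (v \<bullet> b) * pot (\<lambda>z. G z \<bullet> b) j x) \<longlonglongrightarrow>
        (\<Sum>b\<in>Basis. (v \<bullet> b) * lim (\<lambda>j. pot (\<lambda>z. G z \<bullet> b) j x))"
      using cv[OF x] by (intro tendsto_intros) (simp add: convergent_LIMSEQ_iff)
    moreover have "g x \<bullet> v = (\<Sum>b\<in>Basis. (v \<bullet> b) * lim (\<lambda>j. pot (\<lambda>z. G z \<bullet> b) j x))"
      unfolding g_def inner_sum_left by (intro sum.cong) (auto simp: inner_commute[of v] mult.commute)
    ultimately show ?thesis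
      unfolding pot_inner[OF G Gm x, of v] by simp
  qed
  have "GDERIV F x :> g x" if x: "x \<notin> K" for x
    unfolding gderiv_def has_derivative_at_alt
  proof (intro conjI allI impI)
    fix e :: real assume "e > 0"
    then obtain d where d: "d > 0" "cball x d \<subseteq> - K"
      "\<And>h j. norm h \<le> d \<Longrightarrow> \<bar>pot \<phi> j (x + h) - pot \<phi> j x - pot (\<lambda>z. G z \<bullet> h) j x\<bar> \<le> e * norm h"
      using pot_linearization[OF \<phi> \<phi>m G Gm x] by blast
    have "norm (F y - F x - (y - x) \<bullet> g x) \<le> e * norm (y - x)" if y: "norm (y - x) < d" for y
    proof -
      have "y \<in> cball x d" using y by (simp add: dist_norm norm_minus_commute)
      then have "y \<notin> K" using d by auto
      then have "(\<lambda>j. \<bar>pot \<phi> j y - pot \<phi> j x - pot (\<lambda>z. G z \<bullet> (y - x)) j x\<bar>) \<longlonglongrightarrow> \<bar>F y - F x - g x \<bullet> (y - x)\<bar>"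
        using x by (intro tendsto_intros conv lim)
      then have "\<bar>F y - F x - g x \<bullet> (y - x)\<bar> \<le> e * norm (y - x)"
        using d(3)[of "y - x"] y by (intro LIMSEQ_le_const2) auto
      then show ?thesis by (simp add: inner_commute)
    qed
    then show "\<exists>d>0. \<forall>y. norm (y - x) < d \<longrightarrow> norm (F y - F x - (y - x) \<bullet> g x) \<le> e * norm (y - x)"
      using d(1) by blast
  qed (rule bounded_linear_inner_left)
  then show ?thesis using lim that by blast
qed

end

lemma GDERIV_inverse_norm:
  fixes z :: "'a::euclidean_space"
  assumes z: "z \<noteq> 0"
  shows "GDERIV (\<lambda>z. 1 / norm z) z :> - (1 / norm z ^ 3) *\<^sub>R z"
proof (rule GDERIV_subst)
  show "GDERIV (\<lambda>z. 1 / norm z) z :> (- (1 / (norm z)\<^sup>2)) *\<^sub>R sgn z"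
    by (rule GDERIV_DERIV_compose[OF GDERIV_norm[OF z], where g = "\<lambda>r. 1 / r"])
      (use z in \<open>auto intro!: derivative_eq_intros simp: power2_eq_square\<close>)
  show "(- (1 / (norm z)\<^sup>2)) *\<^sub>R sgn z = - (1 / norm z ^ 3) *\<^sub>R z"
    by (simp add: sgn_div_norm power2_eq_square power3_eq_cube divide_inverse)
qed

lemma GDERIV_inner_div_norm_cube:
  fixes z b :: "'a::euclidean_space"
  assumes z: "z \<noteq> 0"
  shows "GDERIV (\<lambda>z. (- (1 / norm z ^ 3) *\<^sub>R z) \<bullet> b) z :> (3 * (z \<bullet> b) / norm z ^ 5) *\<^sub>R z - (1 / norm z ^ 3) *\<^sub>R b"
proof -
  have 1: "GDERIV (\<lambda>z. z \<bullet> b) z :> b"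
    unfolding gderiv_def by (intro derivative_intros)
  have 2: "GDERIV (\<lambda>z. - (1 / norm z ^ 3)) z :> (3 / norm z ^ 4) *\<^sub>R sgn z"
  proof (rule GDERIV_DERIV_compose[OF GDERIV_norm[OF z], where g = "\<lambda>r. - (1 / r ^ 3)"])
    define r where "r = norm z"
    have r: "r > 0" using z by (simp add: r_def)
    have "((\<lambda>r. - (1 / r ^ 3)) has_real_derivative - ((0 * r ^ 3 - 1 * (3 * r ^ 2)) / (r ^ 3 * r ^ 3))) (at r)"
      by (rule derivative_eq_intros refl | use r in simp)+
    also have "- ((0 * r ^ 3 - 1 * (3 * r ^ 2)) / (r ^ 3 * r ^ 3)) = 3 / r ^ 4"
      using r by (simp add: divide_simps flip: power_add)
    finally show "((\<lambda>r. - (1 / r ^ 3)) has_real_derivative 3 / norm z ^ 4) (at (norm z))"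
      by (simp add: r_def)
  qed
  have "(3 / norm z ^ 4) *\<^sub>R sgn z = (3 / norm z ^ 5) *\<^sub>R z"
    by (simp add: sgn_div_norm divide_inverse eval_nat_numeral)
  then show ?thesis
    using GDERIV_mult[OF 2 1] by (simp add: algebra_simps)
qed

text \<open>Two applications of \<open>lim_pot_gderiv\<close>, to 1 / |z| and to the components of
  its gradient. The Hessian of the kernel has trace zero, hence so have its integrals against the
  charges and their limits.\<close>

lemma newton_limit_harmonic:
  fixes K :: "(real ^ 3) set"
  assumes "bounded_charges K M C"
    and conv: "\<And>x. x \<notin> K \<Longrightarrow> (\<lambda>j. bounded_charges.pot M (\<lambda>z. 1 / norm z) j x) \<longlonglongrightarrow> u x"
  obtains g where "harmonic_on u (- K)" "\<And>x. x \<notin> K \<Longrightarrow> GDERIV u x :> g x" "continuous_on (- K) g"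
    "\<And>x v. x \<notin> K \<Longrightarrow> (\<lambda>j. bounded_charges.pot M (\<lambda>z. (- (1 / norm z ^ 3) *\<^sub>R z) \<bullet> v) j x) \<longlonglongrightarrow> g x \<bullet> v"
proof -
  interpret bounded_charges K M C by fact
  define G where "G z = - (1 / norm z ^ 3) *\<^sub>R z" for z :: "real^3"
  define H where "H b z = (3 * (z \<bullet> b) / norm z ^ 5) *\<^sub>R z - (1 / norm z ^ 3) *\<^sub>R b" for b z :: "real^3"
  have Gc: "continuous_on (- {0}) G" unfolding G_def by (intro continuous_intros) auto
  have Gm [measurable]: "G \<in> borel_measurable borel" unfolding G_def by measurable
  have Hc: "continuous_on (- {0}) (H b)" for b unfolding H_def by (intro continuous_intros) auto
  have Hm [measurable]: "H b \<in> borel_measurable borel" for b unfolding H_def by measurable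
  have dG: "GDERIV (\<lambda>z. 1 / norm z) z :> G z" if "z \<noteq> 0" for z
    unfolding G_def using GDERIV_inverse_norm[OF that] .
  have dH: "GDERIV (\<lambda>z. G z \<bullet> b) z :> H b z" if "z \<noteq> 0" for z b
    unfolding G_def H_def using GDERIV_inner_div_norm_cube[OF that] .
  obtain g where g: "\<And>x. x \<notin> K \<Longrightarrow> GDERIV u x :> g x"
    "\<And>x v. x \<notin> K \<Longrightarrow> (\<lambda>j. pot (\<lambda>z. G z \<bullet> v) j x) \<longlonglongrightarrow> g x \<bullet> v"
    by (rule lim_pot_gderiv[OF dG _ Gc Gm conv]) auto
  have "\<exists>gb. (\<forall>x. x \<notin> K \<longrightarrow> GDERIV (\<lambda>x. g x \<bullet> b) x :> gb x) \<and>
      (\<forall>x v. x \<notin> K \<longrightarrow> (\<lambda>j. pot (\<lambda>z. H b z \<bullet> v) j x) \<longlonglongrightarrow> gb x \<bullet> v)" for b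
    by (rule lim_pot_gderiv[OF dH _ Hc Hm g(2)]) auto
  then obtain gb where gb: "\<And>b x. x \<notin> K \<Longrightarrow> GDERIV (\<lambda>x. g x \<bullet> b) x :> gb b x"
    "\<And>b x v. x \<notin> K \<Longrightarrow> (\<lambda>j. pot (\<lambda>z. H b z \<bullet> v) j x) \<longlonglongrightarrow> gb b x \<bullet> v" by metis
  \<comment> \<open>Rank-one operators assemble the Hessian as a bounded linear function, so its
    continuity reduces to that of the matrix entries.\<close>
  define E where "E b c = Blinfun (\<lambda>v::real^3. (v \<bullet> c) *\<^sub>R b)" for b c :: "real^3"
  have E: "blinfun_apply (E b c) v = (v \<bullet> c) *\<^sub>R b" for b c v
    unfolding E_def by (subst bounded_linear_Blinfun_apply) (auto intro!: bounded_linear_intros)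
  define h where "h x = (\<Sum>b\<in>Basis. \<Sum>c\<in>Basis. (gb b x \<bullet> c) *\<^sub>R E b c)" for x
  have h: "blinfun_apply (h x) v = (\<Sum>b\<in>Basis. (v \<bullet> gb b x) *\<^sub>R b)" for x v
  proof -
    have "blinfun_apply (h x) v = (\<Sum>b\<in>Basis. (\<Sum>c\<in>Basis. (gb b x \<bullet> c) * (v \<bullet> c)) *\<^sub>R b)"
      unfolding h_def by (simp add: blinfun.sum_left blinfun.scaleR_left E scaleR_sum_left)
    moreover have "(\<Sum>c\<in>Basis. (gb b x \<bullet> c) * (v \<bullet> c)) = v \<bullet> gb b x" for b
      unfolding euclidean_inner[of v "gb b x"] by (simp add: mult.commute)
    ultimately show ?thesis by simp
  qed
  have dg: "(g has_derivative blinfun_apply (h x)) (at x)" if x: "x \<notin> K" for x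
    unfolding has_derivative_componentwise_within[of g _ x UNIV, simplified]
  proof
    fix i :: "real^3" assume i: "i \<in> Basis"
    then have "blinfun_apply (h x) v \<bullet> i = v \<bullet> gb i x" for v by (simp add: h)
    then show "((\<lambda>x. g x \<bullet> i) has_derivative (\<lambda>v. blinfun_apply (h x) v \<bullet> i)) (at x)"
      using gb(1)[OF x] by (simp add: gderiv_def)
  qed
  have harm: "harmonic_on u (- K)" unfolding harmonic_on_def
  proof (intro exI[of _ g] exI[of _ h] conjI ballI)
    show "GDERIV u x :> g x" if "x \<in> - K" for x using g(1) that by simp
    show "(g has_derivative blinfun_apply (h x)) (at x)" if "x \<in> - K" for x using dg that by simp
    have "continuous_on (- K) (\<lambda>x. gb b x \<bullet> c)" for b c
      by (rule continuous_on_lim_pot[OF _ _ gb(2)]) (auto intro!: continuous_intros Hc)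
    then show "continuous_on (- K) h"
      unfolding h_def by (intro continuous_on_sum continuous_on_scaleR continuous_on_const)
    fix x assume "x \<in> - K"
    then have x: "x \<notin> K" by simp
    \<comment> \<open>The trace is 3 |z|^2 / |z|^5 - 3 / |z|^3, where the last 3 is the dimension.
      At z = 0 all terms are 0 by division by zero.\<close>
    have tr0: "(\<Sum>b\<in>Basis. H b z \<bullet> b) = 0" for z
    proof (cases "z = 0")
      case False
      have "(\<Sum>b\<in>Basis. H b z \<bullet> b) = 3 / norm z ^ 5 * (\<Sum>b\<in>Basis. (z \<bullet> b) * (z \<bullet> b)) - (1 / norm z ^ 3) * (\<Sum>b\<in>(Basis :: (real^3) set). b \<bullet> b)"
        by (simp add: H_def inner_diff_left sum_subtractf sum_distrib_left mult.assoc)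
      also have "(\<Sum>b\<in>(Basis :: (real^3) set). b \<bullet> b) = 3" by simp
      also have "(\<Sum>b\<in>Basis. (z \<bullet> b) * (z \<bullet> b)) = (norm z)\<^sup>2"
        unfolding power2_norm_eq_inner euclidean_inner[of z z] ..
      also have "3 / norm z ^ 5 * (norm z)\<^sup>2 - (1 / norm z ^ 3) * 3 = 0"
        using False by (simp add: divide_simps flip: power_add)
      finally show ?thesis .
    qed (simp add: H_def)
    have "(\<lambda>j. \<Sum>b\<in>Basis. pot (\<lambda>z. H b z \<bullet> b) j x) \<longlonglongrightarrow> (\<Sum>b\<in>Basis. gb b x \<bullet> b)"
      by (intro tendsto_sum gb(2) x)
    moreover have "(\<Sum>b\<in>Basis. pot (\<lambda>z. H b z \<bullet> b) j x) = 0" for j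
    proof -
      have "(\<Sum>b\<in>Basis. pot (\<lambda>z. H b z \<bullet> b) j x) = (LINT y|M j. (\<Sum>b\<in>Basis. H b (x - y) \<bullet> b))"
        unfolding pot_def
        by (rule Bochner_Integration.integral_sum[symmetric])
          (rule integrable_kernel[where \<phi> = "\<lambda>z. H b z \<bullet> b" for b], auto intro!: continuous_intros Hc x)
      then show ?thesis by (simp add: tr0)
    qed
    ultimately have "(\<lambda>j::nat. 0) \<longlonglongrightarrow> (\<Sum>b\<in>Basis. gb b x \<bullet> b)" by simp
    then have "(\<Sum>b\<in>Basis. gb b x \<bullet> b) = 0" unfolding LIMSEQ_const_iff by simp
    moreover have "(\<Sum>b\<in>Basis. blinfun_apply (h x) b \<bullet> b) = (\<Sum>b\<in>Basis. gb b x \<bullet> b)"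
      by (intro sum.cong) (auto simp: h inner_commute[of _ "gb _ x"])
    ultimately show "(\<Sum>b\<in>Basis. blinfun_apply (h x) b \<bullet> b) = 0" by simp
  qed
  have gc: "continuous_on (- K) g"
    using dg by (intro continuous_at_imp_continuous_on) (auto intro: has_derivative_continuous)
  show ?thesis by (rule that[OF harm g(1) gc g(2)[unfolded G_def]])
qed

text \<open>Besides the potential, the charges are handed over: that their gradient fields converge
  to g, that their potentials are at most 1 everywhere, and that they charge no point. These facts
  are what the energy estimate of \<open>newtonian_capacity_le\<close> consumes.\<close>

lemma electrostatic_potential_exists:
  fixes K :: "(real ^ 3) set"
  assumes cb: "convex_body K" and KR: "K \<subseteq> cball 0 R" and R: "R > 0"
  obtains u g M where "is_electrostatic_potential K u" "bounded_charges K M R"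
    "\<And>x. x \<notin> K \<Longrightarrow> GDERIV u x :> g x" "continuous_on (- K) g"
    "\<And>x v. x \<notin> K \<Longrightarrow> (\<lambda>j. bounded_charges.pot M (\<lambda>z. (- (1 / norm z ^ 3) *\<^sub>R z) \<bullet> v) j x) \<longlonglongrightarrow> g x \<bullet> v"
    "\<And>j x. (\<integral>\<^sup>+y. ennreal (1 / norm (x - y)) \<partial>M j) \<le> 1" "\<And>j x. AE y in M j. y \<noteq> x"
proof -
  have Kc: "compact K" "convex K" "interior K \<noteq> {}" using cb by (auto simp: convex_body_def)
  have Kb: "K \<in> sets borel" using Kc(1) by (simp add: borel_compact)
  have Kcl: "closed K" using Kc(1) by (rule compact_imp_closed)
  define M where "M = capacitary_measure K"
  define u where "u x = enn2real (capacitary K x)" for x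
  have Mb: "bounded_charges K M R"
    by standard (use Kc R capacitary_measure_le[OF Kb R KR] capacitary_measure_off[OF Kb] sets_capacitary_measure[OF Kb] in \<open>auto simp: M_def\<close>)
  then interpret bounded_charges K M R .
  have uc: "ennreal (u x) = capacitary K x" for x
    using capacitary_le_1[OF Kb, of x] unfolding u_def by (intro ennreal_enn2real) (auto intro: le_less_trans)
  have u0: "0 \<le> u x" for x by (simp add: u_def)
  have u1: "u x \<le> 1" for x using capacitary_le_1[OF Kb, of x] unfolding uc[symmetric] by simp
  have uK: "u x = 1" if "x \<in> K" for x using capacitary_on[OF Kb that] by (simp add: u_def)
  have conv: "(\<lambda>j. pot (\<lambda>z. 1 / norm z) j x) \<longlonglongrightarrow> u x" if x: "x \<notin> K" for x
  proof -
    have "pot (\<lambda>z. 1 / norm z) j x = enn2real (\<integral>\<^sup>+y. ennreal (1 / norm (x - y)) \<partial>M j)" for j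
      unfolding pot_def by (subst integral_eq_nn_integral) auto
    moreover have "(\<lambda>j. \<integral>\<^sup>+y. ennreal (1 / norm (x - y)) \<partial>M j) \<longlonglongrightarrow> ennreal (u x)"
      using potential_capacitary_measure_tendsto[OF Kb R KR x] unfolding M_def uc .
    ultimately show ?thesis using tendsto_enn2real[OF _ u0] by simp
  qed
  obtain g where g: "harmonic_on u (- K)" "\<And>x. x \<notin> K \<Longrightarrow> GDERIV u x :> g x" "continuous_on (- K) g"
    "\<And>x v. x \<notin> K \<Longrightarrow> (\<lambda>j. pot (\<lambda>z. (- (1 / norm z ^ 3) *\<^sub>R z) \<bullet> v) j x) \<longlonglongrightarrow> g x \<bullet> v"
    by (rule newton_limit_harmonic[OF Mb conv]) auto
  have pot: "is_electrostatic_potential K u" unfolding is_electrostatic_potential_def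
  proof (intro conjI ballI g(1))
    show "continuous_on (- interior K) u" unfolding continuous_on_eq_continuous_within
    proof
      fix x assume x: "x \<in> - interior K"
      show "continuous (at x within - interior K) u"
      proof (cases "x \<in> K")
        case False
        then have "isCont u x" using g(2) unfolding gderiv_def by (metis has_derivative_continuous)
        then show ?thesis by (rule continuous_at_imp_continuous_at_within)
      next
        case True
        show ?thesis unfolding continuous_within_eps_delta
        proof (intro allI impI)
          fix e :: real assume e: "e > 0"
          then obtain d where d: "d > 0" "\<And>y. y \<in> ball x d \<Longrightarrow> ennreal (1 - e / 2) \<le> capacitary K y"
            using capacitary_boundary[OF Kc True, of "e / 2"] by auto
          have "dist (u y) (u x) < e" if "dist y x < d" for y
          proof -
            have "ennreal (1 - e / 2) \<le> ennreal (u y)" using d(2)[of y] that by (simp add: dist_commute uc)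
            then have "1 - e / 2 \<le> u y" using u0[of y] by (simp add: ennreal_le_iff)
            then show ?thesis using u1[of y] e by (simp add: uK[OF True] dist_real_def)
          qed
          then show "\<exists>d>0. \<forall>y\<in>- interior K. dist y x < d \<longrightarrow> dist (u y) (u x) < e" using d(1) by blast
        qed
      qed
    qed
    show "u x = 1" if "x \<in> frontier K" for x
      using uK that Kcl by (auto simp: frontier_def closure_closed)
    show "(u \<longlongrightarrow> 0) at_infinity"
    proof (rule tendsto_sandwich[OF always_eventually _ tendsto_const])
      show "\<forall>\<^sub>F x in at_infinity. u x \<le> R / norm x"
      proof (rule eventually_mono[OF eventually_not_equal_at_infinity[of 0]])
        fix x :: "real^3" assume "x \<noteq> 0"
        from capacitary_le[OF Kb R KR this] show "u x \<le> R / norm x"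
          unfolding uc[symmetric] using R by (simp add: ennreal_le_iff)
      qed
      show "((\<lambda>x::real^3. R / norm x) \<longlongrightarrow> 0) at_infinity"
        by (intro tendsto_divide_0[OF tendsto_const] filterlim_at_top_imp_at_infinity filterlim_norm_at_top)
    qed (use u0 in auto)
  qed
  have ae: "AE y in M j. y \<noteq> x" for j x
    unfolding M_def capacitary_measure_def[OF Kb]
    by (subst AE_density) (use AE_lborel_singleton[of x] measurable_hit_density'[OF Kb] in auto)
  have p1: "(\<integral>\<^sup>+y. ennreal (1 / norm (x - y)) \<partial>M j) \<le> 1" for j x
    unfolding M_def by (rule potential_capacitary_measure_le_1[OF Kb R KR])
  show ?thesis by (rule that[OF pot Mb g(2-4) p1 ae])
qed

section \<open>An upper bound for the capacity\<close>

text \<open>A multiple of \<open>|x|\<^sup>-\<^sup>2\<close>, written as a heat integral so that its convolution square follows from the semigroup law.\<close>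

definition riesz_kernel :: "real ^ 3 \<Rightarrow> ennreal" where
  "riesz_kernel x = (\<integral>\<^sup>+t\<in>{0<..}. ennreal (heat t x * t powr (- (1/2))) \<partial>lborel)"

definition riesz_const :: real where
  "riesz_const = 4 * exp (1/4) * gauss_mass"

lemma riesz_const_pos: "riesz_const > 0"
  using gauss_mass_pos by (simp add: riesz_const_def)

text \<open>With n = |x|, the times between n^2 and 2 n^2 suffice: there the integrand is at least
  (2 n^2)^-2 exp(-1/4) / \<open>gauss_mass\<close>, over a length n^2. The reciprocal of the
  resulting coefficient of n^-2 is \<open>riesz_const\<close>.\<close>

lemma inverse_square_le_riesz_kernel: "ennreal (1 / (norm x)\<^sup>2) \<le> ennreal riesz_const * riesz_kernel x"
proof (cases "x = 0")
  case False
  define n where "n = norm x"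
  have n: "n > 0" using False by (simp add: n_def)
  let ?c = "(2 * n\<^sup>2) powr (-2) * exp (- (1/4)) / gauss_mass"
  have "ennreal ?c * ennreal (n\<^sup>2) = (\<integral>\<^sup>+t. ennreal ?c * indicator {n\<^sup>2..2 * n\<^sup>2} t \<partial>lborel)"
    by (subst nn_integral_cmult_indicator) auto
  also have "\<dots> \<le> riesz_kernel x" unfolding riesz_kernel_def
  proof (rule nn_integral_mono)
    fix t
    have "?c \<le> heat t x * t powr (- (1/2))" if t: "n\<^sup>2 \<le> t" "t \<le> 2 * n\<^sup>2"
    proof -
      have t0: "t > 0" using t n by (smt (verit) zero_less_power)
      have "heat t x * t powr (- (1/2)) = (t powr (- (3/2)) * t powr (- (1/2))) * exp (- (n\<^sup>2 / (4 * t))) / gauss_mass"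
        by (simp add: heat_def n_def)
      also have "t powr (- (3/2)) * t powr (- (1/2)) = t powr (- 2)" by (simp flip: powr_add)
      finally have *: "heat t x * t powr (- (1/2)) = t powr (- 2) * exp (- (n\<^sup>2 / (4 * t))) / gauss_mass" .
      have "(2 * n\<^sup>2) powr (- 2) \<le> t powr (- 2)" using t t0 by (intro powr_mono2') auto
      moreover have "exp (- (1/4)) \<le> exp (- (n\<^sup>2 / (4 * t)))" using t t0 by (simp add: field_simps)
      ultimately show ?thesis unfolding * using gauss_mass_pos by (intro divide_right_mono mult_mono) auto
    qed
    then show "ennreal ?c * indicator {n\<^sup>2..2 * n\<^sup>2} t \<le> ennreal (heat t x * t powr (- (1/2))) * indicator {0<..} t"
      using n by (auto simp: indicator_def ennreal_leI) (smt (verit) zero_less_power)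
  qed
  also have "ennreal ?c * ennreal (n\<^sup>2) = ennreal (?c * n\<^sup>2)"
    using gauss_mass_pos by (intro ennreal_mult[symmetric]) auto
  finally have "ennreal (?c * n\<^sup>2) \<le> riesz_kernel x" .
  then have "ennreal riesz_const * ennreal (?c * n\<^sup>2) \<le> ennreal riesz_const * riesz_kernel x" by (rule mult_left_mono) simp
  moreover have "riesz_const * (?c * n\<^sup>2) = 1 / n\<^sup>2"
  proof -
    have "(2 * n\<^sup>2) powr (-2) = 1 / (2 * n\<^sup>2)\<^sup>2" using n by (simp add: powr_minus_divide)
    then show ?thesis using n gauss_mass_pos
      by (simp add: riesz_const_def exp_minus power2_eq_square field_simps)
  qed
  ultimately show ?thesis using riesz_const_pos gauss_mass_pos by (simp add: n_def flip: ennreal_mult)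
qed simp

lemma measurable_riesz_kernel [measurable]: "riesz_kernel \<in> borel_measurable borel"
  unfolding riesz_kernel_def by measurable

definition beta_half :: ennreal where
  "beta_half = (\<integral>\<^sup>+t\<in>{0<..<1}. ennreal (t powr (- (1/2)) * (1 - t) powr (- (1/2))) \<partial>lborel)"

lemma beta_half_finite: "beta_half < top"
proof -
  have "((\<lambda>t. t powr (1/2 - 1) * (1 - t) powr (1/2 - 1)) has_integral Beta (1/2) (1/2 :: real)) {0..1}"
    by (rule has_integral_Beta_real) auto
  from nn_integral_has_integral_lebesgue[OF _ this]
  have "(\<integral>\<^sup>+t. ennreal (indicator {0..1} t * (t powr (1/2 - 1) * (1 - t) powr (1/2 - 1))) \<partial>lborel) = ennreal (Beta (1/2) (1/2))"
    by (simp add: mult.commute)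
  moreover have "beta_half \<le> (\<integral>\<^sup>+t. ennreal (indicator {0..1} t * (t powr (1/2 - 1) * (1 - t) powr (1/2 - 1))) \<partial>lborel)"
    unfolding beta_half_def by (intro nn_integral_mono) (auto simp: indicator_def)
  ultimately show ?thesis by (metis ennreal_less_top le_less_trans)
qed

text \<open>The Beta integral with parameters 1/2 and 1/2: the two exponents -1/2 and the length
  element have total degree 0, so the length a cancels.\<close>

lemma beta_half_scale:
  assumes a: "a > 0"
  shows "(\<integral>\<^sup>+t\<in>{0<..<a}. ennreal (t powr (- (1/2)) * (a - t) powr (- (1/2))) \<partial>lborel) = beta_half"
proof -
  have "(\<integral>\<^sup>+t\<in>{0<..<a}. ennreal (t powr (- (1/2)) * (a - t) powr (- (1/2))) \<partial>lborel) =
      ennreal \<bar>a\<bar> * (\<integral>\<^sup>+r. ennreal ((0 + a * r) powr (- (1/2)) * (a - (0 + a * r)) powr (- (1/2))) * indicator {0<..<a} (0 + a * r) \<partial>lborel)"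
    using a by (intro nn_integral_real_affine) auto
  also have "\<dots> = beta_half" unfolding beta_half_def
  proof (subst nn_integral_cmult[symmetric], simp, intro nn_integral_cong)
    fix r :: real
    show "ennreal \<bar>a\<bar> * (ennreal ((0 + a * r) powr (- (1/2)) * (a - (0 + a * r)) powr (- (1/2))) * indicator {0<..<a} (0 + a * r)) =
        ennreal (r powr (- (1/2)) * (1 - r) powr (- (1/2))) * indicator {0<..<1} r"
    proof (cases "0 < r \<and> r < 1")
      case True
      have "a - a * r = a * (1 - r)" by (simp add: algebra_simps)
      then have "a * ((a * r) powr (- (1/2)) * (a - a * r) powr (- (1/2))) =
          (a powr 1 * (a powr (- (1/2)) * a powr (- (1/2)))) * (r powr (- (1/2)) * (1 - r) powr (- (1/2)))"
        using True a by (simp add: powr_mult)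
      also have "a powr 1 * (a powr (- (1/2)) * a powr (- (1/2))) = 1"
        using a by (simp only: powr_add[symmetric]) simp
      finally have "a * ((a * r) powr (- (1/2)) * (a - a * r) powr (- (1/2))) = r powr (- (1/2)) * (1 - r) powr (- (1/2))"
        by simp
      then show ?thesis using True a by (simp add: indicator_def flip: ennreal_mult)
    qed (use a in \<open>auto simp: indicator_def zero_less_mult_iff\<close>)
  qed
  finally show ?thesis .
qed

text \<open>The space integral joins the Gaussians at times t and s to the one at time a = t + s.
  For fixed a the weights t^(-1/2) (a - t)^(-1/2) integrate to the constant
  \<open>beta_half\<close>, and what remains is the time integral of \<open>heat\<close>.\<close>

lemma riesz_kernel_convolution:
  "(\<integral>\<^sup>+x. riesz_kernel (y - x) * riesz_kernel (x - z) \<partial>lborel) = beta_half * newton_kernel (y - z)"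
proof -
  let ?p = "\<lambda>t::real. t powr (- (1/2))"
  let ?i = "indicator {0<..} :: real \<Rightarrow> ennreal"
  have "(\<integral>\<^sup>+x. riesz_kernel (y - x) * riesz_kernel (x - z) \<partial>lborel) =
      (\<integral>\<^sup>+x. \<integral>\<^sup>+t. \<integral>\<^sup>+s. (ennreal (heat t (y - x) * ?p t) * ?i t) * (ennreal (heat s (x - z) * ?p s) * ?i s) \<partial>lborel \<partial>lborel \<partial>lborel)"
    unfolding riesz_kernel_def by (simp add: nn_integral_cmult nn_integral_multc)
  also have "\<dots> = (\<integral>\<^sup>+t. \<integral>\<^sup>+x. \<integral>\<^sup>+s. (ennreal (heat t (y - x) * ?p t) * ?i t) * (ennreal (heat s (x - z) * ?p s) * ?i s) \<partial>lborel \<partial>lborel \<partial>lborel)"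
    by (rule lborel_pair.Fubini') measurable
  also have "\<dots> = (\<integral>\<^sup>+t. \<integral>\<^sup>+s. \<integral>\<^sup>+x. (ennreal (heat t (y - x) * ?p t) * ?i t) * (ennreal (heat s (x - z) * ?p s) * ?i s) \<partial>lborel \<partial>lborel \<partial>lborel)"
    by (intro nn_integral_cong lborel_pair.Fubini') measurable
  also have "\<dots> = (\<integral>\<^sup>+t. \<integral>\<^sup>+s. ennreal (heat (t + s) (y - z)) * ennreal (?p t * ?p s) * ?i t * ?i s \<partial>lborel \<partial>lborel)"
  proof (intro nn_integral_cong)
    fix t s :: real
    show "(\<integral>\<^sup>+x. (ennreal (heat t (y - x) * ?p t) * ?i t) * (ennreal (heat s (x - z) * ?p s) * ?i s) \<partial>lborel) =
      ennreal (heat (t + s) (y - z)) * ennreal (?p t * ?p s) * ?i t * ?i s"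
    proof (cases "t > 0 \<and> s > 0")
      case True
      have "(\<integral>\<^sup>+x. (ennreal (heat t (y - x) * ?p t) * ?i t) * (ennreal (heat s (x - z) * ?p s) * ?i s) \<partial>lborel) =
          (\<integral>\<^sup>+x. (ennreal (heat t (y - x)) * ennreal (heat s (x - z))) * ennreal (?p t * ?p s) \<partial>lborel)"
        using True by (intro nn_integral_cong) (simp add: ennreal_mult ac_simps)
      then show ?thesis using True by (simp add: nn_integral_multc heat_convolution)
    qed (auto simp: indicator_def)
  qed
  also have "\<dots> = (\<integral>\<^sup>+t. \<integral>\<^sup>+a. ennreal (heat a (y - z)) * ennreal (?p t * ?p (a - t)) * ?i t * ?i (a - t) \<partial>lborel \<partial>lborel)"
  proof (rule nn_integral_cong)
    fix t :: real
    show "(\<integral>\<^sup>+s. ennreal (heat (t + s) (y - z)) * ennreal (?p t * ?p s) * ?i t * ?i s \<partial>lborel) =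
        (\<integral>\<^sup>+a. ennreal (heat a (y - z)) * ennreal (?p t * ?p (a - t)) * ?i t * ?i (a - t) \<partial>lborel)"
      by (subst (2) nn_integral_real_affine[where c = 1 and t = t]) auto
  qed
  also have "\<dots> = (\<integral>\<^sup>+a. \<integral>\<^sup>+t. ennreal (heat a (y - z)) * ennreal (?p t * ?p (a - t)) * ?i t * ?i (a - t) \<partial>lborel \<partial>lborel)"
    by (rule lborel_pair.Fubini') measurable
  also have "\<dots> = (\<integral>\<^sup>+a. (ennreal (heat a (y - z)) * ?i a) * beta_half \<partial>lborel)"
  proof (intro nn_integral_cong)
    fix a :: real
    show "(\<integral>\<^sup>+t. ennreal (heat a (y - z)) * ennreal (?p t * ?p (a - t)) * ?i t * ?i (a - t) \<partial>lborel) =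
        (ennreal (heat a (y - z)) * ?i a) * beta_half"
    proof (cases "a > 0")
      case True
      have "(\<integral>\<^sup>+t. ennreal (heat a (y - z)) * ennreal (?p t * ?p (a - t)) * ?i t * ?i (a - t) \<partial>lborel) =
          (\<integral>\<^sup>+t. ennreal (heat a (y - z)) * (ennreal (?p t * ?p (a - t)) * indicator {0<..<a} t) \<partial>lborel)"
        by (intro nn_integral_cong) (auto simp: indicator_def)
      then show ?thesis using True by (simp add: nn_integral_cmult beta_half_scale)
    next
      case False
      then have "?i t * ?i (a - t) = 0" for t by (auto simp: indicator_def)
      then have "ennreal (heat a (y - z)) * ennreal (?p t * ?p (a - t)) * ?i t * ?i (a - t) = 0" for t
        by (metis mult.assoc mult_zero_right)
      then have "(\<integral>\<^sup>+t. ennreal (heat a (y - z)) * ennreal (?p t * ?p (a - t)) * ?i t * ?i (a - t) \<partial>lborel) =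
          (\<integral>\<^sup>+t. 0 \<partial>(lborel :: real measure))"
        by (intro nn_integral_cong) blast
      then show ?thesis using False by (simp add: indicator_def)
    qed
  qed
  also have "\<dots> = beta_half * newton_kernel (y - z)"
    unfolding newton_kernel_def by (subst nn_integral_multc) (auto simp: mult.commute)
  finally show ?thesis .
qed

definition cap_const :: real where
  "cap_const = riesz_const\<^sup>2 * enn2real beta_half * newton_const"

text \<open>The field of the j-th charge is bounded by \<open>I j\<close>, the integral of |x -
  y|^-2, and Fatou's lemma bounds the energy of u by the integrals of the squares of these. By the
  convolution identity such an integral is at most a multiple of the mutual energy of the charge
  with itself; its potential is at most 1, so the total charge, at most R, remains as the
  bound.\<close>

lemma newtonian_capacity_le:
  fixes K :: "(real ^ 3) set"
  assumes cb: "convex_body K" and KR: "K \<subseteq> cball 0 R" and R: "R > 0"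
  shows "newtonian_capacity K \<le> ennreal (cap_const * R)"
proof -
  obtain u g M where u: "is_electrostatic_potential K u" and Mb: "bounded_charges K M R"
    and g: "\<And>x. x \<notin> K \<Longrightarrow> GDERIV u x :> g x" "continuous_on (- K) g"
    and conv: "\<And>x v. x \<notin> K \<Longrightarrow> (\<lambda>j. bounded_charges.pot M (\<lambda>z. (- (1 / norm z ^ 3) *\<^sub>R z) \<bullet> v) j x) \<longlonglongrightarrow> g x \<bullet> v"
    and pot1: "\<And>j x. (\<integral>\<^sup>+y. ennreal (1 / norm (x - y)) \<partial>M j) \<le> 1" and M0: "\<And>j x. AE y in M j. y \<noteq> x"
    by (rule electrostatic_potential_exists[OF assms]) blast
  interpret bounded_charges K M R by (rule Mb)
  have Kcl: "closed K" using K by (rule compact_imp_closed)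
  define I where "I j x = (\<integral>\<^sup>+y. ennreal (1 / (norm (x - y))\<^sup>2) \<partial>M j)" for j x
  have sf: "sigma_finite_measure (M j)" for j
    using finite_M[of j] by (rule finite_measure.axioms)
  have Im [measurable]: "I j \<in> borel_measurable borel" for j
  proof -
    interpret sigma_finite_measure "M j" by (rule sf)
    show ?thesis unfolding I_def by measurable
  qed
  \<comment> \<open>The limit field is tested against its own direction v: |p j| / |v| tends to |g
    x|, and it is bounded by \<open>I j x\<close> because the gradient of 1 / |z| has norm
    |z|^-2.\<close>
  have le: "ennreal ((norm (g x))\<^sup>2) \<le> liminf (\<lambda>j. (I j x)\<^sup>2)" if x: "x \<notin> K" for x
  proof (cases "g x = 0")
    case False
    define v where "v = g x"
    have v: "norm v > 0" using False by (simp add: v_def)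
    define p where "p j = pot (\<lambda>z. (- (1 / norm z ^ 3) *\<^sub>R z) \<bullet> v) j x" for j
    have "p \<longlonglongrightarrow> (norm v)\<^sup>2" using conv[OF x, of v] by (simp add: p_def[abs_def] v_def power2_norm_eq_inner)
    then have "(\<lambda>j. ennreal ((\<bar>p j\<bar> / norm v)\<^sup>2)) \<longlonglongrightarrow> ennreal ((\<bar>(norm v)\<^sup>2\<bar> / norm v)\<^sup>2)"
      using v by (intro tendsto_ennrealI tendsto_intros) auto
    then have "(\<lambda>j. ennreal ((\<bar>p j\<bar> / norm v)\<^sup>2)) \<longlonglongrightarrow> ennreal ((norm v)\<^sup>2)"
      using v by (simp add: power2_eq_square)
    then have "ennreal ((norm v)\<^sup>2) = liminf (\<lambda>j. ennreal ((\<bar>p j\<bar> / norm v)\<^sup>2))"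
      by (intro lim_imp_Liminf[symmetric]) auto
    also have "\<dots> \<le> liminf (\<lambda>j. (I j x)\<^sup>2)"
    proof (intro Liminf_mono always_eventually allI)
      fix j
      have "ennreal \<bar>p j\<bar> \<le> (\<integral>\<^sup>+y. ennreal (norm ((- (1 / norm (x - y) ^ 3) *\<^sub>R (x - y)) \<bullet> v)) \<partial>M j)"
        unfolding p_def pot_def real_norm_def[symmetric] by (rule integral_norm_bound_ennreal)
          (rule integrable_kernel[where \<phi> = "\<lambda>z. (- (1 / norm z ^ 3) *\<^sub>R z) \<bullet> v"], auto intro!: continuous_intros x)
      also have "\<dots> \<le> (\<integral>\<^sup>+y. ennreal (norm v) * ennreal (1 / (norm (x - y))\<^sup>2) \<partial>M j)"
      proof (rule nn_integral_mono)
        fix y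
        have "norm ((- (1 / norm (x - y) ^ 3) *\<^sub>R (x - y)) \<bullet> v) \<le> norm (- (1 / norm (x - y) ^ 3) *\<^sub>R (x - y)) * norm v"
          unfolding real_norm_def by (rule Cauchy_Schwarz_ineq2)
        also have "norm (- (1 / norm (x - y) ^ 3) *\<^sub>R (x - y)) = 1 / (norm (x - y))\<^sup>2"
          by (simp add: power2_eq_square power3_eq_cube)
        finally show "ennreal (norm ((- (1 / norm (x - y) ^ 3) *\<^sub>R (x - y)) \<bullet> v)) \<le> ennreal (norm v) * ennreal (1 / (norm (x - y))\<^sup>2)"
          by (simp add: mult.commute ennreal_leI flip: ennreal_mult)
      qed
      also have "\<dots> = ennreal (norm v) * I j x" unfolding I_def by (simp add: nn_integral_cmult)
      finally have "ennreal (1 / norm v) * ennreal \<bar>p j\<bar> \<le> ennreal (1 / norm v) * (ennreal (norm v) * I j x)"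
        by (rule mult_left_mono) simp
      then have "ennreal (\<bar>p j\<bar> / norm v) \<le> I j x"
        using v by (simp add: mult.assoc[symmetric] flip: ennreal_mult)
      then have "(ennreal (\<bar>p j\<bar> / norm v))\<^sup>2 \<le> (I j x)\<^sup>2" by (intro power_mono) auto
      then show "ennreal ((\<bar>p j\<bar> / norm v)\<^sup>2) \<le> (I j x)\<^sup>2" by (simp add: ennreal_power)
    qed
    finally show ?thesis by (simp add: v_def)
  qed simp
  have Isq: "(\<integral>\<^sup>+x. (I j x)\<^sup>2 \<partial>lborel) \<le> ennreal (cap_const * R)" for j
  proof -
    interpret Mj: sigma_finite_measure "M j" by (rule sf)
    interpret P: pair_sigma_finite lborel "M j" ..
    let ?r = "ennreal riesz_const"
    have "(\<integral>\<^sup>+x. (I j x)\<^sup>2 \<partial>lborel) =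
        (\<integral>\<^sup>+x. \<integral>\<^sup>+y. \<integral>\<^sup>+z. ennreal (1 / (norm (x - y))\<^sup>2) * ennreal (1 / (norm (x - z))\<^sup>2) \<partial>M j \<partial>M j \<partial>lborel)"
      unfolding I_def power2_eq_square[of "integral\<^sup>N _ _"] by (simp add: nn_integral_cmult nn_integral_multc)
    also have "\<dots> \<le> (\<integral>\<^sup>+x. \<integral>\<^sup>+y. \<integral>\<^sup>+z. (?r * riesz_kernel (y - x)) * (?r * riesz_kernel (x - z)) \<partial>M j \<partial>M j \<partial>lborel)"
    proof (intro nn_integral_mono mult_mono)
      show "ennreal (1 / (norm (x - y))\<^sup>2) \<le> ?r * riesz_kernel (y - x)" for x y
        using inverse_square_le_riesz_kernel[of "y - x"] by (simp add: norm_minus_commute)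
    qed (auto intro: inverse_square_le_riesz_kernel)
    also have "\<dots> = (\<integral>\<^sup>+y. \<integral>\<^sup>+x. \<integral>\<^sup>+z. (?r * riesz_kernel (y - x)) * (?r * riesz_kernel (x - z)) \<partial>M j \<partial>lborel \<partial>M j)"
      by (rule P.Fubini'[symmetric]) measurable
    also have "\<dots> = (\<integral>\<^sup>+y. \<integral>\<^sup>+z. \<integral>\<^sup>+x. (?r * riesz_kernel (y - x)) * (?r * riesz_kernel (x - z)) \<partial>lborel \<partial>M j \<partial>M j)"
      by (intro nn_integral_cong P.Fubini'[symmetric]) measurable
    also have "\<dots> = (\<integral>\<^sup>+y. \<integral>\<^sup>+z. ?r * ?r * beta_half * newton_kernel (y - z) \<partial>M j \<partial>M j)"
    proof (intro nn_integral_cong)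
      fix y z
      have "(\<integral>\<^sup>+x. (?r * riesz_kernel (y - x)) * (?r * riesz_kernel (x - z)) \<partial>lborel) =
          (\<integral>\<^sup>+x. (?r * ?r) * (riesz_kernel (y - x) * riesz_kernel (x - z)) \<partial>lborel)"
        by (simp add: ac_simps)
      also have "\<dots> = ?r * ?r * beta_half * newton_kernel (y - z)"
        by (simp add: nn_integral_cmult riesz_kernel_convolution mult.assoc)
      finally show "(\<integral>\<^sup>+x. (?r * riesz_kernel (y - x)) * (?r * riesz_kernel (x - z)) \<partial>lborel) = ?r * ?r * beta_half * newton_kernel (y - z)" .
    qed
    also have "\<dots> = (\<integral>\<^sup>+y. \<integral>\<^sup>+z. (?r * ?r * beta_half * ennreal newton_const) * ennreal (1 / norm (y - z)) \<partial>M j \<partial>M j)"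
    proof (rule nn_integral_cong, rule nn_integral_cong_AE)
      fix y
      show "AE z in M j. ?r * ?r * beta_half * newton_kernel (y - z) = ?r * ?r * beta_half * ennreal newton_const * ennreal (1 / norm (y - z))"
        using M0[of y j]
      proof eventually_elim
        case (elim z)
        then have "newton_kernel (y - z) = ennreal newton_const * ennreal (1 / norm (y - z))"
          using newton_const_pos by (simp add: newton_kernel_eq flip: ennreal_mult)
        then show ?case by (simp add: mult.assoc)
      qed
    qed
    also have "\<dots> = (\<integral>\<^sup>+y. (?r * ?r * beta_half * ennreal newton_const) * (\<integral>\<^sup>+z. ennreal (1 / norm (y - z)) \<partial>M j) \<partial>M j)"
      by (simp add: nn_integral_cmult)
    also have "\<dots> \<le> (\<integral>\<^sup>+y. (?r * ?r * beta_half * ennreal newton_const) * 1 \<partial>M j)"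
      by (intro nn_integral_mono mult_left_mono pot1) auto
    also have "\<dots> = (?r * ?r * beta_half * ennreal newton_const) * emeasure (M j) UNIV" by simp
    also have "\<dots> \<le> (?r * ?r * beta_half * ennreal newton_const) * ennreal R"
      by (intro mult_left_mono M_le) auto
    also have "\<dots> = ennreal (cap_const * R)"
    proof -
      have "beta_half = ennreal (enn2real beta_half)" using beta_half_finite by simp
      then have "?r * ?r * beta_half * ennreal newton_const * ennreal R =
          ennreal riesz_const * ennreal riesz_const * ennreal (enn2real beta_half) * ennreal newton_const * ennreal R" by simp
      also have "\<dots> = ennreal (cap_const * R)"
        using riesz_const_pos newton_const_pos R by (simp add: cap_const_def power2_eq_square flip: ennreal_mult)
      finally show ?thesis .
    qed
    finally show ?thesis .
  qed
  have "newtonian_capacity K = (\<integral>\<^sup>+ x \<in> - K. ennreal ((norm (g x))\<^sup>2) \<partial>lborel)"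
    by (rule newtonian_capacity_eq[OF u Kcl]) (use g in auto)
  also have "\<dots> \<le> (\<integral>\<^sup>+x. liminf (\<lambda>j. (I j x)\<^sup>2) \<partial>lborel)"
    by (intro nn_integral_mono) (use le in \<open>auto simp: indicator_def\<close>)
  also have "\<dots> \<le> liminf (\<lambda>j. \<integral>\<^sup>+x. (I j x)\<^sup>2 \<partial>lborel)"
    by (rule nn_integral_liminf) measurable
  also have "\<dots> \<le> liminf (\<lambda>j. ennreal (cap_const * R))"
    by (intro Liminf_mono always_eventually allI Isq)
  also have "\<dots> = ennreal (cap_const * R)" by (simp add: Liminf_const)
  finally show ?thesis .
qed

section \<open>A lower bound for the capacity of a needle\<close>

lemma vector_3_eq: "vector [a, b, c] = a *\<^sub>R axis 1 1 + b *\<^sub>R axis 2 1 + c *\<^sub>R (axis 3 1 :: real ^ 3)"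
  by (simp add: vec_eq_iff forall_3 vector_3 axis_def)

lemma measurable_vector_3 [measurable (raw)]:
  assumes [measurable]: "f \<in> borel_measurable M" "g \<in> borel_measurable M" "h \<in> borel_measurable M"
  shows "(\<lambda>x. vector [f x, g x, h x] :: real ^ 3) \<in> borel_measurable M"
  unfolding vector_3_eq by measurable

lemma borel_measurable_vector_3_prod:
  "(\<lambda>p. vector [fst p, fst (snd p), snd (snd p)] :: real ^ 3) \<in> borel_measurable borel"
  unfolding vector_3_eq by (intro borel_measurable_continuous_onI continuous_intros)

lemma emeasure_lborel_Times:
  fixes A :: "'a::euclidean_space set" and B :: "'b::euclidean_space set"
  assumes "A \<in> sets borel" "B \<in> sets borel"
  shows "emeasure lborel (A \<times> B) = emeasure lborel A * emeasure lborel B"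
  unfolding lborel_prod[symmetric] using assms by (intro lborel.emeasure_pair_measure_Times) auto

lemma lborel_vec3: "(lborel :: (real ^ 3) measure) = distr lborel borel (\<lambda>p. vector [fst p, fst (snd p), snd (snd p)])"
proof (rule lborel_eqI)
  let ?T = "\<lambda>p. vector [fst p, fst (snd p), snd (snd p)] :: real ^ 3"
  note [measurable] = borel_measurable_vector_3_prod
  fix l u :: "real ^ 3" assume le: "\<And>b. b \<in> Basis \<Longrightarrow> l \<bullet> b \<le> u \<bullet> b"
  have lu: "l $ i \<le> u $ i" for i
    using le[of "axis i 1"] by (simp add: axis_in_Basis_iff inner_axis)
  have "emeasure (distr lborel borel ?T) (box l u) = emeasure lborel (?T -` box l u)"
    by (subst emeasure_distr) auto
  also have "?T -` box l u = {l $ 1<..<u $ 1} \<times> ({l $ 2<..<u $ 2} \<times> {l $ 3<..<u $ 3})"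
    by (auto simp: mem_box_cart forall_3 vector_3)
  also have "emeasure lborel \<dots> = ennreal (u $ 1 - l $ 1) * (ennreal (u $ 2 - l $ 2) * ennreal (u $ 3 - l $ 3))"
    using lu
    by (simp add: emeasure_lborel_Times borel_Times)
  also have "\<dots> = ennreal (\<Prod>b\<in>Basis. (u - l) \<bullet> b)"
  proof -
    have "(\<Prod>b\<in>Basis. (u - l) \<bullet> b) = (\<Prod>i\<in>UNIV. u $ i - l $ i)"
      by (simp add: Basis_vec_def inner_axis UNION_singleton_eq_range prod.reindex inj_on_def axis_eq_axis)
    also have "\<dots> = (u $ 1 - l $ 1) * ((u $ 2 - l $ 2) * (u $ 3 - l $ 3))"
      unfolding UNIV_3 by (simp add: ac_simps)
    finally show ?thesis using lu by (simp add: ennreal_mult)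
  qed
  finally show "emeasure (distr lborel borel ?T) (box l u) = (\<Prod>b\<in>Basis. (u - l) \<bullet> b)" .
qed simp

text \<open>The order is adapted to the family of lines below: the second coordinate is the
  parameter t along a line and stands outermost, and for fixed t the other two coordinates are
  rescaled separately.\<close>

lemma nn_integral_vec3:
  assumes [measurable]: "f \<in> borel_measurable borel"
  shows "(\<integral>\<^sup>+v. f v \<partial>lborel) =
    (\<integral>\<^sup>+y. \<integral>\<^sup>+z. \<integral>\<^sup>+x. f (vector [x, y, z] :: real ^ 3) \<partial>lborel \<partial>lborel \<partial>lborel)"
proof -
  have m1: "(\<lambda>p. f (vector [fst p, fst (snd p), snd (snd p)])) \<in> borel_measurable (lborel \<Otimes>\<^sub>M (lborel :: (real \<times> real) measure))"
    using measurable_compose[OF borel_measurable_vector_3_prod assms] by (simp add: lborel_prod)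
  have m2: "(\<lambda>q. f (vector [x, fst q, snd q])) \<in> borel_measurable (lborel \<Otimes>\<^sub>M lborel)" for x
    by measurable
  have "(\<integral>\<^sup>+v. f v \<partial>lborel) = (\<integral>\<^sup>+p. f (vector [fst p, fst (snd p), snd (snd p)]) \<partial>lborel)"
    using borel_measurable_vector_3_prod by (subst lborel_vec3) (simp add: nn_integral_distr)
  also have "\<dots> = (\<integral>\<^sup>+p. f (vector [fst p, fst (snd p), snd (snd p)]) \<partial>(lborel \<Otimes>\<^sub>M (lborel :: (real \<times> real) measure)))"
    by (simp add: lborel_prod)
  also have "\<dots> = (\<integral>\<^sup>+x. \<integral>\<^sup>+q. f (vector [x, fst q, snd q]) \<partial>lborel \<partial>lborel)"
    using lborel.nn_integral_fst[OF m1] by simp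
  also have "\<dots> = (\<integral>\<^sup>+x. \<integral>\<^sup>+q. f (vector [x, fst q, snd q]) \<partial>(lborel \<Otimes>\<^sub>M lborel) \<partial>lborel)"
    by (simp add: lborel_prod)
  also have "\<dots> = (\<integral>\<^sup>+x. \<integral>\<^sup>+y. \<integral>\<^sup>+z. f (vector [x, y, z]) \<partial>lborel \<partial>lborel \<partial>lborel)"
    using lborel.nn_integral_fst[OF m2] by simp
  also have "\<dots> = (\<integral>\<^sup>+y. \<integral>\<^sup>+x. \<integral>\<^sup>+z. f (vector [x, y, z]) \<partial>lborel \<partial>lborel \<partial>lborel)"
    by (rule lborel_pair.Fubini') measurable
  also have "\<dots> = (\<integral>\<^sup>+y. \<integral>\<^sup>+z. \<integral>\<^sup>+x. f (vector [x, y, z]) \<partial>lborel \<partial>lborel \<partial>lborel)"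
    by (rule nn_integral_cong, rule lborel_pair.Fubini') measurable
  finally show ?thesis .
qed

abbreviation centered_box :: "real ^ 3 \<Rightarrow> (real ^ 3) set" where
  "centered_box h \<equiv> cbox (- h) h"

text \<open>Along a curve from the conductor to infinity the energy density, weighted with the Jacobian \<open>J\<close> of a
  family of such curves, is bounded below by Young's inequality.\<close>

lemma needle_line_energy:
  fixes s \<alpha> L e :: real
  assumes e: "0 < e" "e \<le> L" and s: "\<bar>s\<bar> \<le> L / 2" and \<alpha>: "\<bar>\<alpha>\<bar> \<le> 1"
    and u: "is_electrostatic_potential (centered_box (vector [L, e, e])) u"
    and g: "\<And>x. x \<notin> centered_box (vector [L, e, e]) \<Longrightarrow> GDERIV u x :> g x"
    and gc: "continuous_on (- centered_box (vector [L, e, e])) g"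
  shows "ennreal (1 / (12 * ln (1 + L / e))) \<le>
    (\<integral>\<^sup>+t\<in>{e<..}. ennreal (t * (1 + t / L) * (norm (g (vector [s * (1 + t / L), t, t * \<alpha>])))\<^sup>2) \<partial>lborel)"
proof -
  let ?h = "vector [L, e, e] :: real ^ 3"
  let ?K = "centered_box ?h"
  \<comment> \<open>A straight line with direction \<open>w\<close>. It reaches the face with second
    coordinate e at t = e; there |s| \<le> L / 2 leaves room for the dilation by 1 + e / L \<le> 2.
    The map from (s, t, \<alpha>) to space has the Jacobian t (1 + t / L), the \<open>J\<close>
    below.\<close>
  define \<gamma> where "\<gamma> t = (vector [s * (1 + t / L), t, t * \<alpha>] :: real ^ 3)" for t
  define w where "w = (vector [s / L, 1, \<alpha>] :: real ^ 3)"
  have \<gamma>_eq: "\<gamma> t = vector [s, 0, 0] + t *\<^sub>R w" for t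
    using e by (simp add: \<gamma>_def w_def vec_eq_iff forall_3 vector_3 algebra_simps)
  have L: "L > 0" using e by simp
  have cw: "norm w \<le> sqrt 3"
  proof -
    have "(s / L)\<^sup>2 \<le> 1\<^sup>2" using s L by (intro power2_le_iff_abs_le[THEN iffD2]) (auto simp: abs_le_iff field_simps)
    moreover have "\<alpha>\<^sup>2 \<le> 1" using \<alpha> by (simp add: abs_square_le_1)
    ultimately have "(norm w)\<^sup>2 \<le> 3"
      unfolding power2_norm_eq_inner by (simp add: inner_vec_def sum_3 w_def vector_3 power2_eq_square)
    then show ?thesis by (rule real_le_rsqrt)
  qed
  have out: "\<gamma> t \<notin> ?K" if "t > e" for t
    using that e by (auto simp: \<gamma>_def mem_box_cart forall_3 vector_3)
  have outi: "\<gamma> t \<in> - interior ?K" if "t \<ge> e" for t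
    using that e by (auto simp: \<gamma>_def interior_cbox mem_box_cart forall_3 vector_3)
  define F where "F t = u (\<gamma> t)" for t
  have dF: "(F has_real_derivative g (\<gamma> t) \<bullet> w) (at t)" if t: "t > e" for t
  proof -
    have 1: "(\<gamma> has_derivative (\<lambda>k. k *\<^sub>R w)) (at t)"
      unfolding \<gamma>_eq by (auto intro!: derivative_eq_intros)
    have 2: "(u has_derivative (\<lambda>v. v \<bullet> g (\<gamma> t))) (at (\<gamma> t))" using g[OF out[OF t]] by (simp add: gderiv_def)
    have "(F has_derivative (\<lambda>k. (k *\<^sub>R w) \<bullet> g (\<gamma> t))) (at t)"
      unfolding F_def by (rule has_derivative_compose[OF 1 2])
    then show ?thesis unfolding has_field_derivative_def
      by (rule has_derivative_eq_rhs) (auto simp: fun_eq_iff inner_commute)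
  qed
  have contF: "continuous_on {e..} F"
    unfolding F_def
  proof (rule continuous_on_compose2[where t = "- interior ?K"])
    show "continuous_on (- interior ?K) u" using u by (simp add: is_electrostatic_potential_def)
    show "continuous_on {e..} \<gamma>" unfolding \<gamma>_eq by (intro continuous_intros)
  qed (use outi in auto)
  have "\<gamma> e \<in> frontier ?K"
  proof -
    have "\<bar>s\<bar> * (1 + e / L) \<le> (L / 2) * 2" using s e by (intro mult_mono) (auto simp: field_simps)
    then have "\<bar>s * (1 + e / L)\<bar> \<le> L" using e by (simp add: abs_mult)
    moreover have "\<bar>e * \<alpha>\<bar> \<le> e" using e \<alpha> by (simp add: abs_mult mult_left_le)
    ultimately have "\<gamma> e \<in> ?K" using e by (auto simp: \<gamma>_def mem_box_cart forall_3 vector_3 abs_le_iff)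
    then show ?thesis using outi[of e] by (simp add: frontier_def)
  qed
  then have Fe: "F e = 1" using u by (simp add: F_def is_electrostatic_potential_def)
  \<comment> \<open>The potential is differentiable only off the box, so the estimate starts at some
    a > e and ends at a finite T, retaining a potential drop of at least 1/2.\<close>
  obtain a where a: "a > e" "F a \<ge> 3/4"
  proof -
    have "\<exists>d>0. \<forall>x\<in>{e..}. dist x e < d \<longrightarrow> dist (F x) (F e) < 1/4"
      by (rule contF[unfolded continuous_on_iff, rule_format]) auto
    then obtain d where d: "d > 0" "\<And>x. x \<ge> e \<Longrightarrow> dist x e < d \<Longrightarrow> dist (F x) (F e) < 1/4" by auto
    have "dist (F (e + d / 2)) (F e) < 1/4" using d(1) by (intro d(2)) (auto simp: dist_real_def)
    then show ?thesis using that[of "e + d / 2"] d(1) Fe by (simp add: dist_real_def abs_if split: if_splits)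
  qed
  obtain T where T: "T > a" "F T \<le> 1/4"
  proof -
    have "filterlim (\<lambda>t. norm (\<gamma> t)) at_top at_top"
    proof (rule filterlim_at_top_mono[OF filterlim_ident always_eventually], rule allI)
      fix t :: real
      have "\<bar>\<gamma> t $ 2\<bar> \<le> norm (\<gamma> t)" by (rule component_le_norm_cart)
      then show "t \<le> norm (\<gamma> t)" by (simp add: \<gamma>_def vector_3)
    qed
    then have "filterlim \<gamma> at_infinity at_top" using filterlim_at_infinity_conv_norm_at_top by blast
    then have "(F \<longlongrightarrow> 0) at_top"
      unfolding F_def using u filterlim_compose is_electrostatic_potential_def by blast
    then have "\<forall>\<^sub>F t in at_top. F t < 1/4" by (rule order_tendstoD) simp
    then have "\<forall>\<^sub>F t in at_top. F t < 1/4 \<and> t > a" using eventually_gt_at_top by (rule eventually_conj)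
    then obtain T where "F T < 1/4" "T > a" by (auto simp: eventually_at_top_linorder)
    then show ?thesis using that[of T] by simp
  qed
  define \<Lambda> where "\<Lambda> = ln (1 + L / e)"
  have \<Lambda>: "\<Lambda> > 0" unfolding \<Lambda>_def by (rule ln_gt_zero) (use e L in simp)
  \<comment> \<open>The parameter of Young's inequality. The bound obtained below is \<mu> - 3
    \<mu>^2 \<Lambda>, which is largest, with value 1 / (12 \<Lambda>), at this \<mu>.\<close>
  define \<mu> where "\<mu> = 1 / (6 * \<Lambda>)"
  have \<mu>: "\<mu> > 0" using \<Lambda> by (simp add: \<mu>_def)
  define J where "J t = t * (1 + t / L)" for t
  have J: "J t > 0" if "t > 0" for t using that L by (simp add: J_def add_pos_pos)
  define q where "q t = J t * (norm (g (\<gamma> t)))\<^sup>2" for t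
  \<comment> \<open>An antiderivative of the lower bound that Young's inequality gives for
    \<open>q\<close>: ln t - ln (L + t) is an antiderivative of 1 / J, and the 3 bounds the squared
    norm of the direction \<open>w\<close>.\<close>
  define W where "W t = - 2 * \<mu> * F t - 3 * \<mu>\<^sup>2 * (ln t - ln (L + t))" for t
  define W' where "W' t = - 2 * \<mu> * (g (\<gamma> t) \<bullet> w) - 3 * \<mu>\<^sup>2 * (1 / t - 1 / (L + t))" for t
  have dW: "(W has_real_derivative W' t) (at t)" if "t > e" for t
    unfolding W_def W'_def by (rule derivative_eq_intros dF refl | use that e L in simp)+
  have W'q: "W' t \<le> q t" if t: "t > e" for t
  proof -
    have t0: "t > 0" using t e by simp
    define n where "n = norm (g (\<gamma> t))"
    have 1: "1 / t - 1 / (L + t) = 1 / J t" using t0 L by (simp add: J_def field_simps)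
    have "\<bar>g (\<gamma> t) \<bullet> w\<bar> \<le> n * norm w" unfolding n_def by (rule Cauchy_Schwarz_ineq2)
    also have "\<dots> \<le> n * sqrt 3" using cw by (intro mult_left_mono) (auto simp: n_def)
    finally have 2: "- (g (\<gamma> t) \<bullet> w) \<le> n * sqrt 3" by linarith
    have "0 \<le> (J t * n - \<mu> * sqrt 3)\<^sup>2 / J t" using J[OF t0] by simp
    also have "\<dots> = J t * n\<^sup>2 - 2 * \<mu> * (n * sqrt 3) + 3 * \<mu>\<^sup>2 * (1 / J t)"
    proof -
      have "(J t * n - \<mu> * sqrt 3)\<^sup>2 = (J t)\<^sup>2 * n\<^sup>2 - 2 * (J t * n) * (\<mu> * sqrt 3) + \<mu>\<^sup>2 * 3"
        by (simp add: power2_diff power_mult_distrib)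
      also have "\<dots> = J t * (J t * n\<^sup>2 - 2 * \<mu> * (n * sqrt 3) + 3 * \<mu>\<^sup>2 * (1 / J t))"
        using J[OF t0] by (simp add: distrib_left right_diff_distrib power2_eq_square[of "J t"])
      finally show ?thesis using J[OF t0] by simp
    qed
    finally have "2 * \<mu> * (n * sqrt 3) - 3 * \<mu>\<^sup>2 * (1 / J t) \<le> q t" by (simp add: q_def n_def)
    moreover have "2 * \<mu> * - (g (\<gamma> t) \<bullet> w) \<le> 2 * \<mu> * (n * sqrt 3)" using 2 \<mu> by (intro mult_left_mono) auto
    ultimately show ?thesis unfolding W'_def 1 by simp
  qed
  have qc: "continuous_on {a..T} q"
  proof -
    have "continuous_on {a..T} (\<lambda>t. g (\<gamma> t))"
      by (rule continuous_on_compose2[OF gc]) (use out a in \<open>auto simp: \<gamma>_eq intro!: continuous_intros\<close>)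
    then show ?thesis unfolding q_def J_def using L by (intro continuous_intros) auto
  qed
  then have qi: "(q has_integral integral {a..T} q) {a..T}"
    by (intro integrable_integral integrable_continuous_real)
  have Wi: "(W' has_integral (W T - W a)) {a..T}"
    using T a dW by (intro fundamental_theorem_of_calculus)
      (auto simp: has_real_derivative_iff_has_vector_derivative[symmetric] intro!: DERIV_subset[OF dW])
  have "1 / (12 * \<Lambda>) \<le> W T - W a"
  proof -
    have pos: "a > 0" "T > 0" using a T e by auto
    have "ln T - ln (L + T) \<le> 0" using pos L by simp
    moreover have "- \<Lambda> \<le> ln a - ln (L + a)"
    proof -
      have "e / (L + e) \<le> a / (L + a)" using a e L by (simp add: field_simps)
      then have "ln (e / (L + e)) \<le> ln (a / (L + a))" using e L pos by (subst ln_le_cancel_iff) auto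
      moreover have "ln (e / (L + e)) = - \<Lambda>"
        using e L unfolding \<Lambda>_def by (simp add: ln_inverse[symmetric] field_simps)
      ultimately show ?thesis using pos L by (simp add: ln_div)
    qed
    ultimately have "(ln T - ln (L + T)) - (ln a - ln (L + a)) \<le> \<Lambda>" by linarith
    then have 1: "3 * \<mu>\<^sup>2 * ((ln T - ln (L + T)) - (ln a - ln (L + a))) \<le> 3 * \<mu>\<^sup>2 * \<Lambda>"
      by (intro mult_left_mono) auto
    have 2: "2 * \<mu> * (1/2) \<le> 2 * \<mu> * (F a - F T)" using a T \<mu> by (intro mult_left_mono) auto
    have "W T - W a = 2 * \<mu> * (F a - F T) - 3 * \<mu>\<^sup>2 * ((ln T - ln (L + T)) - (ln a - ln (L + a)))"
      by (simp add: W_def algebra_simps)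
    also have "\<dots> \<ge> 2 * \<mu> * (1/2) - 3 * \<mu>\<^sup>2 * \<Lambda>" using 1 2 by linarith
    also have "2 * \<mu> * (1/2) - 3 * \<mu>\<^sup>2 * \<Lambda> = 1 / (12 * \<Lambda>)"
      using \<Lambda> by (simp add: \<mu>_def power2_eq_square field_simps)
    finally show ?thesis .
  qed
  also have "\<dots> \<le> integral {a..T} q"
    by (rule has_integral_le[OF Wi qi]) (use W'q a in auto)
  finally have "ennreal (1 / (12 * \<Lambda>)) \<le> ennreal (integral {a..T} q)" by (rule ennreal_leI)
  also have "\<dots> = (\<integral>\<^sup>+t. ennreal (q t) * indicator {a..T} t \<partial>lborel)"
  proof (rule nn_integral_has_integral_lebesgue'[symmetric, OF _ qi])
    show "0 \<le> q t" if "t \<in> {a..T}" for t using J[of t] that a e by (simp add: q_def)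
  qed
  also have "\<dots> \<le> (\<integral>\<^sup>+t\<in>{e<..}. ennreal (q t) \<partial>lborel)"
    using a by (intro nn_integral_mono) (auto simp: indicator_def)
  finally show ?thesis by (simp add: \<Lambda>_def q_def J_def \<gamma>_def)
qed

text \<open>The line estimate is integrated over s in an interval of length L and \<alpha> in one of
  length 2, which turns 1 / (12 ln (1 + L / e)) into the stated bound. For fixed t the Jacobian
  splits into the two one-dimensional substitutions x = s (1 + t / L) and z = t \<alpha>.\<close>

lemma newtonian_capacity_needle_ge:
  assumes e: "0 < e" "e \<le> L"
    and u: "is_electrostatic_potential (centered_box (vector [L, e, e])) u"
    and g: "\<And>x. x \<notin> centered_box (vector [L, e, e]) \<Longrightarrow> GDERIV u x :> g x"
    and gc: "continuous_on (- centered_box (vector [L, e, e])) g"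
  shows "ennreal (L / (6 * ln (1 + L / e))) \<le> newtonian_capacity (centered_box (vector [L, e, e]))"
proof -
  let ?K = "centered_box (vector [L, e, e] :: real ^ 3)"
  have L: "L > 0" using e by simp
  define c where "c = 1 / (12 * ln (1 + L / e))"
  have "ln (1 + L / e) > 0" by (rule ln_gt_zero) (use e L in simp)
  then have c: "c > 0" by (simp add: c_def)
  \<comment> \<open>The energy density, extended by 0 into the box: g is controlled only outside,
    and the extension is Borel measurable on the whole space.\<close>
  define f where "f x = ennreal ((norm (indicator (- ?K) x *\<^sub>R g x))\<^sup>2)" for x
  have "(\<lambda>x. indicator (- ?K) x *\<^sub>R g x) \<in> borel_measurable borel"
    using gc by (intro borel_measurable_continuous_on_indicator) auto
  then have fm [measurable]: "f \<in> borel_measurable borel" unfolding f_def by measurable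
  define q where "q s \<alpha> t = ennreal (t * (1 + t / L)) * f (vector [s * (1 + t / L), t, t * \<alpha>])" for s \<alpha> t
  let ?I1 = "indicator {- 1..1} :: real \<Rightarrow> ennreal"
  let ?I2 = "indicator {- (L / 2)..L / 2} :: real \<Rightarrow> ennreal"
  let ?It = "indicator {e<..} :: real \<Rightarrow> ennreal"
  have "ennreal (L / (6 * ln (1 + L / e))) = ennreal c * ennreal L * ennreal 2"
  proof -
    have "L / (6 * ln (1 + L / e)) = c * L * 2" by (simp add: c_def)
    then show ?thesis
      using c L by (simp only: ennreal_mult mult_nonneg_nonneg less_imp_le zero_le_numeral)
  qed
  also have "\<dots> = (\<integral>\<^sup>+\<alpha>. \<integral>\<^sup>+s. ennreal c * ?I2 s * ?I1 \<alpha> \<partial>lborel \<partial>lborel)"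
    using L by (simp add: nn_integral_cmult nn_integral_multc)
  also have "\<dots> \<le> (\<integral>\<^sup>+\<alpha>. \<integral>\<^sup>+s. (\<integral>\<^sup>+t. q s \<alpha> t * ?It t \<partial>lborel) * ?I2 s * ?I1 \<alpha> \<partial>lborel \<partial>lborel)"
  proof (intro nn_integral_mono)
    fix \<alpha> s :: real
    have "ennreal c \<le> (\<integral>\<^sup>+t. q s \<alpha> t * ?It t \<partial>lborel)" if "s \<in> {- (L / 2)..L / 2}" "\<alpha> \<in> {- 1..1}"
    proof -
      have "ennreal c \<le> (\<integral>\<^sup>+t\<in>{e<..}. ennreal (t * (1 + t / L) * (norm (g (vector [s * (1 + t / L), t, t * \<alpha>])))\<^sup>2) \<partial>lborel)"
        unfolding c_def using that by (intro needle_line_energy[OF e _ _ u g gc]) auto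
      also have "\<dots> = (\<integral>\<^sup>+t. q s \<alpha> t * ?It t \<partial>lborel)"
      proof (rule nn_integral_cong)
        fix t :: real
        have "vector [s * (1 + t / L), t, t * \<alpha>] \<in> - ?K" if "t > e"
          using that e by (auto simp: mem_box_cart forall_3 vector_3)
        then show "ennreal (t * (1 + t / L) * (norm (g (vector [s * (1 + t / L), t, t * \<alpha>])))\<^sup>2) * ?It t = q s \<alpha> t * ?It t"
          using e L by (cases "t > e") (simp_all add: q_def f_def flip: ennreal_mult)
      qed
      finally show ?thesis .
    qed
    then show "ennreal c * ?I2 s * ?I1 \<alpha> \<le> (\<integral>\<^sup>+t. q s \<alpha> t * ?It t \<partial>lborel) * ?I2 s * ?I1 \<alpha>"
      by (auto simp: indicator_def)
  qed
  also have "\<dots> \<le> (\<integral>\<^sup>+\<alpha>. \<integral>\<^sup>+s. \<integral>\<^sup>+t. q s \<alpha> t * ?It t \<partial>lborel \<partial>lborel \<partial>lborel)"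
    by (intro nn_integral_mono) (auto simp: indicator_def)
  also have "\<dots> = (\<integral>\<^sup>+\<alpha>. \<integral>\<^sup>+t. \<integral>\<^sup>+s. q s \<alpha> t * ?It t \<partial>lborel \<partial>lborel \<partial>lborel)"
    unfolding q_def by (rule nn_integral_cong, rule lborel_pair.Fubini') measurable
  also have "\<dots> = (\<integral>\<^sup>+t. \<integral>\<^sup>+\<alpha>. \<integral>\<^sup>+s. q s \<alpha> t * ?It t \<partial>lborel \<partial>lborel \<partial>lborel)"
    unfolding q_def by (rule lborel_pair.Fubini') measurable
  also have "\<dots> \<le> (\<integral>\<^sup>+t. \<integral>\<^sup>+z. \<integral>\<^sup>+x. f (vector [x, t, z]) \<partial>lborel \<partial>lborel \<partial>lborel)"
  proof (rule nn_integral_mono)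
    fix t :: real
    show "(\<integral>\<^sup>+\<alpha>. \<integral>\<^sup>+s. q s \<alpha> t * ?It t \<partial>lborel \<partial>lborel) \<le> (\<integral>\<^sup>+z. \<integral>\<^sup>+x. f (vector [x, t, z]) \<partial>lborel \<partial>lborel)"
    proof (cases "t > e")
      case True
      define b where "b = 1 + t / L"
      have t: "t > 0" and b: "b > 0" using True e L by (auto simp: b_def add_pos_pos)
      have "(\<integral>\<^sup>+z. \<integral>\<^sup>+x. f (vector [x, t, z]) \<partial>lborel \<partial>lborel) =
          ennreal \<bar>t\<bar> * (\<integral>\<^sup>+\<alpha>. \<integral>\<^sup>+x. f (vector [x, t, 0 + t * \<alpha>]) \<partial>lborel \<partial>lborel)"
        using t by (intro nn_integral_real_affine) auto
      also have "\<dots> = ennreal \<bar>t\<bar> * (\<integral>\<^sup>+\<alpha>. ennreal \<bar>b\<bar> * (\<integral>\<^sup>+s. f (vector [0 + b * s, t, 0 + t * \<alpha>]) \<partial>lborel) \<partial>lborel)"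
        using b by (subst nn_integral_real_affine[where c = b and t = 0]) auto
      also have "\<dots> = (\<integral>\<^sup>+\<alpha>. \<integral>\<^sup>+s. ennreal (t * b) * f (vector [s * b, t, t * \<alpha>]) \<partial>lborel \<partial>lborel)"
        using t b by (simp add: nn_integral_cmult ennreal_mult mult.assoc mult.commute[of b])
      finally show ?thesis using True by (simp add: q_def b_def)
    qed simp
  qed
  also have "\<dots> = (\<integral>\<^sup>+v. f v \<partial>lborel)" by (rule nn_integral_vec3[symmetric]) simp
  also have "\<dots> = (\<integral>\<^sup>+ x \<in> - ?K. ennreal ((norm (g x))\<^sup>2) \<partial>lborel)"
    by (intro nn_integral_cong) (auto simp: f_def indicator_def)
  also have "\<dots> = newtonian_capacity ?K"
    by (rule newtonian_capacity_eq[OF u _ g, symmetric]) (auto simp: closed_cbox)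
  finally show ?thesis .
qed

section \<open>Hausdorff measure\<close>

lemma ennreal_less_add: "x < top \<Longrightarrow> 0 < e \<Longrightarrow> x < x + ennreal e"
  by (cases x) (auto simp: ennreal_less_iff simp flip: ennreal_plus)

lemma le_INF_add_INF:
  fixes c :: ennreal
  assumes "\<And>i j. i \<in> I \<Longrightarrow> j \<in> J \<Longrightarrow> c \<le> f i + g j"
  shows "c \<le> (INF i\<in>I. f i) + (INF j\<in>J. g j)"
proof (rule ennreal_le_epsilon)
  fix e :: real assume fin: "(INF i\<in>I. f i) + (INF j\<in>J. g j) < top" and e: "e > 0"
  have "(INF i\<in>I. f i) < (INF i\<in>I. f i) + ennreal (e / 2)"
    using fin e by (intro ennreal_less_add) (auto simp: less_top)
  then obtain i where i: "i \<in> I" "f i < (INF i\<in>I. f i) + ennreal (e / 2)"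
    by (auto simp: INF_less_iff)
  have "(INF j\<in>J. g j) < (INF j\<in>J. g j) + ennreal (e / 2)"
    using fin e by (intro ennreal_less_add) (auto simp: less_top)
  then obtain j where j: "j \<in> J" "g j < (INF j\<in>J. g j) + ennreal (e / 2)"
    by (auto simp: INF_less_iff)
  have "c \<le> f i + g j" using i j by (intro assms)
  also have "\<dots> \<le> ((INF i\<in>I. f i) + ennreal (e / 2)) + ((INF j\<in>J. g j) + ennreal (e / 2))"
    using i j by (intro add_mono) auto
  also have "\<dots> = (INF i\<in>I. f i) + (INF j\<in>J. g j) + (ennreal (e / 2) + ennreal (e / 2))" by (simp add: ac_simps)
  also have "ennreal (e / 2) + ennreal (e / 2) = ennreal e" using e by (simp flip: ennreal_plus)
  finally show "c \<le> (INF i\<in>I. f i) + (INF j\<in>J. g j) + ennreal e" .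
qed

text \<open>Homotheties with ratio \<theta> scale the d-dimensional measure by \<theta>^d; the lemma
  lets \<theta> tend to 1. Infinite X is treated separately because multiplication by infinity is
  not continuous.\<close>

lemma ennreal_le_of_contractions:
  fixes X Y :: ennreal
  assumes "\<And>\<theta>. 0 < \<theta> \<Longrightarrow> \<theta> < 1 \<Longrightarrow> ennreal (\<theta> ^ d) * X \<le> Y"
  shows "X \<le> Y"
proof (cases "X = top")
  case True
  then show ?thesis using assms[of "1/2"] by (auto simp: ennreal_mult_top top_unique)
next
  case False
  define \<theta> where "\<theta> n = 1 - inverse (real (Suc (Suc n)))" for n
  have \<theta>: "0 < \<theta> n" "\<theta> n < 1" for n unfolding \<theta>_def by (auto simp: field_simps)
  have "\<theta> \<longlonglongrightarrow> 1 - 0" unfolding \<theta>_def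
    by (intro tendsto_diff tendsto_const filterlim_compose[OF LIMSEQ_inverse_real_of_nat filterlim_Suc])
  then have "(\<lambda>n. \<theta> n ^ d) \<longlonglongrightarrow> 1 ^ d" by (intro tendsto_power) simp
  then have "(\<lambda>n. X * ennreal (\<theta> n ^ d)) \<longlonglongrightarrow> X * ennreal (1 ^ d)"
    using False by (intro ennreal_tendsto_cmult tendsto_ennrealI) (auto simp: less_top)
  moreover have "X * ennreal (\<theta> n ^ d) \<le> Y" for n using assms[OF \<theta>] by (simp add: mult.commute)
  ultimately show ?thesis by (intro LIMSEQ_le_const2[of _ X]) auto
qed

definition hausdorff_weight :: "nat \<Rightarrow> 'a::metric_space set \<Rightarrow> ennreal" where
  "hausdorff_weight d C = (if C = {} then 0 else ennreal (unit_ball_vol (real d) * (diameter C / 2) ^ d))"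

lemma hausdorff_content_eq:
  "hausdorff_content d \<delta> S =
     (INF C \<in> {C. S \<subseteq> (\<Union>i. C i) \<and> (\<forall>i. bounded (C i) \<and> diameter (C i) \<le> \<delta>)}. \<Sum>i. hausdorff_weight d (C i))"
  unfolding hausdorff_content_def hausdorff_weight_def ..

lemma hausdorff_content_le:
  assumes "S \<subseteq> (\<Union>i. C i)" "\<And>i. bounded (C i)" "\<And>i. diameter (C i) \<le> \<delta>"
  shows "hausdorff_content d \<delta> S \<le> (\<Sum>i. hausdorff_weight d (C i))"
  unfolding hausdorff_content_eq using assms by (intro INF_lower) auto

lemma hausdorff_content_antimono: "\<delta> \<le> \<delta>' \<Longrightarrow> hausdorff_content d \<delta>' S \<le> hausdorff_content d \<delta> S"
  unfolding hausdorff_content_eq by (intro INF_superset_mono) (auto intro: order_trans)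

lemma hausdorff_content_mono: "S \<subseteq> T \<Longrightarrow> hausdorff_content d \<delta> S \<le> hausdorff_content d \<delta> T"
  unfolding hausdorff_content_eq by (intro INF_superset_mono) auto

lemma hausdorff_content_le_measure: "\<delta> > 0 \<Longrightarrow> hausdorff_content d \<delta> S \<le> hausdorff_measure d S"
  unfolding hausdorff_measure_def by (intro SUP_upper) auto

lemma hausdorff_measure_mono: "S \<subseteq> T \<Longrightarrow> hausdorff_measure d S \<le> hausdorff_measure d T"
  unfolding hausdorff_measure_def by (intro SUP_mono) (auto intro: hausdorff_content_mono)

lemma hausdorff_weight_mono: "B \<subseteq> C \<Longrightarrow> bounded C \<Longrightarrow> hausdorff_weight d B \<le> hausdorff_weight d C"
  unfolding hausdorff_weight_def
  by (auto intro!: ennreal_leI mult_left_mono power_mono divide_right_mono diameter_subset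
      simp: diameter_ge_0 bounded_subset)

lemma hausdorff_measure_empty [simp]: "hausdorff_measure d {} = 0"
proof -
  have "hausdorff_content d \<delta> ({} :: 'a set) \<le> (\<Sum>i. hausdorff_weight d ((\<lambda>_. {} :: 'a set) i))" if "\<delta> > 0" for \<delta>
    using that by (intro hausdorff_content_le) auto
  then have "hausdorff_content d \<delta> ({} :: 'a set) = 0" if "\<delta> > 0" for \<delta>
    using that by (simp add: hausdorff_weight_def)
  then show ?thesis unfolding hausdorff_measure_def by simp
qed

lemma hausdorff_measure_Un: "hausdorff_measure d (S \<union> T) \<le> hausdorff_measure d S + hausdorff_measure d T"
  unfolding hausdorff_measure_def[of d "S \<union> T"]
proof (rule SUP_least)
  fix \<delta> :: real assume \<delta>: "\<delta> \<in> {0<..}"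
  have "hausdorff_content d \<delta> (S \<union> T) \<le> hausdorff_content d \<delta> S + hausdorff_content d \<delta> T"
    unfolding hausdorff_content_eq[of d \<delta> S] hausdorff_content_eq[of d \<delta> T]
  proof (rule le_INF_add_INF)
    fix A B :: "nat \<Rightarrow> 'a set"
    assume A: "A \<in> {C. S \<subseteq> (\<Union>i. C i) \<and> (\<forall>i. bounded (C i) \<and> diameter (C i) \<le> \<delta>)}"
      and B: "B \<in> {C. T \<subseteq> (\<Union>i. C i) \<and> (\<forall>i. bounded (C i) \<and> diameter (C i) \<le> \<delta>)}"
    define C where "C i = (if even i then A (i div 2) else B (i div 2))" for i
    have "A i \<subseteq> (\<Union>i. C i)" for i by (rule SUP_upper2[of "2 * i"]) (auto simp: C_def)
    moreover have "B i \<subseteq> (\<Union>i. C i)" for i by (rule SUP_upper2[of "2 * i + 1"]) (auto simp: C_def)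
    ultimately have "(\<Union>i. A i) \<union> (\<Union>i. B i) \<subseteq> (\<Union>i. C i)" by blast
    moreover have "S \<subseteq> (\<Union>i. A i)" "T \<subseteq> (\<Union>i. B i)" using A B by auto
    ultimately have cover: "S \<union> T \<subseteq> (\<Union>i. C i)" by (meson Un_mono subset_trans)
    have "bounded (C i)" "diameter (C i) \<le> \<delta>" for i using A B by (simp_all add: C_def)
    then have "hausdorff_content d \<delta> (S \<union> T) \<le> (\<Sum>i. hausdorff_weight d (C i))"
      by (intro hausdorff_content_le cover)
    also have "\<dots> \<le> (\<Sum>i. hausdorff_weight d (A i)) + (\<Sum>i. hausdorff_weight d (B i))"
    proof -
      have *: "(\<Sum>i<2 * n. hausdorff_weight d (C i)) = (\<Sum>i<n. hausdorff_weight d (A i)) + (\<Sum>i<n. hausdorff_weight d (B i))" for n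
        by (induction n) (auto simp: C_def ac_simps)
      show ?thesis unfolding suminf_eq_SUP[of "\<lambda>i. hausdorff_weight d (C i)"]
      proof (rule SUP_least)
        fix n
        have "(\<Sum>i<n. hausdorff_weight d (C i)) \<le> (\<Sum>i<2 * n. hausdorff_weight d (C i))"
          by (intro sum_mono2) auto
        also have "\<dots> \<le> (\<Sum>i. hausdorff_weight d (A i)) + (\<Sum>i. hausdorff_weight d (B i))"
          unfolding * by (intro add_mono sum_le_suminf) auto
        finally show "(\<Sum>i<n. hausdorff_weight d (C i)) \<le> (\<Sum>i. hausdorff_weight d (A i)) + (\<Sum>i. hausdorff_weight d (B i))" .
      qed
    qed
    finally show "hausdorff_content d \<delta> (S \<union> T) \<le> (\<Sum>i. hausdorff_weight d (A i)) + (\<Sum>i. hausdorff_weight d (B i))" .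
  qed
  also have "\<dots> \<le> hausdorff_measure d S + hausdorff_measure d T"
    using \<delta> by (intro add_mono hausdorff_content_le_measure) auto
  finally show "hausdorff_content d \<delta> (S \<union> T) \<le> hausdorff_measure d S + hausdorff_measure d T" .
qed

lemma hausdorff_measure_UNION_le:
  "finite I \<Longrightarrow> hausdorff_measure d (\<Union>i\<in>I. A i) \<le> (\<Sum>i\<in>I. hausdorff_measure d (A i))"
proof (induction I rule: finite_induct)
  case (insert i I)
  have "hausdorff_measure d (\<Union>i\<in>insert i I. A i) \<le> hausdorff_measure d (A i) + hausdorff_measure d (\<Union>i\<in>I. A i)"
    using hausdorff_measure_Un by simp
  also have "\<dots> \<le> hausdorff_measure d (A i) + (\<Sum>i\<in>I. hausdorff_measure d (A i))"
    by (intro add_left_mono insert.IH)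
  finally show ?case using insert.hyps by simp
qed simp

text \<open>A covering set of diameter below r cannot meet both S and T, so a fine cover of the
  union splits into covers of the two parts without increase of the total weight.\<close>

lemma hausdorff_measure_separated:
  assumes r: "r > 0" and sep: "\<And>x y. x \<in> S \<Longrightarrow> y \<in> T \<Longrightarrow> r \<le> dist x y"
  shows "hausdorff_measure d S + hausdorff_measure d T \<le> hausdorff_measure d (S \<union> T)"
proof -
  have small: "hausdorff_content d \<delta> S + hausdorff_content d \<delta> T \<le> hausdorff_content d \<delta> (S \<union> T)" if \<delta>: "\<delta> < r" for \<delta>
    unfolding hausdorff_content_eq[of d \<delta> "S \<union> T"]
  proof (rule INF_greatest)
    fix C :: "nat \<Rightarrow> 'a set"
    assume C: "C \<in> {C. S \<union> T \<subseteq> (\<Union>i. C i) \<and> (\<forall>i. bounded (C i) \<and> diameter (C i) \<le> \<delta>)}"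
    have cb: "bounded (C i)" "diameter (C i) \<le> \<delta>" for i using C by auto
    have sub: "bounded (C i \<inter> X)" "diameter (C i \<inter> X) \<le> \<delta>" for i X
      using cb[of i] diameter_subset[of "C i \<inter> X" "C i"] by (auto intro: bounded_subset)
    have w: "hausdorff_weight d (C i \<inter> S) + hausdorff_weight d (C i \<inter> T) \<le> hausdorff_weight d (C i)" for i
    proof (cases "C i \<inter> S = {} \<or> C i \<inter> T = {}")
      case True
      then show ?thesis using hausdorff_weight_mono[of _ "C i" d] cb
        by (auto simp: hausdorff_weight_def[of d "{}"])
    next
      case False
      then obtain x y where "x \<in> C i \<inter> S" "y \<in> C i \<inter> T" by blast
      then have "r \<le> dist x y" "dist x y \<le> diameter (C i)"
        using sep cb by (auto intro: diameter_bounded_bound)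
      then show ?thesis using cb(2)[of i] \<delta> by simp
    qed
    have "hausdorff_content d \<delta> S + hausdorff_content d \<delta> T \<le>
        (\<Sum>i. hausdorff_weight d (C i \<inter> S)) + (\<Sum>i. hausdorff_weight d (C i \<inter> T))"
      using C sub by (intro add_mono hausdorff_content_le) auto
    also have "\<dots> = (\<Sum>i. hausdorff_weight d (C i \<inter> S) + hausdorff_weight d (C i \<inter> T))"
      by (intro suminf_add) auto
    also have "\<dots> \<le> (\<Sum>i. hausdorff_weight d (C i))"
      by (intro suminf_le w) auto
    finally show "hausdorff_content d \<delta> S + hausdorff_content d \<delta> T \<le> (\<Sum>i. hausdorff_weight d (C i))" .
  qed
  have "hausdorff_measure d S + hausdorff_measure d T =
      (SUP \<delta>\<in>{0<..}. hausdorff_content d \<delta> S + hausdorff_content d \<delta> T)"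
    unfolding hausdorff_measure_def
  proof (rule SUP_add_directed_ennreal[symmetric])
    fix i j :: real assume "i \<in> {0<..}" "j \<in> {0<..}"
    then show "\<exists>k\<in>{0<..}. hausdorff_content d i S + hausdorff_content d j T \<le> hausdorff_content d k S + hausdorff_content d k T"
      by (intro bexI[of _ "min i j"] add_mono hausdorff_content_antimono) auto
  qed
  also have "\<dots> \<le> hausdorff_measure d (S \<union> T)"
  proof (rule SUP_least)
    fix \<delta> :: real assume "\<delta> \<in> {0<..}"
    define \<delta>' where "\<delta>' = min \<delta> (r / 2)"
    have \<delta>': "\<delta>' > 0" "\<delta>' < r" "\<delta>' \<le> \<delta>" using \<open>\<delta> \<in> {0<..}\<close> r by (auto simp: \<delta>'_def)
    have "hausdorff_content d \<delta> S + hausdorff_content d \<delta> T \<le> hausdorff_content d \<delta>' S + hausdorff_content d \<delta>' T"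
      using \<delta>' by (intro add_mono hausdorff_content_antimono)
    also have "\<dots> \<le> hausdorff_content d \<delta>' (S \<union> T)" by (rule small) (use \<delta>' in simp)
    also have "\<dots> \<le> hausdorff_measure d (S \<union> T)" using \<delta>' by (intro hausdorff_content_le_measure)
    finally show "hausdorff_content d \<delta> S + hausdorff_content d \<delta> T \<le> hausdorff_measure d (S \<union> T)" .
  qed
  finally show ?thesis .
qed

lemma diameter_le_dist:
  "S \<noteq> {} \<Longrightarrow> (\<And>x y. x \<in> S \<Longrightarrow> y \<in> S \<Longrightarrow> dist x y \<le> B) \<Longrightarrow> diameter S \<le> B"
  unfolding diameter_def by (auto intro!: cSUP_least)

lemma hausdorff_measure_Lipschitz:
  fixes f :: "'a::metric_space \<Rightarrow> 'b::metric_space"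
  assumes l: "l > 0" and f: "\<And>x y. x \<in> S \<Longrightarrow> y \<in> S \<Longrightarrow> dist (f x) (f y) \<le> l * dist x y"
  shows "hausdorff_measure d (f ` S) \<le> ennreal (l ^ d) * hausdorff_measure d S"
  unfolding hausdorff_measure_def[of d "f ` S"]
proof (rule SUP_least)
  fix \<delta>' :: real assume "\<delta>' \<in> {0<..}"
  define \<delta> where "\<delta> = \<delta>' / l"
  have \<delta>: "\<delta> > 0" "\<delta>' = l * \<delta>" using l \<open>\<delta>' \<in> {0<..}\<close> by (auto simp: \<delta>_def)
  have img: "bounded (f ` (C \<inter> S)) \<and> (C \<inter> S \<noteq> {} \<longrightarrow> diameter (f ` (C \<inter> S)) \<le> l * diameter C)" if C: "bounded C" for C
  proof -
    have d: "dist x y \<le> l * diameter C" if xy: "x \<in> f ` (C \<inter> S)" "y \<in> f ` (C \<inter> S)" for x y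
    proof -
      obtain a b where ab: "x = f a" "y = f b" "a \<in> C" "b \<in> C" "a \<in> S" "b \<in> S" using xy by blast
      have "dist x y \<le> l * dist a b" using f ab by simp
      also have "\<dots> \<le> l * diameter C" using l ab C by (intro mult_left_mono diameter_bounded_bound) auto
      finally show ?thesis .
    qed
    have "bounded (f ` (C \<inter> S))" using d unfolding bounded_two_points by blast
    moreover have "diameter (f ` (C \<inter> S)) \<le> l * diameter C" if "C \<inter> S \<noteq> {}"
      using that by (intro diameter_le_dist d) auto
    ultimately show ?thesis by blast
  qed
  have l0: "ennreal (l ^ d) > 0" "ennreal (l ^ d) \<noteq> top" using l by auto
  have "hausdorff_content d \<delta>' (f ` S) / ennreal (l ^ d) \<le> hausdorff_content d \<delta> S"
    unfolding hausdorff_content_eq[of d \<delta> S]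
  proof (rule INF_greatest, rule divide_le_posI_ennreal[OF l0(1)])
    fix C :: "nat \<Rightarrow> 'a set"
    assume C: "C \<in> {C. S \<subseteq> (\<Union>i. C i) \<and> (\<forall>i. bounded (C i) \<and> diameter (C i) \<le> \<delta>)}"
    have cb: "bounded (C i)" "diameter (C i) \<le> \<delta>" for i using C by auto
    have "hausdorff_content d \<delta>' (f ` S) \<le> (\<Sum>i. hausdorff_weight d (f ` (C i \<inter> S)))"
    proof (rule hausdorff_content_le)
      show "f ` S \<subseteq> (\<Union>i. f ` (C i \<inter> S))" using C by blast
      show "bounded (f ` (C i \<inter> S))" for i using img[OF cb(1)] by blast
      show "diameter (f ` (C i \<inter> S)) \<le> \<delta>'" for i
      proof (cases "C i \<inter> S = {}")
        case False
        then have "diameter (f ` (C i \<inter> S)) \<le> l * diameter (C i)" using img[OF cb(1)] by blast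
        also have "\<dots> \<le> \<delta>'" using \<delta> l cb(2)[of i] by simp
        finally show ?thesis .
      qed (use \<delta> l in simp)
    qed
    also have "\<dots> \<le> (\<Sum>i. ennreal (l ^ d) * hausdorff_weight d (C i))"
    proof (rule suminf_le)
      fix i
      show "hausdorff_weight d (f ` (C i \<inter> S)) \<le> ennreal (l ^ d) * hausdorff_weight d (C i)"
      proof (cases "C i \<inter> S = {}")
        case False
        then have "diameter (f ` (C i \<inter> S)) \<le> l * diameter (C i)" using img[OF cb(1)] by blast
        then have "(diameter (f ` (C i \<inter> S)) / 2) ^ d \<le> (l * (diameter (C i) / 2)) ^ d"
          using img[OF cb(1)] by (intro power_mono) (auto intro: diameter_ge_0)
        also have "\<dots> = l ^ d * (diameter (C i) / 2) ^ d" by (rule power_mult_distrib)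
        finally have "unit_ball_vol (real d) * (diameter (f ` (C i \<inter> S)) / 2) ^ d \<le>
            l ^ d * (unit_ball_vol (real d) * (diameter (C i) / 2) ^ d)"
          by (subst mult.left_commute) (rule mult_left_mono, auto)
        then show ?thesis using False l by (auto simp: hausdorff_weight_def ennreal_leI simp flip: ennreal_mult')
      qed (simp add: hausdorff_weight_def)
    qed auto
    also have "\<dots> = ennreal (l ^ d) * (\<Sum>i. hausdorff_weight d (C i))" by simp
    finally show "hausdorff_content d \<delta>' (f ` S) \<le> ennreal (l ^ d) * (\<Sum>i. hausdorff_weight d (C i))" .
  qed
  also have "\<dots> \<le> hausdorff_measure d S" using \<delta> by (intro hausdorff_content_le_measure)
  finally have "ennreal (l ^ d) * (hausdorff_content d \<delta>' (f ` S) / ennreal (l ^ d)) \<le> ennreal (l ^ d) * hausdorff_measure d S"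
    by (rule mult_left_mono) simp
  moreover have "ennreal (l ^ d) * (hausdorff_content d \<delta>' (f ` S) / ennreal (l ^ d)) = hausdorff_content d \<delta>' (f ` S)"
    using l by (subst ennreal_times_divide, subst mult.commute, subst ennreal_mult_divide_eq) auto
  ultimately show "hausdorff_content d \<delta>' (f ` S) \<le> ennreal (l ^ d) * hausdorff_measure d S" by simp
qed

lemma hausdorff_measure_isometry:
  fixes f :: "'a::metric_space \<Rightarrow> 'a"
  assumes "\<And>x y. dist (f x) (f y) = dist x y"
  shows "hausdorff_measure d (f ` S) = hausdorff_measure d S"
proof (rule antisym)
  show "hausdorff_measure d (f ` S) \<le> hausdorff_measure d S"
    using hausdorff_measure_Lipschitz[of 1 S f d] assms by simp
  have inj: "inj f" using assms by (metis dist_eq_0_iff injI)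
  then have "S = inv f ` (f ` S)" by (simp add: image_inv_f_f)
  moreover have "hausdorff_measure d (inv f ` (f ` S)) \<le> ennreal (1 ^ d) * hausdorff_measure d (f ` S)"
    by (rule hausdorff_measure_Lipschitz) (use inj assms in \<open>auto simp: inv_f_f\<close>)
  ultimately show "hausdorff_measure d S \<le> hausdorff_measure d (f ` S)" by simp
qed

section \<open>Homotheties and additivity of the measure\<close>

definition contraction :: "'a::euclidean_space \<Rightarrow> real \<Rightarrow> 'a \<Rightarrow> 'a" where
  "contraction a \<theta> x = a + \<theta> *\<^sub>R (x - a)"

lemma dist_contraction: "dist (contraction a \<theta> x) (contraction a \<theta> y) = \<bar>\<theta>\<bar> * dist x y"
proof -
  have "contraction a \<theta> x - contraction a \<theta> y = \<theta> *\<^sub>R (x - y)" by (simp add: contraction_def algebra_simps)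
  then show ?thesis by (simp only: dist_norm norm_scaleR)
qed

text \<open>The Lipschitz estimate bounds the measure of an image from above; a lower bound comes
  from applying it to the inverse homothety.\<close>

lemma hausdorff_measure_contraction_ge:
  assumes \<theta>: "0 < \<theta>"
  shows "ennreal (\<theta> ^ d) * hausdorff_measure d S \<le> hausdorff_measure d (contraction a \<theta> ` S)"
proof -
  have "S = contraction a (1 / \<theta>) ` (contraction a \<theta> ` S)"
    using \<theta> by (simp add: image_image contraction_def)
  moreover have "hausdorff_measure d (contraction a (1 / \<theta>) ` (contraction a \<theta> ` S)) \<le>
      ennreal ((1 / \<theta>) ^ d) * hausdorff_measure d (contraction a \<theta> ` S)"
    by (rule hausdorff_measure_Lipschitz)
      (use \<theta> in \<open>auto simp: dist_contraction\<close>)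
  ultimately have "ennreal (\<theta> ^ d) * hausdorff_measure d S \<le>
      ennreal (\<theta> ^ d) * (ennreal ((1 / \<theta>) ^ d) * hausdorff_measure d (contraction a \<theta> ` S))"
    by (intro mult_left_mono) auto
  also have "\<dots> = hausdorff_measure d (contraction a \<theta> ` S)"
  proof -
    have "ennreal (\<theta> ^ d) * ennreal ((1 / \<theta>) ^ d) = 1"
      using \<theta> by (simp add: power_divide flip: ennreal_mult)
    then show ?thesis by (simp add: mult.assoc[symmetric])
  qed
  finally show ?thesis .
qed

text \<open>Disjoint compact sets have positive distance, so additivity on separated sets applies to
  one of them against the union of the others.\<close>

lemma hausdorff_measure_UNION_compact_separated:
  fixes B :: "'i \<Rightarrow> 'a::euclidean_space set"
  assumes "finite I" "\<And>i. i \<in> I \<Longrightarrow> compact (C i) \<and> B i \<subseteq> C i" "disjoint_family_on C I"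
  shows "(\<Sum>i\<in>I. hausdorff_measure d (B i)) \<le> hausdorff_measure d (\<Union>i\<in>I. B i)"
  using assms
proof (induction I rule: finite_induct)
  case (insert i I)
  have c1: "compact (C i)" and c2: "compact (\<Union>j\<in>I. C j)"
    using insert.prems(1) insert.hyps(1) by (auto intro!: compact_UN)
  have "C i \<inter> C j = {}" if "j \<in> I" for j
    using disjoint_family_onD[OF insert.prems(2), of i j] that insert.hyps(2) by (metis insertCI)
  then have c3: "C i \<inter> (\<Union>j\<in>I. C j) = {}" by blast
  obtain r where r: "r > 0" "\<And>x y. x \<in> C i \<Longrightarrow> y \<in> (\<Union>j\<in>I. C j) \<Longrightarrow> r \<le> dist x y"
    using separate_compact_closed[OF c1 compact_imp_closed[OF c2] c3] by blast
  have "(\<Sum>j\<in>insert i I. hausdorff_measure d (B j)) \<le> hausdorff_measure d (B i) + hausdorff_measure d (\<Union>j\<in>I. B j)"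
  proof -
    have "(\<Sum>j\<in>I. hausdorff_measure d (B j)) \<le> hausdorff_measure d (\<Union>j\<in>I. B j)"
      by (rule insert.IH[OF _ disjoint_family_on_mono[OF subset_insertI insert.prems(2)]]) (use insert.prems(1) in blast)
    then show ?thesis using insert.hyps by (simp add: add_left_mono)
  qed
  also have "\<dots> \<le> hausdorff_measure d (B i \<union> (\<Union>j\<in>I. B j))"
    by (rule hausdorff_measure_separated[OF r(1)]) (use r(2) insert.prems(1) in blast)
  finally show ?case by simp
qed simp

text \<open>Additivity without measurability: the sets are exhausted by contracted, mutually separated copies.\<close>

lemma hausdorff_measure_UNION_shrinkable:
  fixes A :: "'i \<Rightarrow> 'a::euclidean_space set"
  assumes I: "finite I" and bd: "\<And>i. i \<in> I \<Longrightarrow> bounded (A i)"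
    and sh: "\<And>i \<theta>. i \<in> I \<Longrightarrow> 0 < \<theta> \<Longrightarrow> \<theta> < 1 \<Longrightarrow> closure (contraction (a i) \<theta> ` A i) \<subseteq> A i"
    and dj: "disjoint_family_on A I"
  shows "hausdorff_measure d (\<Union>i\<in>I. A i) = (\<Sum>i\<in>I. hausdorff_measure d (A i))"
proof (rule antisym)
  show "(\<Sum>i\<in>I. hausdorff_measure d (A i)) \<le> hausdorff_measure d (\<Union>i\<in>I. A i)"
  proof (rule ennreal_le_of_contractions[where d = d])
    fix \<theta> :: real assume \<theta>: "0 < \<theta>" "\<theta> < 1"
    let ?B = "\<lambda>i. contraction (a i) \<theta> ` A i"
    have "ennreal (\<theta> ^ d) * (\<Sum>i\<in>I. hausdorff_measure d (A i)) = (\<Sum>i\<in>I. ennreal (\<theta> ^ d) * hausdorff_measure d (A i))"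
      by (rule sum_distrib_left)
    also have "\<dots> \<le> (\<Sum>i\<in>I. hausdorff_measure d (?B i))"
      by (intro sum_mono hausdorff_measure_contraction_ge \<theta>)
    also have "\<dots> \<le> hausdorff_measure d (\<Union>i\<in>I. ?B i)"
    proof (rule hausdorff_measure_UNION_compact_separated[OF I, where C = "\<lambda>i. closure (?B i)"])
      show "disjoint_family_on (\<lambda>i. closure (?B i)) I"
        unfolding disjoint_family_on_def
      proof (intro ballI impI)
        fix i j assume ij: "i \<in> I" "j \<in> I" "i \<noteq> j"
        then have "A i \<inter> A j = {}" using dj by (simp add: disjoint_family_on_def)
        then show "closure (?B i) \<inter> closure (?B j) = {}"
          using sh[OF ij(1) \<theta>] sh[OF ij(2) \<theta>] by (metis Int_mono subset_empty)
      qed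
      show "compact (closure (?B i)) \<and> ?B i \<subseteq> closure (?B i)" if "i \<in> I" for i
        using bounded_subset[OF bd[OF that] sh[OF that \<theta>]] by (simp add: compact_eq_bounded_closed closure_subset)
    qed
    also have "\<dots> \<le> hausdorff_measure d (\<Union>i\<in>I. A i)"
    proof (rule hausdorff_measure_mono)
      show "(\<Union>i\<in>I. ?B i) \<subseteq> (\<Union>i\<in>I. A i)"
        by (intro UN_mono order_refl order_trans[OF closure_subset sh[OF _ \<theta>]])
    qed
    finally show "ennreal (\<theta> ^ d) * (\<Sum>i\<in>I. hausdorff_measure d (A i)) \<le> hausdorff_measure d (\<Union>i\<in>I. A i)" .
  qed
qed (rule hausdorff_measure_UNION_le[OF I])

section \<open>Hausdorff measure of boxes\<close>

text \<open>A zero in \<open>h\<close> makes the box flat in that coordinate.\<close>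

definition flat_box :: "real ^ 'n \<Rightarrow> real ^ 'n \<Rightarrow> (real ^ 'n) set" where
  "flat_box c h = {x. \<forall>j. if h $ j = 0 then x $ j = c $ j else \<bar>x $ j - c $ j\<bar> < h $ j}"

lemma mem_flat_box:
  "x \<in> flat_box c h \<longleftrightarrow> (\<forall>j. (h $ j = 0 \<longrightarrow> x $ j = c $ j) \<and> (h $ j \<noteq> 0 \<longrightarrow> \<bar>x $ j - c $ j\<bar> < h $ j))"
  by (auto simp: flat_box_def)

text \<open>The contracted box has half-edges \<theta> times the old ones, strictly smaller wherever
  positive, so even its closure fits into the relatively open box. This is the hypothesis of
  \<open>hausdorff_measure_UNION_shrinkable\<close>.\<close>

lemma flat_box_shrinkable:
  assumes h: "\<And>j. h $ j \<ge> 0" and \<theta>: "0 < \<theta>" "\<theta> < 1"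
  shows "closure (contraction c \<theta> ` flat_box c h) \<subseteq> flat_box c h"
proof -
  have "closure (contraction c \<theta> ` flat_box c h) \<subseteq> {x. \<forall>j. \<bar>x $ j - c $ j\<bar> \<le> \<theta> * h $ j}"
  proof (rule closure_minimal)
    show "contraction c \<theta> ` flat_box c h \<subseteq> {x. \<forall>j. \<bar>x $ j - c $ j\<bar> \<le> \<theta> * h $ j}"
    proof safe
      fix x j assume "x \<in> flat_box c h"
      then have "if h $ j = 0 then x $ j = c $ j else \<bar>x $ j - c $ j\<bar> < h $ j" by (simp add: flat_box_def)
      then have "\<bar>x $ j - c $ j\<bar> \<le> h $ j" by (simp split: if_splits)
      then show "\<bar>contraction c \<theta> x $ j - c $ j\<bar> \<le> \<theta> * h $ j"
        using \<theta> by (simp add: contraction_def abs_mult)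
    qed
    show "closed {x. \<forall>j. \<bar>x $ j - c $ j\<bar> \<le> \<theta> * h $ j}"
      by (intro closed_Collect_all closed_Collect_le continuous_intros)
  qed
  also have "\<dots> \<subseteq> flat_box c h"
  proof
    fix x assume x: "x \<in> {x. \<forall>j. \<bar>x $ j - c $ j\<bar> \<le> \<theta> * h $ j}"
    have "if h $ j = 0 then x $ j = c $ j else \<bar>x $ j - c $ j\<bar> < h $ j" for j
    proof (cases "h $ j = 0")
      case False
      then have "\<theta> * h $ j < h $ j" using h[of j] \<theta> by simp
      then show ?thesis using x False by (auto intro: le_less_trans)
    qed (use x in \<open>auto dest: spec[of _ j]\<close>)
    then show "x \<in> flat_box c h" by (simp add: flat_box_def)
  qed
  finally show ?thesis .
qed

lemma flat_box_subset_cbox: "flat_box c h \<subseteq> cbox (c - h) (c + h)"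
proof
  fix x assume x: "x \<in> flat_box c h"
  have "(c - h) $ j \<le> x $ j \<and> x $ j \<le> (c + h) $ j" for j
  proof -
    have "if h $ j = 0 then x $ j = c $ j else \<bar>x $ j - c $ j\<bar> < h $ j" using x by (simp add: flat_box_def)
    then show ?thesis by (auto split: if_splits)
  qed
  then show "x \<in> cbox (c - h) (c + h)" by (simp add: mem_box_cart)
qed

lemma bounded_flat_box: "bounded (flat_box c h)"
  by (rule bounded_subset[OF bounded_cbox flat_box_subset_cbox])

text \<open>Contracted copies of the closed box lie in the relatively open one, so adding the
  relative boundary does not increase the measure. Covers by closed cells can thus be matched with
  disjoint open cells.\<close>

lemma hausdorff_measure_cbox_le_flat_box:
  assumes h: "\<And>j. h $ j \<ge> 0"
  shows "hausdorff_measure d (cbox (c - h) (c + h)) \<le> hausdorff_measure d (flat_box c h)"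
proof (rule ennreal_le_of_contractions[where d = d])
  fix \<theta> :: real assume \<theta>: "0 < \<theta>" "\<theta> < 1"
  have "contraction c \<theta> ` cbox (c - h) (c + h) \<subseteq> flat_box c h"
  proof
    fix y assume "y \<in> contraction c \<theta> ` cbox (c - h) (c + h)"
    then obtain x where x: "x \<in> cbox (c - h) (c + h)" "y = contraction c \<theta> x" by blast
    have "if h $ j = 0 then y $ j = c $ j else \<bar>y $ j - c $ j\<bar> < h $ j" for j
    proof -
      have a: "\<bar>x $ j - c $ j\<bar> \<le> h $ j" using x(1) unfolding mem_box_cart by (auto simp: abs_le_iff algebra_simps dest: spec[of _ j])
      have b: "\<bar>y $ j - c $ j\<bar> = \<theta> * \<bar>x $ j - c $ j\<bar>" using x \<theta> by (simp add: contraction_def abs_mult)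
      show ?thesis
      proof (cases "h $ j = 0")
        case False
        then have "\<theta> * h $ j < h $ j" using h[of j] \<theta> by simp
        moreover have "\<theta> * \<bar>x $ j - c $ j\<bar> \<le> \<theta> * h $ j" using a \<theta> by (intro mult_left_mono) auto
        ultimately show ?thesis using False b by simp
      qed (use a b in auto)
    qed
    then show "y \<in> flat_box c h" by (simp add: flat_box_def)
  qed
  then show "ennreal (\<theta> ^ d) * hausdorff_measure d (cbox (c - h) (c + h)) \<le> hausdorff_measure d (flat_box c h)"
    using order_trans[OF hausdorff_measure_contraction_ge[OF \<theta>(1)] hausdorff_measure_mono] by blast
qed

lemma hausdorff_measure_flat_box_translate: "hausdorff_measure d (flat_box c h) = hausdorff_measure d (flat_box 0 h)"
proof -
  have "flat_box c h = (+) c ` flat_box 0 h"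
  proof safe
    fix x assume "x \<in> flat_box c h"
    then have "x - c \<in> flat_box 0 h" by (simp add: mem_flat_box)
    then have "c + (x - c) \<in> (+) c ` flat_box 0 h" by (rule imageI)
    then show "x \<in> (+) c ` flat_box 0 h" by simp
  next
    fix x assume "x \<in> flat_box 0 h"
    then show "c + x \<in> flat_box c h" by (simp add: mem_flat_box)
  qed
  then show ?thesis by (simp add: hausdorff_measure_isometry)
qed

lemma hausdorff_measure_flat_box_permute:
  fixes h :: "real ^ 'n" and p :: "'n \<Rightarrow> 'n"
  assumes p: "bij p"
  shows "hausdorff_measure d (flat_box 0 (\<chi> j. h $ p j)) = hausdorff_measure d (flat_box 0 h)"
proof -
  define f :: "real ^ 'n \<Rightarrow> real ^ 'n" where "f x = (\<chi> j. x $ p j)" for x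
  have dist: "dist (f x) (f y) = dist x y" for x y
  proof -
    have "(\<Sum>j\<in>UNIV. (dist (x $ p j) (y $ p j))\<^sup>2) = (\<Sum>j\<in>UNIV. (dist (x $ j) (y $ j))\<^sup>2)"
      using sum.reindex_bij_betw[OF p, of "\<lambda>j. (dist (x $ j) (y $ j))\<^sup>2"] .
    then show ?thesis by (simp add: dist_vec_def L2_set_def f_def)
  qed
  have mem: "x \<in> flat_box 0 h \<longleftrightarrow> f x \<in> flat_box 0 (\<chi> j. h $ p j)" for x
  proof -
    have "(\<forall>j. P (p j)) \<longleftrightarrow> (\<forall>j. P j)" for P using p by (metis bij_pointE)
    from this[of "\<lambda>j. (h $ j = 0 \<longrightarrow> x $ j = 0) \<and> (h $ j \<noteq> 0 \<longrightarrow> \<bar>x $ j\<bar> < h $ j)"] show ?thesis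
      by (simp add: mem_flat_box f_def)
  qed
  have "flat_box 0 (\<chi> j. h $ p j) = f ` flat_box 0 h"
  proof safe
    fix x assume x: "x \<in> flat_box 0 (\<chi> j. h $ p j)"
    define y where "y = (\<chi> j. x $ inv p j)"
    have "x = f y" using p by (simp add: f_def y_def vec_eq_iff bij_is_inj)
    then show "x \<in> f ` flat_box 0 h" using x mem by blast
  qed (simp add: mem)
  then show ?thesis using hausdorff_measure_isometry[of f, OF dist] by simp
qed

lemma flat_box_measure_additive:
  assumes "finite I" "disjoint_family_on (\<lambda>i. flat_box (c i) (h i)) I"
    and "\<And>i j. i \<in> I \<Longrightarrow> h i $ j \<ge> 0"
  shows "hausdorff_measure d (\<Union>i\<in>I. flat_box (c i) (h i)) = (\<Sum>i\<in>I. hausdorff_measure d (flat_box (c i) (h i)))"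
  using assms by (intro hausdorff_measure_UNION_shrinkable[where a = c] bounded_flat_box flat_box_shrinkable) auto

definition unit_face :: "'n \<Rightarrow> real ^ 'n" where
  "unit_face i = (\<chi> j. if j = i then 0 else 1)"

text \<open>The box is cut into cells of side length \<open>2\<close>, indexed by \<open>P\<close>; the closed cells cover it.\<close>

lemma hausdorff_measure_flat_box_tiling:
  fixes c :: "real ^ 'n" and N :: "'n \<Rightarrow> nat"
  assumes N: "\<And>j. N j > 0"
  shows "hausdorff_measure d (flat_box c (\<chi> j. if j = i then 0 else real (N j))) =
    of_nat (\<Prod>j\<in>UNIV - {i}. N j) * hausdorff_measure d (flat_box 0 (unit_face i))"
proof -
  define h :: "real ^ 'n" where "h = (\<chi> j. if j = i then 0 else real (N j))"
  \<comment> \<open>The value 1 at i gives a single layer of cells in the flat direction.\<close>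
  define N' where "N' j = (if j = i then 1 else N j)" for j
  define P where "P = (\<Pi>\<^sub>E j\<in>UNIV. {..<N' j})"
  \<comment> \<open>In a direction other than i the cells begin at c $ j - N j and have length 2, so
    the m j-th cell has its centre at the odd offset 2 m j + 1.\<close>
  define cc :: "('n \<Rightarrow> nat) \<Rightarrow> real ^ 'n" where "cc m = (\<chi> j. if j = i then c $ i else c $ j - real (N j) + (2 * real (m j) + 1))" for m
  have P: "finite P" unfolding P_def by (intro finite_PiE) auto
  have uf: "unit_face i $ j \<ge> 0" for j by (simp add: unit_face_def)
  have card: "card P = (\<Prod>j\<in>UNIV - {i}. N j)"
  proof -
    have "card P = (\<Prod>j\<in>UNIV. N' j)" unfolding P_def by (subst card_PiE) auto
    also have "\<dots> = N' i * (\<Prod>j\<in>UNIV - {i}. N' j)" by (rule prod.remove) auto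
    also have "\<dots> = (\<Prod>j\<in>UNIV - {i}. N j)" by (simp add: N'_def)
    finally show ?thesis .
  qed
  have dj: "disjoint_family_on (\<lambda>m. flat_box (cc m) (unit_face i)) P"
    unfolding disjoint_family_on_def
  proof (intro ballI impI)
    fix m m' assume m: "m \<in> P" "m' \<in> P" "m \<noteq> m'"
    then obtain j where j: "m j \<noteq> m' j" by blast
    have "j \<noteq> i"
    proof
      assume "j = i"
      then have "m j < 1" "m' j < 1" using m(1,2) by (auto simp: P_def N'_def PiE_def Pi_def dest: spec[of _ i])
      then show False using j by simp
    qed
    then have "\<bar>x $ j - cc m $ j\<bar> < 1" "\<bar>x $ j - cc m' $ j\<bar> < 1"
      if "x \<in> flat_box (cc m) (unit_face i)" "x \<in> flat_box (cc m') (unit_face i)" for x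
      using that by (auto simp: mem_flat_box unit_face_def dest!: spec[of _ j])
    moreover have "\<bar>cc m $ j - cc m' $ j\<bar> \<ge> 2"
    proof -
      have "cc m $ j - cc m' $ j = 2 * (real (m j) - real (m' j))" using \<open>j \<noteq> i\<close> by (simp add: cc_def)
      moreover have "\<bar>real (m j) - real (m' j)\<bar> \<ge> 1" using j by linarith
      ultimately show ?thesis by (simp add: abs_mult)
    qed
    ultimately show "flat_box (cc m) (unit_face i) \<inter> flat_box (cc m') (unit_face i) = {}" by fastforce
  qed
  have sub: "flat_box (cc m) (unit_face i) \<subseteq> flat_box c h" if m: "m \<in> P" for m
  proof
    fix x assume x: "x \<in> flat_box (cc m) (unit_face i)"
    have "(h $ j = 0 \<longrightarrow> x $ j = c $ j) \<and> (h $ j \<noteq> 0 \<longrightarrow> \<bar>x $ j - c $ j\<bar> < h $ j)" for j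
    proof (cases "j = i")
      case True
      then show ?thesis using x by (auto simp: mem_flat_box unit_face_def h_def cc_def dest: spec[of _ i])
    next
      case False
      then have "\<bar>x $ j - cc m $ j\<bar> < 1" using x by (auto simp: mem_flat_box unit_face_def dest: spec[of _ j])
      moreover have "m j < N j" using m False by (auto simp: P_def N'_def PiE_def Pi_def dest: spec[of _ j])
      then have "real (m j) + 1 \<le> real (N j)" by linarith
      ultimately show ?thesis using False N[of j] by (auto simp: h_def cc_def)
    qed
    then show "x \<in> flat_box c h" by (simp add: mem_flat_box)
  qed
  have cover: "flat_box c h \<subseteq> (\<Union>m\<in>P. cbox (cc m - unit_face i) (cc m + unit_face i))"
  proof
    fix x assume x: "x \<in> flat_box c h"
    \<comment> \<open>Rounding down selects a cell; a point on the wall between two cells is on the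
      boundary of the selected one, hence the cover by closed cells.\<close>
    define m where "m j = (if j = i then 0 else nat \<lfloor>(x $ j - c $ j + real (N j)) / 2\<rfloor>)" for j
    have b: "m j < N j \<and> \<bar>x $ j - cc m $ j\<bar> \<le> 1" if j: "j \<noteq> i" for j
    proof -
      define y where "y = (x $ j - c $ j + real (N j)) / 2"
      have "\<bar>x $ j - c $ j\<bar> < real (N j)" using x j N[of j] by (auto simp: mem_flat_box h_def dest: spec[of _ j])
      then have y: "0 < y" "y < real (N j)" by (auto simp: y_def abs_less_iff)
      have mj: "real (m j) = of_int \<lfloor>y\<rfloor>" using j y(1) by (simp add: m_def y_def[symmetric])
      have "real (m j) \<le> y" "y < real (m j) + 1" unfolding mj by linarith+
      moreover have "x $ j - cc m $ j = 2 * y - 2 * real (m j) - 1" using j by (simp add: cc_def y_def)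
      ultimately show ?thesis using y by auto
    qed
    have "m \<in> P" unfolding P_def N'_def using b by (auto simp: m_def)
    moreover have "x \<in> cbox (cc m - unit_face i) (cc m + unit_face i)"
      unfolding mem_box_cart
    proof
      fix j
      show "(cc m - unit_face i) $ j \<le> x $ j \<and> x $ j \<le> (cc m + unit_face i) $ j"
      proof (cases "j = i")
        case True
        then show ?thesis using x by (auto simp: mem_flat_box h_def cc_def unit_face_def dest: spec[of _ i])
      next
        case False
        then show ?thesis using b[OF False] by (auto simp: unit_face_def abs_le_iff)
      qed
    qed
    ultimately show "x \<in> (\<Union>m\<in>P. cbox (cc m - unit_face i) (cc m + unit_face i))" by blast
  qed
  let ?q = "hausdorff_measure d (flat_box 0 (unit_face i))"
  have "hausdorff_measure d (flat_box c h) = of_nat (card P) * ?q"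
  proof (rule antisym)
    have "hausdorff_measure d (flat_box c h) \<le> (\<Sum>m\<in>P. hausdorff_measure d (cbox (cc m - unit_face i) (cc m + unit_face i)))"
      by (rule order_trans[OF hausdorff_measure_mono[OF cover] hausdorff_measure_UNION_le[OF P]])
    also have "\<dots> \<le> (\<Sum>m\<in>P. hausdorff_measure d (flat_box (cc m) (unit_face i)))"
      by (intro sum_mono hausdorff_measure_cbox_le_flat_box uf)
    also have "\<dots> = of_nat (card P) * ?q"
      by (simp add: hausdorff_measure_flat_box_translate[of d "cc _"])
    finally show "hausdorff_measure d (flat_box c h) \<le> of_nat (card P) * ?q" .
    have "of_nat (card P) * ?q = (\<Sum>m\<in>P. hausdorff_measure d (flat_box (cc m) (unit_face i)))"
      by (simp add: hausdorff_measure_flat_box_translate[of d "cc _"])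
    also have "\<dots> = hausdorff_measure d (\<Union>m\<in>P. flat_box (cc m) (unit_face i))"
      by (rule flat_box_measure_additive[symmetric, OF P dj]) (rule uf)
    also have "\<dots> \<le> hausdorff_measure d (flat_box c h)"
      by (intro hausdorff_measure_mono UN_least sub)
    finally show "of_nat (card P) * ?q \<le> hausdorff_measure d (flat_box c h)" .
  qed
  then show ?thesis unfolding card h_def .
qed

lemma hausdorff_measure_unit_face:
  fixes i j :: "'n::finite"
  shows "hausdorff_measure d (flat_box 0 (unit_face i)) = hausdorff_measure d (flat_box 0 (unit_face j))"
proof -
  have "unit_face i = (\<chi> k. unit_face j $ Transposition.transpose i j k)"
    by (auto simp: unit_face_def vec_eq_iff Transposition.transpose_def)
  then show ?thesis
    using hausdorff_measure_flat_box_permute[of "Transposition.transpose i j" d "unit_face j"] by simp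
qed

section \<open>The surface area measure of a box\<close>

text \<open>Integer half-edges allow each face to be tiled by translates of a single square-like
  cell, so that face measures become cell counts.\<close>

definition int_box :: "('n \<Rightarrow> nat) \<Rightarrow> (real ^ 'n) set" where
  "int_box N = cbox (- (\<chi> j. real (N j))) (\<chi> j. real (N j))"

lemma mem_int_box: "x \<in> int_box N \<longleftrightarrow> (\<forall>j. \<bar>x $ j\<bar> \<le> real (N j))"
  by (auto simp: int_box_def mem_box_cart abs_le_iff)
    (metis minus_le_iff)+

lemma interior_int_box: "x \<in> interior (int_box N) \<longleftrightarrow> (\<forall>j. \<bar>x $ j\<bar> < real (N j))"
  by (auto simp: int_box_def interior_cbox mem_box_cart abs_less_iff)
    (metis minus_less_iff)+

lemma convex_body_int_box:
  assumes "\<And>j. N j > 0"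
  shows "convex_body (int_box N)"
proof -
  have "0 \<in> interior (int_box N)" using assms by (simp add: interior_int_box)
  then show ?thesis by (auto simp: convex_body_def int_box_def convex_box)
qed

text \<open>The index pairs an axis with a sign 1 or -1. Edges are excluded: on these relatively
  open faces the outer normal is unique.\<close>

definition face :: "('n \<Rightarrow> nat) \<Rightarrow> 'n \<times> real \<Rightarrow> (real ^ 'n) set" where
  "face N p = flat_box (axis (fst p) (snd p * real (N (fst p)))) (\<chi> j. if j = fst p then 0 else real (N j))"

lemma mem_face:
  assumes "\<And>j. N j > 0"
  shows "x \<in> face N (i, s) \<longleftrightarrow> x $ i = s * real (N i) \<and> (\<forall>j. j \<noteq> i \<longrightarrow> \<bar>x $ j\<bar> < real (N j))"
  using assms by (auto simp: face_def mem_flat_box axis_def)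

lemma norm_axis_real: "norm (axis i (s :: real)) = \<bar>s\<bar>"
  by (simp add: norm_eq_sqrt_inner inner_axis_axis)

lemma outer_normal_int_box:
  assumes s: "s = 1 \<or> s = - 1" and x: "x \<in> int_box N" "x $ i = s * real (N i)"
  shows "is_outer_normal (int_box N) x (axis i s)"
  unfolding is_outer_normal_def
proof (intro conjI ballI)
  show "norm (axis i s) = 1" using s by (auto simp: norm_axis_real)
  fix y assume "y \<in> int_box N"
  then have "\<bar>y $ i\<bar> \<le> real (N i)" by (simp add: mem_int_box)
  then show "(y - x) \<bullet> axis i s \<le> 0" using s x(2) by (auto simp: inner_axis)
qed

text \<open>From a relatively interior point of a face one can move both ways along every other
  axis, which annihilates those components of v; a move inward determines the sign of the remaining
  one.\<close>

lemma outer_normal_face: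
  fixes x :: "real ^ 'n"
  assumes N: "\<And>j. N j > 0" and s: "s = 1 \<or> s = - 1" and x: "x \<in> face N (i, s)"
    and v: "is_outer_normal (int_box N) x v"
  shows "v = axis i s"
proof -
  have xi: "x $ i = s * real (N i)" and xj: "\<And>j. j \<noteq> i \<Longrightarrow> \<bar>x $ j\<bar> < real (N j)"
    using x mem_face[where N = N, OF N] by auto
  have xb: "\<bar>x $ j\<bar> \<le> real (N j)" for j using xi xj[of j] s by (cases "j = i") auto
  have move: "\<epsilon> * v $ j \<le> 0" if "\<bar>x $ j + \<epsilon>\<bar> \<le> real (N j)" for j \<epsilon>
  proof -
    have "x + axis j \<epsilon> \<in> int_box N" using that xb by (auto simp: mem_int_box axis_def)
    then have "(x + axis j \<epsilon> - x) \<bullet> v \<le> 0" using v unfolding is_outer_normal_def by blast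
    then show ?thesis by (simp add: inner_axis')
  qed
  have vj: "v $ j = 0" if "j \<noteq> i" for j
  proof -
    define \<epsilon> where "\<epsilon> = real (N j) - \<bar>x $ j\<bar>"
    have \<epsilon>: "\<epsilon> > 0" using xj[OF that] by (simp add: \<epsilon>_def)
    have "\<bar>x $ j + \<epsilon>\<bar> \<le> real (N j)" "\<bar>x $ j + - \<epsilon>\<bar> \<le> real (N j)"
      using \<epsilon> unfolding \<epsilon>_def by linarith+
    from this[THEN move] have "\<epsilon> * v $ j \<le> 0" "(- \<epsilon>) * v $ j \<le> 0" .
    then show ?thesis using \<epsilon> by (simp add: mult_le_0_iff zero_le_mult_iff)
  qed
  have "(- s) * v $ i \<le> 0"
  proof (rule move)
    have "real (N i) \<ge> 1" using N[of i] by simp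
    then show "\<bar>x $ i + - s\<bar> \<le> real (N i)" using s xi by auto
  qed
  moreover have "v = axis i (v $ i)" using vj by (auto simp: vec_eq_iff axis_def)
  moreover have "norm v = 1" using v by (simp add: is_outer_normal_def)
  ultimately have "\<bar>v $ i\<bar> = 1" "s * v $ i \<ge> 0" by (metis norm_axis_real, simp)
  then have "v $ i = s" using s by (auto simp: abs_if split: if_splits)
  then show ?thesis using \<open>v = axis i (v $ i)\<close> by simp
qed

text \<open>A boundary point at which two coordinates are extremal has two different axis vectors as
  normals. The Gauss map is therefore defined exactly on the open faces and is constant on
  each.\<close>

lemma gauss_int_box:
  fixes N :: "'n::finite \<Rightarrow> nat"
  assumes N: "\<And>j. N j > 0"
  shows "{x \<in> gauss_domain (int_box N). gauss_map (int_box N) x \<in> \<omega>} =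
    (\<Union>p\<in>{p \<in> UNIV \<times> {1, - 1}. axis (fst p) (snd p) \<in> \<omega>}. face N p)"
proof -
  have ax: "i = k \<and> s = t" if "axis i s = (axis k t :: real ^ 'n)" "s = 1 \<or> s = - 1" for i k :: 'n and s t :: real
    using that by (auto simp: axis_eq_axis)
  have on: "x \<in> gauss_domain (int_box N) \<and> gauss_map (int_box N) x = axis i s"
    if s: "s = 1 \<or> s = - 1" and x: "x \<in> face N (i, s)" for x i s
  proof -
    have xi: "x $ i = s * real (N i)" and xj: "\<And>j. j \<noteq> i \<Longrightarrow> \<bar>x $ j\<bar> < real (N j)"
      using x mem_face[where N = N, OF N] by auto
    have xb: "\<bar>x $ j\<bar> \<le> real (N j)" for j using xi xj[of j] s by (cases "j = i") auto
    then have xK: "x \<in> int_box N" by (simp add: mem_int_box)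
    have "x \<notin> interior (int_box N)" using xi s by (auto simp: interior_int_box intro!: exI[of _ i])
    then have fr: "x \<in> frontier (int_box N)" using xK closure_subset by (auto simp: frontier_def)
    have nrm: "is_outer_normal (int_box N) x (axis i s)" by (rule outer_normal_int_box[OF s xK xi])
    have uniq: "\<And>v. is_outer_normal (int_box N) x v \<Longrightarrow> v = axis i s"
      by (rule outer_normal_face[where N = N, OF N s x])
    have "gauss_map (int_box N) x = axis i s"
      unfolding gauss_map_def by (rule the_equality, rule nrm, rule uniq)
    moreover have "\<exists>!v. is_outer_normal (int_box N) x v" by (rule ex1I, rule nrm, rule uniq)
    ultimately show ?thesis using fr by (simp add: gauss_domain_def)
  qed
  have ex: "\<exists>i s. (s = 1 \<or> s = - 1) \<and> x \<in> face N (i, s)" if x: "x \<in> gauss_domain (int_box N)" for x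
  proof -
    have fr: "x \<in> frontier (int_box N)" and uniq: "\<exists>!v. is_outer_normal (int_box N) x v"
      using x by (auto simp: gauss_domain_def)
    have "closed (int_box N)" unfolding int_box_def by (rule closed_cbox)
    then have xK: "x \<in> int_box N" and "x \<notin> interior (int_box N)" using fr by (auto simp: frontier_def)
    then obtain i where i: "\<not> \<bar>x $ i\<bar> < real (N i)" by (auto simp: interior_int_box)
    have sg: "\<exists>s. (s = 1 \<or> s = - 1) \<and> x $ j = s * real (N j)" if "\<not> \<bar>x $ j\<bar> < real (N j)" for j
    proof -
      have "\<bar>x $ j\<bar> \<le> real (N j)" using xK by (simp add: mem_int_box)
      then have "x $ j = 1 * real (N j) \<or> x $ j = - 1 * real (N j)" using that by linarith
      then show ?thesis by blast
    qed
    obtain s where s: "s = 1 \<or> s = - 1" "x $ i = s * real (N i)" using sg[OF i] by blast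
    have "\<bar>x $ j\<bar> < real (N j)" if "j \<noteq> i" for j
    proof (rule ccontr)
      assume "\<not> \<bar>x $ j\<bar> < real (N j)"
      then obtain t where t: "t = 1 \<or> t = - 1" "x $ j = t * real (N j)" using sg by blast
      have "axis i s = axis j t"
        using uniq outer_normal_int_box[OF s(1) xK s(2)] outer_normal_int_box[OF t(1) xK t(2)] by blast
      then show False using ax s(1) that by blast
    qed
    then have "x \<in> face N (i, s)" using s mem_face[where N = N, OF N] by blast
    then show ?thesis using s by blast
  qed
  show ?thesis
  proof (intro set_eqI iffI)
    fix x assume "x \<in> {x \<in> gauss_domain (int_box N). gauss_map (int_box N) x \<in> \<omega>}"
    then have x: "x \<in> gauss_domain (int_box N)" "gauss_map (int_box N) x \<in> \<omega>" by auto
    obtain i s where js: "s = 1 \<or> s = - 1" "x \<in> face N (i, s)" using ex[OF x(1)] by blast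
    then have "axis i s \<in> \<omega>" using on[OF js] x(2) by simp
    then show "x \<in> (\<Union>p\<in>{p \<in> UNIV \<times> {1, - 1}. axis (fst p) (snd p) \<in> \<omega>}. face N p)"
      using js by (intro UN_I[of "(i, s)"]) auto
  next
    fix x assume "x \<in> (\<Union>p\<in>{p \<in> UNIV \<times> {1, - 1}. axis (fst p) (snd p) \<in> \<omega>}. face N p)"
    then obtain i s where js: "s = 1 \<or> s = - 1" "x \<in> face N (i, s)" "axis i s \<in> \<omega>" by auto
    then show "x \<in> {x \<in> gauss_domain (int_box N). gauss_map (int_box N) x \<in> \<omega>}"
      using on[OF js(1,2)] by simp
  qed
qed

text \<open>All faces are measured in copies of one reference face, whose measure is kept as a
  factor. The index k of this face is arbitrary, as permuting coordinates is an isometry.\<close>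

lemma surface_area_measure_int_box:
  fixes N :: "'n::finite \<Rightarrow> nat" and k :: 'n
  assumes N: "\<And>j. N j > 0"
  shows "surface_area_measure (int_box N) \<omega> =
    (\<Sum>p\<in>{p \<in> UNIV \<times> {1, - 1}. axis (fst p) (snd p) \<in> \<omega>}.
      of_nat (\<Prod>j\<in>UNIV - {fst p}. N j) * hausdorff_measure (DIM(real ^ 'n) - 1) (flat_box 0 (unit_face k)))"
proof -
  let ?D = "{p \<in> UNIV \<times> {1, - 1}. axis (fst p) (snd p) \<in> \<omega>}" and ?d = "DIM(real ^ 'n) - 1"
  have "finite (UNIV \<times> {1, - 1} :: ('n \<times> real) set)" by simp
  then have D: "finite ?D" by (rule finite_subset[rotated]) blast
  have dj: "disjoint_family_on (face N) ?D"
    unfolding disjoint_family_on_def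
  proof (intro ballI impI)
    fix p q assume pq: "p \<in> ?D" "q \<in> ?D" "p \<noteq> q"
    obtain i s i' t where eq: "p = (i, s)" "q = (i', t)" by (cases p, cases q)
    have st: "s = 1 \<or> s = - 1" "t = 1 \<or> t = - 1" using pq eq by auto
    have False if "x \<in> face N (i, s)" "x \<in> face N (i', t)" for x
    proof -
      have x: "x $ i = s * real (N i)" "x $ i' = t * real (N i')" "i' \<noteq> i \<Longrightarrow> \<bar>x $ i'\<bar> < real (N i')"
        using that mem_face[where N = N, OF N] by auto
      show False
      proof (cases "i' = i")
        case True
        then have "s = t" using x(1,2) N[of i] by simp
        then show False using True eq pq(3) by simp
      next
        case False
        then show False using x(2,3) st by auto
      qed
    qed
    then show "face N p \<inter> face N q = {}" unfolding eq by blast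
  qed
  have "surface_area_measure (int_box N) \<omega> = hausdorff_measure ?d (\<Union>p\<in>?D. face N p)"
    unfolding surface_area_measure_def gauss_int_box[where N = N, OF N] ..
  also have "\<dots> = (\<Sum>p\<in>?D. hausdorff_measure ?d (face N p))"
    unfolding face_def by (rule flat_box_measure_additive[OF D dj[unfolded face_def]]) simp
  also have "\<dots> = (\<Sum>p\<in>?D. of_nat (\<Prod>j\<in>UNIV - {fst p}. N j) * hausdorff_measure ?d (flat_box 0 (unit_face k)))"
  proof (rule sum.cong[OF refl])
    fix p
    show "hausdorff_measure ?d (face N p) = of_nat (\<Prod>j\<in>UNIV - {fst p}. N j) * hausdorff_measure ?d (flat_box 0 (unit_face k))"
      unfolding face_def hausdorff_measure_unit_face[of ?d k "fst p"]
      by (rule hausdorff_measure_flat_box_tiling) (rule N)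
  qed
  finally show ?thesis .
qed

lemma is_blaschke_sum_int_box:
  fixes K L M :: "'n::finite \<Rightarrow> nat"
  assumes "\<And>j. K j > 0" "\<And>j. L j > 0" "\<And>j. M j > 0"
    and area: "\<And>i. (\<Prod>j\<in>UNIV - {i}. M j) = (\<Prod>j\<in>UNIV - {i}. K j) + (\<Prod>j\<in>UNIV - {i}. L j)"
  shows "is_blaschke_sum (int_box K) (int_box L) (int_box M)"
  unfolding is_blaschke_sum_def
proof (intro conjI ballI impI convex_body_int_box assms)
  fix \<omega> :: "(real ^ 'n) set"
  show "surface_area_measure (int_box M) \<omega> = surface_area_measure (int_box K) \<omega> + surface_area_measure (int_box L) \<omega>"
    \<comment> \<open>\<open>undefined\<close> is just some index: the three boxes only have to
      share the same reference face.\<close>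
    unfolding surface_area_measure_int_box[where N = K and k = undefined, OF assms(1)]
      surface_area_measure_int_box[where N = L and k = undefined, OF assms(2)]
      surface_area_measure_int_box[where N = M and k = undefined, OF assms(3)] area
    by (simp only: of_nat_add distrib_right sum.distrib)
qed

section \<open>The counterexample\<close>

lemma newtonian_capacity_homogeneous:
  fixes K :: "(real ^ 3) set"
  assumes K: "convex_body K" and t: "t > 0"
  shows "newtonian_capacity ((\<lambda>x. t *\<^sub>R x) ` K) = ennreal t * newtonian_capacity K"
proof -
  have cK: "compact K" using K by (simp add: convex_body_def)
  then obtain R where R: "R > 0" "K \<subseteq> cball 0 R"
    using compact_imp_bounded bounded_pos by (metis mem_cball_0 subsetI)
  obtain u where "is_electrostatic_potential K u"
    by (rule electrostatic_potential_exists[OF K R(2,1)]) blast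
  then show ?thesis by (rule newtonian_capacity_scaleR[OF _ compact_imp_closed[OF cK] t])
qed

lemma ennreal_power2_strict_mono:
  fixes a b :: ennreal
  assumes "a < b"
  shows "a\<^sup>2 < b\<^sup>2"
proof (cases "b = top")
  case True
  then show ?thesis using assms by (simp add: power2_eq_square ennreal_mult_less_top ennreal_mult_top)
next
  case False
  then obtain x y where "a = ennreal x" "b = ennreal y" "0 \<le> x" "0 \<le> y"
    using assms by (cases a; cases b) auto
  then show ?thesis
    using assms by (simp add: ennreal_power ennreal_less_iff power_strict_mono)
qed

theorem proposition2p5:
  shows "(\<forall>(K :: (real ^ 3) set) (t :: real). convex_body K \<and> t > 0 \<longrightarrow>
            newtonian_capacity ((\<lambda>x. t *\<^sub>R x) ` K) = ennreal t * newtonian_capacity K) \<and>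
         \<not> (\<forall>(K :: (real ^ 3) set) (L :: (real ^ 3) set) (M :: (real ^ 3) set).
               convex_body K \<and> convex_body L \<and> is_blaschke_sum K L M \<longrightarrow>
               (newtonian_capacity M)\<^sup>2 \<ge> (newtonian_capacity K)\<^sup>2 + (newtonian_capacity L)\<^sup>2)"
proof (intro conjI notI)
  show "\<forall>(K :: (real ^ 3) set) (t :: real). convex_body K \<and> t > 0 \<longrightarrow>
      newtonian_capacity ((\<lambda>x. t *\<^sub>R x) ` K) = ennreal t * newtonian_capacity K"
    using newtonian_capacity_homogeneous by blast
next
  assume KS: "\<forall>(K :: (real ^ 3) set) (L :: (real ^ 3) set) (M :: (real ^ 3) set).
      convex_body K \<and> convex_body L \<and> is_blaschke_sum K L M \<longrightarrow>
      (newtonian_capacity M)\<^sup>2 \<ge> (newtonian_capacity K)\<^sup>2 + (newtonian_capacity L)\<^sup>2"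
  \<comment> \<open>The numerator is the lower bound for the needle with half-edges 4 k^3, 2 k, 2 k,
    whose ratio is 2 k^2. The denominator is the radius of a ball about the sum: its half-edges add
    up to 10 k^2 + 1 \<le> 11 k^2. The quotient grows like k / ln k and so passes
    \<open>cap_const\<close>.\<close>
  have "filterlim (\<lambda>k::nat. 4 * real k ^ 3 / (6 * ln (1 + 2 * real k ^ 2)) / (11 * real k ^ 2)) at_top sequentially"
    by real_asymp
  then have "\<forall>\<^sub>F k in sequentially. 4 * real k ^ 3 / (6 * ln (1 + 2 * real k ^ 2)) / (11 * real k ^ 2) > cap_const \<and> k \<ge> 1"
    by (intro eventually_conj eventually_ge_at_top) (simp add: filterlim_at_top_dense)
  then obtain k :: nat where k: "4 * real k ^ 3 / (6 * ln (1 + 2 * real k ^ 2)) / (11 * real k ^ 2) > cap_const" "k \<ge> 1"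
    by (auto simp: eventually_sequentially)
  txt \<open>The half-sizes are scaled to integers. A quarter of the face areas is \<open>(4k\<^sup>2, 8k\<^sup>4, 8k\<^sup>4)\<close>
    for \<open>K\<close>, \<open>(8k\<^sup>4, 4k\<^sup>2, 8k\<^sup>4)\<close> for \<open>L\<close> and \<open>(8k\<^sup>4 + 4k\<^sup>2, 8k\<^sup>4 + 4k\<^sup>2, 16k\<^sup>4)\<close> for \<open>M\<close>.\<close>
  define K L M :: "3 \<Rightarrow> nat" where
    "K i = (if i = 1 then 4 * k ^ 3 else 2 * k)" and
    "L i = (if i = 2 then 4 * k ^ 3 else 2 * k)" and
    "M i = (if i = 3 then 2 * k ^ 2 + 1 else 4 * k ^ 2)" for i
  have pos: "K i > 0" "L i > 0" "M i > 0" for i using k(2) by (auto simp: K_def L_def M_def)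
  have area: "(\<Prod>j\<in>UNIV - {i}. M j) = (\<Prod>j\<in>UNIV - {i}. K j) + (\<Prod>j\<in>UNIV - {i}. L j)" for i
  proof -
    have u: "UNIV - {1} = {2, 3 :: 3}" "UNIV - {2} = {1, 3 :: 3}" "UNIV - {3} = {1, 2 :: 3}"
      unfolding UNIV_3 by auto
    consider "i = 1" | "i = 2" | "i = 3" using exhaust_3 by blast
    then show ?thesis
      by cases (simp_all add: u K_def L_def M_def power2_eq_square power3_eq_cube algebra_simps)
  qed
  have blaschke: "is_blaschke_sum (int_box K) (int_box L) (int_box M)"
    by (rule is_blaschke_sum_int_box) (rule pos area)+
  \<comment> \<open>The capacity of the second needle is dropped, since a single needle already
    exceeds the sum.\<close>
  have le: "(newtonian_capacity (int_box K))\<^sup>2 \<le> (newtonian_capacity (int_box M))\<^sup>2"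
  proof -
    have "(newtonian_capacity (int_box K))\<^sup>2 + (newtonian_capacity (int_box L))\<^sup>2 \<le> (newtonian_capacity (int_box M))\<^sup>2"
      using KS blaschke convex_body_int_box[where N = K, OF pos(1)] convex_body_int_box[where N = L, OF pos(2)] by blast
    then show ?thesis by (rule order_trans[rotated]) simp
  qed
  have Kbody: "convex_body (int_box K)" by (rule convex_body_int_box) (rule pos)
  define h :: "real ^ 3" where "h = vector [4 * real k ^ 3, 2 * real k, 2 * real k]"
  have Kbox: "int_box K = centered_box h"
  proof -
    have "(\<chi> j. real (K j)) = h" by (simp add: h_def vec_eq_iff forall_3 vector_3 K_def)
    then show ?thesis by (simp add: int_box_def)
  qed
  have "compact (int_box K)" using Kbody by (simp add: convex_body_def)
  then obtain R where R: "R > 0" "int_box K \<subseteq> cball 0 R"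
    using compact_imp_bounded bounded_pos by (metis mem_cball_0 subsetI)
  obtain u g where u: "is_electrostatic_potential (int_box K) u"
    and g: "\<And>x. x \<notin> int_box K \<Longrightarrow> GDERIV u x :> g x" "continuous_on (- int_box K) g"
    by (rule electrostatic_potential_exists[OF Kbody R(2,1)]) blast
  have k1: "real k \<ge> 1" using k(2) by simp
  have k13: "2 * real k \<le> 4 * real k ^ 3"
  proof -
    have "real k \<le> real k ^ 3" using k1 by (intro self_le_power) auto
    then show ?thesis using k1 by linarith
  qed
  have "ennreal (4 * real k ^ 3 / (6 * ln (1 + 4 * real k ^ 3 / (2 * real k)))) \<le> newtonian_capacity (int_box K)"
    unfolding Kbox h_def
    by (rule newtonian_capacity_needle_ge[OF _ k13]) (use k1 u g Kbox h_def in auto)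
  also have "4 * real k ^ 3 / (2 * real k) = 2 * real k ^ 2"
    using k1 by (simp add: power2_eq_square power3_eq_cube)
  finally have lower: "ennreal (4 * real k ^ 3 / (6 * ln (1 + 2 * real k ^ 2))) \<le> newtonian_capacity (int_box K)" .
  have Msub: "int_box M \<subseteq> cball 0 (11 * real k ^ 2)"
  proof
    fix x assume x: "x \<in> int_box M"
    have "norm x \<le> (\<Sum>i\<in>UNIV. \<bar>x $ i\<bar>)" by (rule norm_le_l1_cart)
    also have "\<dots> \<le> (\<Sum>i\<in>UNIV. real (M i))" using x by (intro sum_mono) (simp add: mem_int_box)
    also have "\<dots> = 10 * real k ^ 2 + 1" by (simp add: sum_3 M_def)
    also have "\<dots> \<le> 11 * real k ^ 2" using k1 by (simp add: one_le_power)
    finally show "x \<in> cball 0 (11 * real k ^ 2)" by simp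
  qed
  have upper: "newtonian_capacity (int_box M) \<le> ennreal (cap_const * (11 * real k ^ 2))"
    by (rule newtonian_capacity_le[OF convex_body_int_box Msub]) (use pos k1 in auto)
  have cc: "cap_const \<ge> 0" using newton_const_pos by (simp add: cap_const_def)
  have "cap_const * (11 * real k ^ 2) < 4 * real k ^ 3 / (6 * ln (1 + 2 * real k ^ 2))"
  proof -
    have "0 < 11 * real k ^ 2" using k1 by simp
    from k(1)[unfolded pos_less_divide_eq[OF this]] show ?thesis .
  qed
  then have "ennreal (cap_const * (11 * real k ^ 2)) < ennreal (4 * real k ^ 3 / (6 * ln (1 + 2 * real k ^ 2)))"
    using cc by (intro ennreal_lessI) (auto intro: le_less_trans[rotated])
  then have "newtonian_capacity (int_box M) < newtonian_capacity (int_box K)"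
    using upper lower by (metis le_less_trans less_le_trans)
  then have "(newtonian_capacity (int_box M))\<^sup>2 < (newtonian_capacity (int_box K))\<^sup>2"
    by (rule ennreal_power2_strict_mono)
  then show False using le by simp
qed

end
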